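(* For every real $\kappa\le 3/2$, unconditionally, \[ \int_1^x\frac{M(u)}{u^\kappa}du - c_\kappa = \Omega_{\pm}\big(x^{3/2-\kappa}\big), \] where $c_\kappa=\frac{2}{\zeta(1/2)}$ if $\kappa=3/2$ and $c_\kappa=0$ otherwise. In particular, \[ \int_1^\infty\frac{|M(x)|}{x^{3/2}}dx=\infty. \]
   Context: $\mu(n)$ is the Möbius function and $M(x)=\sum_{n\le x}\mu(n)$. $f(x)=\Omega_{\pm}(g(x))$ (with $g>0$) means $\limsup_{x\to\infty} f(x)/g(x)>0$ and $\liminf_{x\to\infty} f(x)/g(x)<0$. *)

theory Defs
  imports
    "HOL-Complex_Analysis.Complex_Analysis"
    "HOL-Computational_Algebra.Squarefree"
begin

definition moebius_mu :: "nat \<Rightarrow> int" where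
  "moebius_mu n = (if squarefree n then (-1) ^ card (prime_factors n) else 0)"

(* The index set is empty for x < 1, since nat sends negative integers to 0. *)
definition mertens :: "real \<Rightarrow> real" where
  "mertens x = (\<Sum>n = 1..nat \<lfloor>x\<rfloor>. real_of_int (moebius_mu n))"

(* The Riemann zeta function: the analytic continuation of the Dirichlet series
   1 + 2^(-s) + 3^(-s) + ... to all complex numbers other than 1.  The value at the pole is
   normalised to 0, which makes the function unique as a total function.  Since zeta is real on
   the real axis, Re (zeta x) is the real number zeta(x) for real x. *)
definition zeta :: "complex \<Rightarrow> complex" where
  "zeta = (THE f. f holomorphic_on (- {1}) \<and>
                  (\<forall>s. Re s > 1 \<longrightarrow> (\<lambda>n. 1 / of_nat (Suc n) powr s) sums f s) \<and>
                  f 1 = 0)"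

definition omega_pm :: "(real \<Rightarrow> real) \<Rightarrow> (real \<Rightarrow> real) \<Rightarrow> bool" where
  "omega_pm f g \<longleftrightarrow>
     (\<forall>\<^sub>F x in at_top. g x > 0) \<and>
     Limsup at_top (\<lambda>x. ereal (f x / g x)) > 0 \<and>
     Liminf at_top (\<lambda>x. ereal (f x / g x)) < 0"

end

theory Submission
  imports Defs "HOL-Real_Asymp.Real_Asymp"
begin

text \<open>
  Landau's method.  If the error term were eventually at most \<open>\<epsilon> x\<^bsup>3/2-\<kappa>\<^esup>\<close>
  on one side, then its difference from this bound would be non-negative, so by Landau's theorem its
  Mellin transform converges up to the first real singularity of
  \<open>1 / (s (s-\<kappa>+1) \<zeta>(s))\<close>, which is at most \<open>1/2\<close> because \<open>\<zeta>\<close> has no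
  real zeros in \<open>[1/2, 1)\<close>; subtracting \<open>c\<^sub>\<kappa>\<close> removes the pole at \<open>1/2\<close>
  that appears for \<open>\<kappa> = 3/2\<close>.  Hence \<open>\<zeta>\<close> has no zeros to the right of the critical
  line, and comparing the transform at \<open>\<rho> + \<delta>\<close> and at \<open>1/2 + \<delta>\<close> as
  \<open>\<delta> \<rightarrow> 0\<close> bounds the residue at a zero \<open>\<rho>\<close> on the critical line by \<open>\<epsilon>\<close>.
  This is absurd for small \<open>\<epsilon>\<close> as soon as one zero with real part at least \<open>1/2\<close> exists.

  Such a zero exists because otherwise, by the functional equation, \<open>\<xi>\<close> would be an entire
  function of order less than 2 without zeros, hence \<open>exp (a + b s)\<close>; the symmetry
  \<open>\<xi>(0) = \<xi>(1) = 1/2\<close> would then force \<open>\<xi>(2) = \<pi>/6\<close> to be \<open>1/2\<close> too.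
\<close>

section \<open>Holomorphic integral transforms\<close>

text \<open>All work is done with \<open>zeta_reg\<close>, which is (s - 1) zeta(s): the point 1
  becomes harmless and 1/zeta turns into (s - 1) / \<open>zeta_reg\<close> s. The functional
  equation serves twice. It continues zeta to the whole punctured plane, which the definite
  description in \<open>zeta\<close> demands, and it carries an assumed zero-free half-plane Re s
  \<ge> 1/2 over to all of the plane. It is derived from the Mellin transform of 1/(exp x - 1),
  because for real s every interchange there concerns nonnegative terms; the identity theorem then
  passes to complex s. In the oscillation argument, Landau's theorem acts on the real axis only;
  convergence there gives holomorphy of the transform in a half-plane, and positivity bounds its
  modulus by its value at the real part. The resulting identity is cleared of denominators before s
  approaches a zero \<rho>, so the derivative of \<open>zeta_reg\<close> at \<rho> ends up as a
  factor of the larger side, and a multiple zero needs no separate treatment.\<close>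

text \<open>Reduces complex identities to real arguments, where integrands are nonnegative. The
  midpoint of the interval is the accumulation point required by the identity theorem.\<close>

lemma holomorphic_eq_if_eq_on_reals:
  assumes "f holomorphic_on S" "g holomorphic_on S" "open S" "connected S"
    and ab: "a < b" and sub: "of_real ` {a<..<b} \<subseteq> S"
    and eq: "\<And>x. a < x \<Longrightarrow> x < b \<Longrightarrow> f (of_real x) = g (of_real x)"
    and "z \<in> S"
  shows "f z = g (z :: complex)"
proof -
  define c where "c = (a + b) / 2"
  have c: "a < c" "c < b" using ab by (auto simp: c_def)
  have lim: "complex_of_real c islimpt of_real ` {a<..<b}"
    unfolding islimpt_approachable
  proof (intro allI impI)
    fix e :: real assume "e > 0"
    define d where "d = min (e / 2) ((b - c) / 2)"
    have "d > 0" "d < e" "c + d < b" using \<open>e > 0\<close> c by (auto simp: d_def min_def field_simps)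
    thus "\<exists>x'\<in>of_real ` {a<..<b}. x' \<noteq> complex_of_real c \<and> dist x' (of_real c) < e"
      using c by (intro bexI[of _ "of_real (c + d)"] imageI) (auto simp: dist_norm)
  qed
  have "f z - g z = 0"
    by (rule analytic_continuation[where f = "\<lambda>z. f z - g z" and S = S and \<xi> = "of_real c" and U = "of_real ` {a<..<b}"])
       (use assms c lim in \<open>auto intro!: holomorphic_intros\<close>)
  thus ?thesis by simp
qed

text \<open>The absolute values of the terms f (z g)^n / n! add up to exactly |f| exp(|z| |g|), so
  the single integrability assumption dominates all partial sums at once.\<close>

lemma exp_integral_power_series:
  fixes f :: "'a \<Rightarrow> complex" and g :: "'a \<Rightarrow> real" and z :: complex
  assumes [measurable]: "f \<in> borel_measurable M" "g \<in> borel_measurable M"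
    and int: "integrable M (\<lambda>x. norm (f x) * exp (norm z * \<bar>g x\<bar>))"
  shows "integrable M (\<lambda>x. f x * exp (z * g x))"
    and "integrable M (\<lambda>x. f x * of_real (g x) ^ n / fact n * z ^ n)"
    and "(\<lambda>n. (\<integral>x. f x * of_real (g x) ^ n / fact n \<partial>M) * z ^ n) sums (\<integral>x. f x * exp (z * g x) \<partial>M)"
proof -
  define u where "u = (\<lambda>n x. f x * of_real (g x) ^ n / fact n * z ^ n)"
  have exps: "(\<lambda>n. u n x) sums (f x * exp (z * g x))" for x
  proof -
    have "(\<lambda>n. f x * ((z * of_real (g x)) ^ n /\<^sub>R fact n)) sums (f x * exp (z * g x))"
      by (intro sums_mult exp_converges)
    thus ?thesis
      by (simp add: u_def scaleR_conv_of_real field_simps)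
  qed
  have normu: "norm (u n x) = norm (f x) * ((norm z * \<bar>g x\<bar>) ^ n /\<^sub>R fact n)" for n x
    by (simp add: u_def norm_mult norm_divide norm_power field_simps)
  have expn: "(\<lambda>n. norm (u n x)) sums (norm (f x) * exp (norm z * \<bar>g x\<bar>))" for x
    unfolding normu by (intro sums_mult exp_converges)
  have meas [measurable]: "u n \<in> borel_measurable M" for n
    unfolding u_def by measurable
  have part: "(\<Sum>n<N. norm (u n x)) \<le> norm (f x) * exp (norm z * \<bar>g x\<bar>)" for N :: nat and x
    using expn[of x] by (metis norm_ge_zero sum_le_suminf sums_iff finite_lessThan)
  have single: "norm (u n x) \<le> norm (f x) * exp (norm z * \<bar>g x\<bar>)" for n x
    using part[of x "Suc n"] sum_nonneg[of "{..<n}" "\<lambda>n. norm (u n x)"] by (simp add: sum.lessThan_Suc) 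
  have intu: "integrable M (u n)" for n
    by (rule Bochner_Integration.integrable_bound[OF int]) (use single in auto)
  show "integrable M (\<lambda>x. f x * of_real (g x) ^ n / fact n * z ^ n)"
    using intu[of n] by (simp add: u_def)
  show "integrable M (\<lambda>x. f x * exp (z * g x))"
  proof (rule Bochner_Integration.integrable_bound[OF int])
    show "AE x in M. norm (f x * exp (z * complex_of_real (g x))) \<le> norm (norm (f x) * exp (norm z * \<bar>g x\<bar>))"
    proof (intro AE_I2)
      fix x
      have "norm (exp (z * complex_of_real (g x))) \<le> exp (norm (z * complex_of_real (g x)))"
        by (rule norm_exp)
      thus "norm (f x * exp (z * complex_of_real (g x))) \<le> norm (norm (f x) * exp (norm z * \<bar>g x\<bar>))"
        by (simp add: norm_mult mult_left_mono)
    qed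
  qed measurable
  have "(\<lambda>n. integral\<^sup>L M (u n)) sums (\<integral>x. (\<Sum>n. u n x) \<partial>M)"
  proof (rule sums_integral[OF intu])
    show "AE x in M. summable (\<lambda>n. norm (u n x))"
      using expn by (auto simp: sums_iff)
    show "summable (\<lambda>n. \<integral>x. norm (u n x) \<partial>M)"
    proof (rule bounded_imp_summable)
      fix N
      have "(\<Sum>n\<le>N. \<integral>x. norm (u n x) \<partial>M) = (\<integral>x. (\<Sum>n\<le>N. norm (u n x)) \<partial>M)"
        using intu by (subst Bochner_Integration.integral_sum) auto
      also have "\<dots> \<le> (\<integral>x. norm (f x) * exp (norm z * \<bar>g x\<bar>) \<partial>M)"
      proof (rule integral_mono)
        show "integrable M (\<lambda>x. \<Sum>n\<le>N. norm (u n x))" using intu by auto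
        show "(\<Sum>n\<le>N. norm (u n x)) \<le> norm (f x) * exp (norm z * \<bar>g x\<bar>)" for x
          using part[of x "Suc N"] by (simp add: lessThan_Suc_atMost)
      qed (use int in auto)
      finally show "(\<Sum>n\<le>N. \<integral>x. norm (u n x) \<partial>M) \<le> \<dots>" .
    qed auto
  qed
  moreover have "(\<Sum>n. u n x) = f x * exp (z * g x)" for x
    using exps[of x] by (simp add: sums_iff)
  moreover have "integral\<^sup>L M (u n) = (\<integral>x. f x * of_real (g x) ^ n / fact n \<partial>M) * z ^ n" for n
    unfolding u_def by simp
  ultimately show "(\<lambda>n. (\<integral>x. f x * of_real (g x) ^ n / fact n \<partial>M) * z ^ n) sums (\<integral>x. f x * exp (z * g x) \<partial>M)"
    by simp
qed

text \<open>Expand around c by writing exp(s g) as exp(c g) exp((s - c) g). Since g may change sign,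
  as ln does, the majorant exp(Re c g + r |g|) is bounded by the sum of the two exponentials at Re c
  - r and Re c + r. Extended real bounds cover strips and half-planes together.\<close>

lemma exp_integral_holomorphic:
  fixes f :: "'a \<Rightarrow> complex" and g :: "'a \<Rightarrow> real" and a b :: ereal
  assumes [measurable]: "f \<in> borel_measurable M" "g \<in> borel_measurable M"
    and int: "\<And>\<sigma>. a < ereal \<sigma> \<Longrightarrow> ereal \<sigma> < b \<Longrightarrow> integrable M (\<lambda>x. norm (f x) * exp (\<sigma> * g x))"
  shows "(\<lambda>s. \<integral>x. f x * exp (s * g x) \<partial>M) holomorphic_on {s. a < ereal (Re s) \<and> ereal (Re s) < b}"
proof -
  let ?S = "{s. a < ereal (Re s) \<and> ereal (Re s) < b}"
  have "\<exists>r>0. (\<lambda>s. \<integral>x. f x * exp (s * g x) \<partial>M) holomorphic_on ball c r" if c: "c \<in> ?S" for c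
  proof -
    obtain r1 where r1: "a < ereal r1" "r1 < Re c"
      using c ereal_dense2[of a "Re c"] by auto
    obtain r2 where r2: "ereal r2 < b" "Re c < r2"
      using c ereal_dense2[of "Re c" b] by auto
    define r where "r = min (Re c - r1) (r2 - Re c)"
    have r: "r > 0" "r1 \<le> Re c - r" "Re c + r \<le> r2"
      using r1 r2 by (auto simp: r_def)
    have ab: "a < ereal (Re c - r)" "ereal (Re c - r) < b" "a < ereal (Re c + r)" "ereal (Re c + r) < b"
      using r r1 r2 by (metis ereal_less_eq(3) order.strict_trans1 order.strict_trans2 diff_gt_0_iff_gt
          diff_less_eq less_add_same_cancel1 less_ereal.simps(1) order.strict_trans)+
    define F where "F = (\<lambda>x. f x * exp (c * g x))"
    have [measurable]: "F \<in> borel_measurable M" unfolding F_def by measurable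
    have intF: "integrable M (\<lambda>x. norm (F x) * exp (norm z * \<bar>g x\<bar>))" if "norm z < r" for z :: complex
    proof (rule Bochner_Integration.integrable_bound)
      show "integrable M (\<lambda>x. norm (f x) * exp ((Re c - r) * g x) + norm (f x) * exp ((Re c + r) * g x))"
        using int[OF ab(1,2)] int[OF ab(3,4)] by simp
      show "AE x in M. norm (norm (F x) * exp (norm z * \<bar>g x\<bar>))
         \<le> norm (norm (f x) * exp ((Re c - r) * g x) + norm (f x) * exp ((Re c + r) * g x))"
      proof (intro AE_I2)
        fix x
        have "norm z * \<bar>g x\<bar> \<le> r * \<bar>g x\<bar>"
          using that by (intro mult_right_mono) auto
        hence "exp (Re c * g x + norm z * \<bar>g x\<bar>) \<le> exp (Re c * g x + r * \<bar>g x\<bar>)" by simp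
        also have "\<dots> \<le> exp ((Re c - r) * g x) + exp ((Re c + r) * g x)"
          by (cases "g x \<ge> 0") (auto simp: abs_if algebra_simps)
        finally have "norm (f x) * exp (Re c * g x + norm z * \<bar>g x\<bar>) 
            \<le> norm (f x) * (exp ((Re c - r) * g x) + exp ((Re c + r) * g x))"
          by (intro mult_left_mono) auto
        moreover have "norm (F x) * exp (norm z * \<bar>g x\<bar>) = norm (f x) * exp (Re c * g x + norm z * \<bar>g x\<bar>)"
          by (simp add: F_def norm_mult exp_add)
        ultimately show "norm (norm (F x) * exp (norm z * \<bar>g x\<bar>))
         \<le> norm (norm (f x) * exp ((Re c - r) * g x) + norm (f x) * exp ((Re c + r) * g x))"
          by (simp add: algebra_simps)
      qed
    qed measurable
    have "(\<lambda>n. (\<integral>x. F x * of_real (g x) ^ n / fact n \<partial>M) * (w - c) ^ n) sums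
       (\<integral>x. f x * exp (w * g x) \<partial>M)" if "w \<in> ball c r" for w
    proof -
      have "norm (w - c) < r" using that by (simp add: dist_norm norm_minus_commute)
      from exp_integral_power_series(3)[OF _ _ intF[OF this]]
      have "(\<lambda>n. (\<integral>x. F x * of_real (g x) ^ n / fact n \<partial>M) * (w - c) ^ n) sums
         (\<integral>x. F x * exp ((w - c) * g x) \<partial>M)" by simp
      also have "(\<lambda>x. F x * exp ((w - c) * g x)) = (\<lambda>x. f x * exp (w * g x))"
        by (auto simp: F_def exp_diff ring_distribs)
      finally show ?thesis .
    qed
    hence "(\<lambda>s. \<integral>x. f x * exp (s * g x) \<partial>M) holomorphic_on ball c r"
      by (rule power_series_holomorphic)
    with r show ?thesis by blast
  qed
  hence "(\<lambda>s. \<integral>x. f x * exp (s * g x) \<partial>M) analytic_on ?S"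
    unfolding analytic_on_def by blast
  thus ?thesis by (rule analytic_imp_holomorphic)
qed

section \<open>Landau's theorem on the abscissa of convergence\<close>

text \<open>Expanding \<open>exp (t g)\<close> expresses the Taylor coefficients of \<open>h\<close> at \<open>\<sigma>\<close> as integrals of
  non-negative functions, so summing the Taylor series in the larger disc is justified by monotone convergence.\<close>

lemma landau_step:
  fixes f g :: "'a \<Rightarrow> real" and h :: "complex \<Rightarrow> complex"
  assumes [measurable]: "f \<in> borel_measurable M" "g \<in> borel_measurable M"
    and nn: "\<And>x. f x \<ge> 0" "\<And>x. g x \<ge> 0"
    and \<delta>: "0 < \<delta>" "\<delta> \<le> r"
    and Q: "\<And>t. 0 \<le> t \<Longrightarrow> t < \<delta> \<Longrightarrow> integrable M (\<lambda>x. f x * exp (- (\<sigma> - t) * g x)) \<and>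
              h (of_real (\<sigma> - t)) = of_real (\<integral>x. f x * exp (- (\<sigma> - t) * g x) \<partial>M)"
    and h: "h holomorphic_on ball (of_real \<sigma>) r"
    and t: "0 \<le> t" "t < r"
  shows "integrable M (\<lambda>x. f x * exp (- (\<sigma> - t) * g x)) \<and>
              h (of_real (\<sigma> - t)) = of_real (\<integral>x. f x * exp (- (\<sigma> - t) * g x) \<partial>M)"
proof -
  define F where "F = (\<lambda>x. f x * exp (- \<sigma> * g x))"
  have [measurable]: "F \<in> borel_measurable M" unfolding F_def by measurable
  have Fnn: "F x \<ge> 0" for x using nn by (auto simp: F_def)
  define a where "a = (\<lambda>n. \<integral>x. F x * g x ^ n / fact n \<partial>M)"
  have shift: "f x * exp (- (\<sigma> - t) * g x) = F x * exp (t * g x)" for t x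
    by (simp add: F_def algebra_simps flip: exp_add)
  have intF: "integrable M (\<lambda>x. norm (complex_of_real (F x)) * exp (norm z * \<bar>g x\<bar>))" 
    if "norm z < \<delta>" for z :: complex
    using Q[of "norm z"] that Fnn nn unfolding shift by simp
  define p where "p = (\<lambda>z::complex. \<integral>x. complex_of_real (F x) * exp (z * g x) \<partial>M)"
  have psums: "(\<lambda>n. of_real (a n) * z ^ n) sums p z" if "norm z < \<delta>" for z :: complex
  proof -
    have "(\<integral>x. complex_of_real (F x) * of_real (g x) ^ n / fact n \<partial>M) = of_real (a n)" for n
      unfolding a_def by (subst integral_complex_of_real [symmetric]) simp
    with exp_integral_power_series(3)[OF _ _ intF[OF that]] show ?thesis by (simp add: p_def del: integral_divide_zero)
  qed
  have phol: "p holomorphic_on ball 0 \<delta>"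
    by (rule power_series_holomorphic[where a = "\<lambda>n. of_real (a n)"]) (use psums in auto)
  define q where "q = (\<lambda>z. h (of_real \<sigma> - z))"
  have qhol: "q holomorphic_on ball 0 r"
    unfolding q_def
    by (rule holomorphic_on_compose_gen[of "\<lambda>z. of_real \<sigma> - z", OF _ h, unfolded o_def])
       (auto intro!: holomorphic_intros simp: dist_norm)
  have pq_real: "p (of_real t) = q (of_real t)" if "0 \<le> t" "t < \<delta>" for t
  proof -
    have "p (of_real t) = of_real (\<integral>x. F x * exp (t * g x) \<partial>M)"
      unfolding p_def by (subst integral_complex_of_real [symmetric]) (simp flip: exp_of_real)
    thus ?thesis using Q[OF that] unfolding shift by (simp add: q_def)
  qed
  \<comment> \<open>The hypothesis \<open>Q\<close> gives agreement only at real points of [0,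
    \<delta>), but these accumulate at 0.\<close>
  have pq: "p z - q z = 0" if "z \<in> ball 0 \<delta>" for z
  proof (rule analytic_continuation[where f = "\<lambda>z. p z - q z" and S = "ball 0 \<delta>" and \<xi> = 0
        and U = "of_real ` {0..<\<delta>}"])
    have "q holomorphic_on ball 0 \<delta>"
      by (rule holomorphic_on_subset[OF qhol]) (use \<delta> in auto)
    thus "(\<lambda>z. p z - q z) holomorphic_on ball 0 \<delta>"
      using phol by (intro holomorphic_intros)
    show "(0::complex) islimpt of_real ` {0..<\<delta>}"
      unfolding islimpt_approachable
    proof (intro allI impI)
      fix e :: real assume "e > 0"
      thus "\<exists>x'\<in>of_real ` {0..<\<delta>}. x' \<noteq> (0::complex) \<and> dist x' 0 < e"
        using \<delta> by (intro bexI[of _ "of_real (min (e/2) (\<delta>/2))"]) (auto simp: min_def)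
    qed
  qed (use pq_real that \<delta> in auto)
  have "p has_fps_expansion Abs_fps (\<lambda>n. of_real (a n))"
  proof (rule has_fps_expansionI)
    have "eventually (\<lambda>z. z \<in> ball 0 \<delta>) (nhds (0::complex))"
      using \<delta> by (intro eventually_nhds_in_open) auto
    thus "\<forall>\<^sub>F u in nhds 0. (\<lambda>n. fps_nth (Abs_fps (\<lambda>n. complex_of_real (a n))) n * u ^ n) sums p u"
      by eventually_elim (use psums in auto)
  qed
  hence "fps_nth (Abs_fps (\<lambda>n. complex_of_real (a n))) n = (deriv ^^ n) p 0 / fact n" for n
    by (rule fps_nth_fps_expansion)
  moreover have "(deriv ^^ n) p 0 = (deriv ^^ n) q 0" for n
    by (rule higher_deriv_transform_within_open[OF phol _ open_ball])
       (use pq \<delta> in \<open>auto intro!: holomorphic_on_subset[OF qhol]\<close>)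
  ultimately have an: "of_real (a n) = (deriv ^^ n) q 0 / fact n" for n by simp
  have "(\<lambda>n. (deriv ^^ n) q 0 / fact n * (of_real t - 0) ^ n) sums q (of_real t)"
    by (rule holomorphic_power_series[OF qhol]) (use t in auto)
  hence sums_t: "(\<lambda>n. of_real (a n * t ^ n)) sums q (of_real t)"
    by (simp add: an)
  have a_nn: "a n \<ge> 0" for n
    unfolding a_def using Fnn nn by (intro Bochner_Integration.integral_nonneg) auto
  have sums_Re: "(\<lambda>n. a n * t ^ n) sums Re (q (of_real t))"
    using sums_Re[OF sums_t] by simp
  \<comment> \<open>A single term is integrable at the point \<delta>/2 inside the known disc, and
    the nonzero factor (\<delta>/2)^n can be divided away.\<close>
  have int_n: "integrable M (\<lambda>x. F x * g x ^ n / fact n)" for n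
  proof -
    have "norm (complex_of_real (\<delta>/2)) < \<delta>" using \<delta> by simp
    moreover have "(\<lambda>x. complex_of_real (F x)) \<in> borel_measurable M" by measurable
    ultimately have "integrable M (\<lambda>x. complex_of_real (F x) * of_real (g x) ^ n / fact n * complex_of_real (\<delta>/2) ^ n)"
      by (intro exp_integral_power_series(2)[OF _ assms(2)] intF)
    hence "integrable M (\<lambda>x. complex_of_real (F x * g x ^ n / fact n * (\<delta>/2) ^ n))"
      by (simp only: of_real_mult of_real_power of_real_divide of_real_fact)
    hence "integrable M (\<lambda>x. F x * g x ^ n / fact n * (\<delta>/2) ^ n)"
      by (simp only: complex_of_real_integrable_eq)
    from integrable_mult_left[OF this, of "1 / (\<delta>/2) ^ n"] show ?thesis
      using \<delta> by (simp only: times_divide_eq_right mult_1_right nonzero_mult_div_cancel_right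
          power_not_zero divide_eq_0_iff) simp
  qed
  have "(\<integral>\<^sup>+x. ennreal (F x * exp (t * g x)) \<partial>M) = (\<integral>\<^sup>+x. (\<Sum>n. ennreal (F x * g x ^ n / fact n * t ^ n)) \<partial>M)"
  proof (intro nn_integral_cong)
    fix x
    have "(\<lambda>n. F x * ((t * g x) ^ n /\<^sub>R fact n)) sums (F x * exp (t * g x))"
      by (intro sums_mult exp_converges)
    hence "(\<lambda>n. F x * g x ^ n / fact n * t ^ n) sums (F x * exp (t * g x))"
      by (simp add: field_simps)
    thus "ennreal (F x * exp (t * g x)) = (\<Sum>n. ennreal (F x * g x ^ n / fact n * t ^ n))"
      using Fnn nn t by (intro suminf_ennreal_eq [symmetric]) auto
  qed
  also have "\<dots> = (\<Sum>n. \<integral>\<^sup>+x. ennreal (F x * g x ^ n / fact n * t ^ n) \<partial>M)"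
    by (intro nn_integral_suminf) measurable
  also have "(\<lambda>n. \<integral>\<^sup>+x. ennreal (F x * g x ^ n / fact n * t ^ n) \<partial>M) = (\<lambda>n. ennreal (a n * t ^ n))"
  proof
    fix n
    have "(\<integral>\<^sup>+x. ennreal (F x * g x ^ n / fact n * t ^ n) \<partial>M) = 
        ennreal (\<integral>x. F x * g x ^ n / fact n * t ^ n \<partial>M)"
      using int_n[of n] Fnn nn t by (intro nn_integral_eq_integral integrable_mult_left AE_I2) auto
    thus "(\<integral>\<^sup>+x. ennreal (F x * g x ^ n / fact n * t ^ n) \<partial>M) = ennreal (a n * t ^ n)"
      by (simp add: a_def)
  qed
  also have "(\<Sum>n. ennreal (a n * t ^ n)) = ennreal (Re (q (of_real t)))"
    using sums_Re a_nn t by (intro suminf_ennreal_eq) auto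
  finally have nnint: "(\<integral>\<^sup>+x. ennreal (F x * exp (t * g x)) \<partial>M) = ennreal (Re (q (of_real t)))" .
  have Reqnn: "Re (q (of_real t)) \<ge> 0"
    using a_nn t by (intro sums_le[OF _ sums_zero sums_Re]) auto
  have Imq: "Im (q (of_real t)) = 0"
    using sums_Im[OF sums_t] by (simp add: sums_iff)
  have integ: "integrable M (\<lambda>x. F x * exp (t * g x))"
    using nnint Fnn by (intro integrableI_nonneg) auto
  have "(\<integral>x. F x * exp (t * g x) \<partial>M) = Re (q (of_real t))"
    using nnint Fnn Reqnn by (intro integral_eq_nn_integral[THEN trans]) auto
  with integ Imq show ?thesis unfolding shift
    by (simp add: q_def complex_eq_iff)
qed

text \<open>At the infimum of convergence h is still holomorphic in a disc, and
  \<open>landau_step\<close> pushes convergence past that infimum. Only a neighbourhood of the real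
  ray has to lie in S, so singularities of h off the real axis do no harm.\<close>

theorem landau_abscissa:
  fixes f g :: "'a \<Rightarrow> real" and h :: "complex \<Rightarrow> complex" and a b :: real
  assumes [measurable]: "f \<in> borel_measurable M" "g \<in> borel_measurable M"
    and nn: "\<And>x. f x \<ge> 0" "\<And>x. g x \<ge> 0"
    and Q: "\<And>\<sigma>. \<sigma> > a \<Longrightarrow> integrable M (\<lambda>x. f x * exp (- \<sigma> * g x)) \<and>
              h (of_real \<sigma>) = of_real (\<integral>x. f x * exp (- \<sigma> * g x) \<partial>M)"
    and S: "open S" "of_real ` {b<..} \<subseteq> S" and h: "h holomorphic_on S"
    and \<sigma>: "\<sigma> > b"
  shows "integrable M (\<lambda>x. f x * exp (- \<sigma> * g x)) \<and>
              h (of_real \<sigma>) = of_real (\<integral>x. f x * exp (- \<sigma> * g x) \<partial>M)"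
proof (rule ccontr)
  define Q where "Q = (\<lambda>\<sigma>. integrable M (\<lambda>x. f x * exp (- \<sigma> * g x)) \<and>
              h (of_real \<sigma>) = of_real (\<integral>x. f x * exp (- \<sigma> * g x) \<partial>M))"
  assume "\<not> ?thesis"
  hence nQ: "\<not> Q \<sigma>" by (simp add: Q_def)
  \<comment> \<open>Collecting rays makes Inf T a threshold without first knowing that Q is upward
    closed.\<close>
  define T where "T = {\<tau>. \<forall>\<tau>'\<ge>\<tau>. Q \<tau>'}"
  have T1: "a + 1 \<in> T" using Q by (auto simp: T_def Q_def)
  have low: "\<tau> > \<sigma>" if "\<tau> \<in> T" for \<tau> using that nQ by (force simp: T_def not_le[symmetric])
  hence bdd: "bdd_below T" by (meson bdd_belowI less_imp_le)
  define \<sigma>0 where "\<sigma>0 = Inf T"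
  have \<sigma>0: "\<sigma>0 \<ge> \<sigma>" unfolding \<sigma>0_def using T1 low by (intro cInf_greatest) (auto intro: less_imp_le)
  with \<sigma> S(2) have "of_real \<sigma>0 \<in> S" by auto
  with S(1) obtain r where r: "r > 0" "ball (of_real \<sigma>0) (2 * r) \<subseteq> S"
    by (metis openE mult.commute nonzero_eq_divide_eq zero_less_divide_iff zero_less_numeral zero_neq_numeral)
  have "\<sigma>0 < \<sigma>0 + r / 2" using r by simp
  then obtain \<tau> where \<tau>: "\<tau> \<in> T" "\<tau> < \<sigma>0 + r / 2"
    unfolding \<sigma>0_def using cInf_less_iff[OF _ bdd] T1 by blast
  have above: "Q x" if "x > \<sigma>0" for x
  proof -
    obtain y where "y \<in> T" "y < x" using \<open>x > \<sigma>0\<close> cInf_less_iff[OF _ bdd] T1 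
      unfolding \<sigma>0_def by blast
    thus ?thesis by (auto simp: T_def)
  qed
  \<comment> \<open>The disc is centred r/2 to the right of \<sigma>0, where Q holds down to
    distance r/2. Its radius r reaches \<sigma>0 - r/2, and the ball of radius 2 r around \<sigma>0
    contains it.\<close>
  have step: "Q ((\<sigma>0 + r/2) - t)" if "0 \<le> t" "t < r" for t
    unfolding Q_def
  proof (rule landau_step[OF assms(1,2) nn])
    show "0 < r/2" "r/2 \<le> r" "0 \<le> t" "t < r" using r that by auto
    show "h holomorphic_on ball (of_real (\<sigma>0 + r/2)) r"
    proof (rule holomorphic_on_subset[OF h], rule order_trans[OF _ r(2)])
      show "ball (complex_of_real (\<sigma>0 + r/2)) r \<subseteq> ball (of_real \<sigma>0) (2*r)"
      proof
        fix z assume "z \<in> ball (complex_of_real (\<sigma>0 + r/2)) r"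
        hence "dist (of_real (\<sigma>0 + r/2)) z < r" by simp
        moreover have "dist (complex_of_real \<sigma>0) (of_real (\<sigma>0 + r/2)) = r/2"
          using r by (simp add: dist_norm norm_divide)
        ultimately have "dist (of_real \<sigma>0) z < r + r/2"
          using dist_triangle[of "of_real \<sigma>0" z "complex_of_real (\<sigma>0 + r/2)"] by linarith
        thus "z \<in> ball (of_real \<sigma>0) (2*r)" using r by simp
      qed
    qed
    fix t assume "0 \<le> t" "t < r/2"
    thus "integrable M (\<lambda>x. f x * exp (- (\<sigma>0 + r / 2 - t) * g x)) \<and>
         h (complex_of_real (\<sigma>0 + r / 2 - t)) = complex_of_real (\<integral>x. f x * exp (- (\<sigma>0 + r / 2 - t) * g x) \<partial>M)"
      using above[of "\<sigma>0 + r/2 - t"] unfolding Q_def by simp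
  qed
  have "\<sigma>0 - r/4 \<in> T"
    unfolding T_def
  proof safe
    fix x assume x: "x \<ge> \<sigma>0 - r/4"
    show "Q x"
    proof (cases "x > \<sigma>0")
      case False
      hence "Q ((\<sigma>0 + r/2) - (\<sigma>0 + r/2 - x))" using x r by (intro step) auto
      thus ?thesis by simp
    qed (use above in auto)
  qed
  hence "\<sigma>0 \<le> \<sigma>0 - r/4" unfolding \<sigma>0_def by (rule cInf_lower[OF _ bdd])
  with r show False by simp
qed

section \<open>Continuation of the zeta function\<close>

text \<open>The error of the trapezoidal rule for \<open>x\<^bsup>-s\<^esup>\<close> on \<open>[k+1, k+2]\<close>,
  multiplied by \<open>s - 1\<close> so that it is entire in \<open>s\<close>. Consequently \<open>zeta_reg s\<close> is
  \<open>(s - 1) \<zeta>(s)\<close>, but only for \<open>Re s > -1\<close>, where the series converges.\<close>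

definition zeta_term :: "nat \<Rightarrow> complex \<Rightarrow> complex" where
  "zeta_term k s = (s - 1) / 2 * (of_nat (Suc k) powr (-s) + of_nat (Suc (Suc k)) powr (-s))
     + of_nat (Suc (Suc k)) powr (1 - s) - of_nat (Suc k) powr (1 - s)"

definition zeta_reg :: "complex \<Rightarrow> complex" where
  "zeta_reg s = (s + 1) / 2 + (\<Sum>k. zeta_term k s)"

text \<open>Replace the step length 1 of the trapezoidal rule by a variable z. The error \<phi> and
  its derivative \<phi>1 both vanish at z = 0, and in the second derivative \<phi>2 everything
  cancels except a term with (n + z)^(-s-2). Applying the mean value bound twice gives the
  claim.\<close>

lemma norm_zeta_term_le:
  assumes s: "Re s > -2"
  shows "norm (zeta_term k s) \<le> norm ((s - 1) * s * (s + 1)) * real (Suc k) powr (- Re s - 2)"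
proof -
  define n where "n = complex_of_nat (Suc k)"
  define S where "S = closed_segment 0 (1::complex)"
  define \<phi> where "\<phi> = (\<lambda>z. (s - 1) / 2 * (z * (n powr (-s) + (n + z) powr (-s))) + (n + z) powr (1 - s) - n powr (1 - s))"
  define \<phi>1 where "\<phi>1 = (\<lambda>z. (s - 1) / 2 * (n powr (-s) - (n + z) powr (-s) - s * z * (n + z) powr (-s - 1)))"
  define \<phi>2 where "\<phi>2 = (\<lambda>z. (s - 1) / 2 * (s * (s + 1) * z * (n + z) powr (-s - 2)))"
  define B where "B = norm ((s - 1) * s * (s + 1)) * real (Suc k) powr (- Re s - 2)"
  have S: "convex S" "0 \<in> S" "1 \<in> S" by (auto simp: S_def)
  have SR: "\<exists>t. z = of_real t \<and> 0 \<le> t \<and> t \<le> 1" if "z \<in> S" for z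
    using that unfolding S_def closed_segment_def by (auto simp: scaleR_conv_of_real)
  have nS: "n + z \<notin> \<real>\<^sub>\<le>\<^sub>0" if "z \<in> S" for z
  proof -
    from SR[OF that] obtain t where "z = of_real t" "0 \<le> t" by blast
    hence "n + z = of_real (real (Suc k) + t)" by (simp add: n_def)
    moreover have "real (Suc k) + t > 0" using \<open>0 \<le> t\<close> by simp
    ultimately show ?thesis by (metis complex_nonpos_Reals_iff Re_complex_of_real not_le)
  qed
  have D: "((\<lambda>z. (n + z) powr w) has_field_derivative w * (n + z) powr (w - 1)) (at z within S)"
    if "z \<in> S" for z w
    using nS[OF that] by (auto intro!: derivative_eq_intros)
  have D1: "(\<phi> has_field_derivative \<phi>1 z) (at z within S)" if "z \<in> S" for z
    unfolding \<phi>_def \<phi>1_def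
    by (rule derivative_eq_intros D[OF that] refl)+ (simp add: field_simps)
  have D2: "(\<phi>1 has_field_derivative \<phi>2 z) (at z within S)" if "z \<in> S" for z
    unfolding \<phi>2_def \<phi>1_def
    by (rule derivative_eq_intros D[OF that] refl)+ (simp add: field_simps)
  have b2: "norm (\<phi>2 z) \<le> B" if "z \<in> S" for z
  proof -
    from SR[OF that] obtain t where t: "z = of_real t" "0 \<le> t" "t \<le> 1" by blast
    have n: "n + z = of_real (real (Suc k) + t)" using t by (simp add: n_def)
    have "norm ((n + z) powr (-s - 2)) = (real (Suc k) + t) powr (- Re s - 2)"
      unfolding n by (subst norm_powr_real_powr) (use t in auto)
    also have "\<dots> \<le> real (Suc k) powr (- Re s - 2)"
      by (rule powr_mono2') (use t s in auto)
    finally have "norm ((s - 1) * s * (s + 1)) / 2 * t * norm ((n + z) powr (-s - 2))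
        \<le> norm ((s - 1) * s * (s + 1)) / 2 * t * real (Suc k) powr (- Re s - 2)"
      using t by (intro mult_left_mono) auto
    moreover have "norm (\<phi>2 z) = norm ((s - 1) * s * (s + 1)) / 2 * t * norm ((n + z) powr (-s - 2))"
      using t by (simp add: \<phi>2_def norm_mult norm_divide)
    ultimately have "norm (\<phi>2 z) \<le> norm ((s - 1) * s * (s + 1)) / 2 * t * real (Suc k) powr (- Re s - 2)"
      by simp
    also have "\<dots> \<le> norm ((s - 1) * s * (s + 1)) * 1 * real (Suc k) powr (- Re s - 2)"
      using t by (intro mult_right_mono mult_mono) auto
    finally show ?thesis by (simp add: B_def)
  qed
  have B0: "B \<ge> 0" by (simp add: B_def)
  have b1: "norm (\<phi>1 z) \<le> B" if "z \<in> S" for z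
  proof -
    have "norm (\<phi>1 z - \<phi>1 0) \<le> B * norm (z - 0)"
      by (rule field_differentiable_bound[OF S(1) D2 b2]) (use S that in auto)
    also have "\<dots> \<le> B * 1"
      using SR[OF that] B0 by (intro mult_left_mono) auto
    finally show ?thesis by (simp add: \<phi>1_def)
  qed
  have "norm (\<phi> 1 - \<phi> 0) \<le> B * norm (1 - 0 :: complex)"
    by (rule field_differentiable_bound[OF S(1) D1 b1]) (use S in auto)
  moreover have "\<phi> 1 - \<phi> 0 = zeta_term k s"
    by (simp add: \<phi>_def zeta_term_def n_def add_ac)
  ultimately show ?thesis by (simp add: B_def)
qed

lemma holomorphic_zeta_term [holomorphic_intros]: "zeta_term k holomorphic_on A"
  unfolding zeta_term_def by (intro holomorphic_intros) auto

lemma summable_norm_zeta_term: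
  assumes "Re s > -1"
  shows "summable (\<lambda>k. norm (zeta_term k s))"
proof (rule summable_comparison_test)
  have "summable (\<lambda>k. real k powr (- Re s - 2))"
    using assms by (simp add: summable_real_powr_iff)
  hence "summable (\<lambda>k. real (Suc k) powr (- Re s - 2))"
    by (subst summable_Suc_iff)
  thus "summable (\<lambda>k. norm ((s - 1) * s * (s + 1)) * real (Suc k) powr (- Re s - 2))"
    by (rule summable_mult)
  show "\<exists>N. \<forall>n\<ge>N. norm (norm (zeta_term n s)) \<le> norm ((s - 1) * s * (s + 1)) * real (Suc n) powr (- Re s - 2)"
    using norm_zeta_term_le[of s] assms by auto
qed

lemma holomorphic_zeta_reg: "zeta_reg holomorphic_on {s. Re s > -1}"
proof -
  have "(\<lambda>s. \<Sum>k. zeta_term k s) holomorphic_on {s. Re s > -1}"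
  proof (rule holomorphic_uniform_sequence)
    show "open {s. Re s > -1}" by (rule open_halfspace_Re_gt)
    show "(\<lambda>s. \<Sum>k<n. zeta_term k s) holomorphic_on {s. Re s > -1}" for n
      by (intro holomorphic_intros)
    fix x assume x: "x \<in> {s. Re s > -1}"
    define d where "d = (Re x + 1) / 2"
    have d: "d > 0" "Re x - d > -1" using x by (auto simp: d_def field_simps)
    have sub: "Re x - d \<le> Re s" if "s \<in> cball x d" for s
      using that abs_Re_le_cmod[of "x - s"] by (simp add: dist_norm)
    have "compact ((\<lambda>s. (s - 1) * s * (s + 1)) ` cball x d)"
      by (intro compact_continuous_image continuous_intros) auto
    hence "bounded ((\<lambda>s. (s - 1) * s * (s + 1)) ` cball x d)"
      by (rule compact_imp_bounded)
    then obtain C where CC: "\<forall>y\<in>(\<lambda>s. (s - 1) * s * (s + 1)) ` cball x d. norm y \<le> C"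
      unfolding bounded_iff by (elim exE)
    have C: "norm ((s - 1) * s * (s + 1)) \<le> C" if "s \<in> cball x d" for s
      by (rule CC[THEN bspec, OF imageI[OF that]])
    have "uniform_limit (cball x d) (\<lambda>n s. \<Sum>k<n. zeta_term k s) (\<lambda>s. \<Sum>k. zeta_term k s) sequentially"
    proof (rule Weierstrass_m_test)
      have "summable (\<lambda>k. real k powr (- (Re x - d) - 2))"
        using d by (simp add: summable_real_powr_iff)
      hence "summable (\<lambda>k. real (Suc k) powr (- (Re x - d) - 2))"
        by (subst summable_Suc_iff)
      thus "summable (\<lambda>k. C * real (Suc k) powr (- (Re x - d) - 2))"
        by (rule summable_mult)
      fix k s assume s: "s \<in> cball x d"
      have "norm (zeta_term k s) \<le> norm ((s - 1) * s * (s + 1)) * real (Suc k) powr (- Re s - 2)"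
        using sub[OF s] d by (intro norm_zeta_term_le) auto
      also have "\<dots> \<le> C * real (Suc k) powr (- (Re x - d) - 2)"
        using C[OF s] sub[OF s] order_trans[OF norm_ge_zero C[OF s]]
        by (intro mult_mono powr_mono) auto
      finally show "norm (zeta_term k s) \<le> C * real (Suc k) powr (- (Re x - d) - 2)" .
    qed
    moreover have "cball x d \<subseteq> {s. Re s > -1}" using sub d by force
    ultimately show "\<exists>d>0. cball x d \<subseteq> {s. Re s > -1} \<and>
      uniform_limit (cball x d) (\<lambda>n s. \<Sum>k<n. zeta_term k s) (\<lambda>s. \<Sum>k. zeta_term k s) sequentially"
      using d by blast
  qed
  thus ?thesis unfolding zeta_reg_def by (intro holomorphic_intros) auto
qed

lemma sum_zeta_term:
  "(\<Sum>k<N. zeta_term k s) = (s - 1) * ((\<Sum>k<N. of_nat (Suc k) powr (-s)) + of_nat (Suc N) powr (-s) / 2 - 1 / 2)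
      + of_nat (Suc N) powr (1 - s) - 1"
proof (induction N)
  case (Suc N)
  define a where "a = (\<lambda>k. of_nat (Suc k) powr (-s) :: complex)"
  define b where "b = (\<lambda>k. of_nat (Suc k) powr (1 - s) :: complex)"
  have t: "zeta_term N s = (s - 1) / 2 * (a N + a (Suc N)) + b (Suc N) - b N"
    by (simp only: zeta_term_def a_def b_def)
  have ab: "of_nat (Suc k) powr (-s) = a k" "of_nat (Suc k) powr (1 - s) = b k" for k
    by (simp_all only: a_def b_def)
  show ?case
    unfolding sum.lessThan_Suc t Suc ab by (simp add: field_simps)
qed simp

text \<open>Telescoping leaves the constants -(s - 1)/2 - 1, and the summand (s + 1)/2 in
  \<open>zeta_reg\<close> is exactly what cancels them.\<close>

lemma zeta_reg_LIMSEQ: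
  assumes "Re s > -1"
  shows "(\<lambda>N. (s - 1) * ((\<Sum>k<N. of_nat (Suc k) powr (-s)) + of_nat (Suc N) powr (-s) / 2)
      + of_nat (Suc N) powr (1 - s)) \<longlonglongrightarrow> zeta_reg s"
proof -
  have "(\<lambda>N. \<Sum>k<N. zeta_term k s) \<longlonglongrightarrow> (\<Sum>k. zeta_term k s)"
    by (rule summable_LIMSEQ[OF summable_norm_cancel[OF summable_norm_zeta_term[OF assms]]])
  hence "(\<lambda>N. (s + 1) / 2 + (\<Sum>k<N. zeta_term k s)) \<longlonglongrightarrow> zeta_reg s"
    unfolding zeta_reg_def by (intro tendsto_intros)
  moreover have "(s + 1) / 2 + ((s - 1) * (u + v / 2 - 1 / 2) + w - 1) = (s - 1) * (u + v / 2) + w" for u v w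
    by (simp add: field_simps)
  ultimately show ?thesis by (simp only: sum_zeta_term)
qed

lemma nat_powr_tendsto_0:
  assumes "Re s < 0"
  shows "(\<lambda>N. of_nat (Suc N) powr s :: complex) \<longlonglongrightarrow> 0"
proof (rule tendsto_norm_zero_cancel)
  have eq: "norm (of_nat (Suc N) powr s) = real (Suc N) powr Re s" for N
    by (subst norm_powr_real_powr) auto
  show "(\<lambda>N. norm (of_nat (Suc N) powr s :: complex)) \<longlonglongrightarrow> 0" unfolding eq
    by (rule tendsto_neg_powr[OF assms]) (rule filterlim_compose[OF filterlim_real_sequentially filterlim_Suc])
qed

lemma zeta_reg_sums:
  assumes s: "Re s > 1"
  shows "(\<lambda>k. 1 / of_nat (Suc k) powr s) sums (zeta_reg s / (s - 1))"
proof -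
  have s1: "s - 1 \<noteq> 0" using s by auto
  have "(\<lambda>N. ((s - 1) * ((\<Sum>k<N. of_nat (Suc k) powr (-s)) + of_nat (Suc N) powr (-s) / 2)
      + of_nat (Suc N) powr (1 - s) - of_nat (Suc N) powr (1 - s)) / (s - 1)
      - of_nat (Suc N) powr (-s) / 2) \<longlonglongrightarrow> (zeta_reg s - 0) / (s - 1) - 0 / 2"
    using s s1 by (intro tendsto_intros zeta_reg_LIMSEQ nat_powr_tendsto_0) auto
  hence "(\<lambda>N. \<Sum>k<N. of_nat (Suc k) powr (-s)) \<longlonglongrightarrow> zeta_reg s / (s - 1)"
    using s1 by simp
  thus ?thesis by (simp add: sums_def powr_minus field_simps)
qed

lemma zeta_reg_1 [simp]: "zeta_reg 1 = 1"
proof -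
  have "zeta_term k 1 = 0" for k
    unfolding zeta_term_def by (simp del: of_nat_Suc)
  thus ?thesis by (simp add: zeta_reg_def)
qed

section \<open>Zeta on the positive real axis, and polynomial growth\<close>

lemma Im_zeta_reg_of_real:
  assumes "x > -1"
  shows "Im (zeta_reg (of_real x)) = 0"
proof -
  have "zeta_term k (of_real x) = of_real ((x - 1) / 2 * (real (Suc k) powr (-x) + real (Suc (Suc k)) powr (-x))
     + real (Suc (Suc k)) powr (1 - x) - real (Suc k) powr (1 - x))" for k
    unfolding zeta_term_def by (simp add: powr_of_real[symmetric] del: of_nat_Suc)
  hence "Im (zeta_term k (of_real x)) = 0" for k by simp
  moreover have "(\<lambda>k. zeta_term k (of_real x)) sums (\<Sum>k. zeta_term k (of_real x))"
    by (rule summable_sums[OF summable_norm_cancel[OF summable_norm_zeta_term]]) (use assms in auto)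
  from sums_Im[OF this] have "(\<lambda>k. Im (zeta_term k (of_real x))) sums Im (\<Sum>k. zeta_term k (of_real x))" .
  ultimately have "Im (\<Sum>k. zeta_term k (of_real x)) = 0"
    by (simp add: sums_iff)
  thus ?thesis by (simp add: zeta_reg_def)
qed

lemma zeta_reg_of_real: "x > -1 \<Longrightarrow> zeta_reg (of_real x) = of_real (Re (zeta_reg (of_real x)))"
  using Im_zeta_reg_of_real by (simp add: complex_eq_iff)

text \<open>Comparison of the sum with 1 plus the integral of t^(-x) from 1 to N + 1; the first term
  1, multiplied by 1 - x, accounts for the constant -x.\<close>

lemma sum_powr_le:
  assumes "0 < x" "x < (1::real)"
  shows "(1 - x) * (\<Sum>k<Suc N. real (Suc k) powr (-x)) \<le> real (Suc N) powr (1 - x) - x"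
proof (induction N)
  case (Suc N)
  have "\<exists>z. real (Suc N) < z \<and> z < real (Suc (Suc N)) \<and>
      real (Suc (Suc N)) powr (1 - x) - real (Suc N) powr (1 - x) = (real (Suc (Suc N)) - real (Suc N)) * ((1 - x) * z powr (-x))"
    by (rule MVT2) (auto intro!: derivative_eq_intros)
  then obtain z where z: "real (Suc N) < z" "z < real (Suc (Suc N))"
    "real (Suc (Suc N)) powr (1 - x) - real (Suc N) powr (1 - x) = (1 - x) * z powr (-x)" by auto
  have "real (Suc (Suc N)) powr (-x) \<le> z powr (-x)"
    by (rule powr_mono2') (use z assms in auto)
  hence "(1 - x) * real (Suc (Suc N)) powr (-x) \<le> (1 - x) * z powr (-x)"
    using assms by (intro mult_left_mono) auto
  thus ?case using Suc z(3) by (simp add: algebra_simps)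
qed simp

lemma zeta_reg_sums_real:
  assumes "x > 1"
  shows "(\<lambda>k. 1 / real (Suc k) powr x) sums (Re (zeta_reg (of_real x)) / (x - 1))"
proof -
  have "(\<lambda>k. 1 / of_nat (Suc k) powr of_real x) sums (zeta_reg (of_real x) / (of_real x - 1))"
    using assms by (intro zeta_reg_sums) auto
  also have "(\<lambda>k. 1 / of_nat (Suc k) powr of_real x) = (\<lambda>k. complex_of_real (1 / real (Suc k) powr x))"
    by (simp add: powr_of_real[symmetric] del: of_nat_Suc)
  also have "zeta_reg (of_real x) / (of_real x - 1) = of_real (Re (zeta_reg (of_real x)) / (x - 1))"
    using assms by (subst zeta_reg_of_real) auto
  finally show ?thesis by (simp only: sums_of_real_iff)
qed

text \<open>This excludes real zeros of zeta to the right of 0, so 1/zeta has no singularity on the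
  real ray along which Landau's theorem is applied.\<close>

lemma zeta_reg_pos_real:
  assumes "x > 0"
  shows "Re (zeta_reg (of_real x)) > 0"
proof -
  consider "x < 1" | "x = 1" | "x > 1" by linarith
  thus ?thesis
  proof cases
    case 1
    \<comment> \<open>The trapezoidal sum carries its last term with weight 1/2. Subtracting (1 -
      x)/2 (N + 1)^(-x), which tends to 0, completes it to the full sum of
      \<open>sum_powr_le\<close>.\<close>
    have ev: "Re ((of_real x - 1) * ((\<Sum>k<N. of_nat (Suc k) powr (- of_real x)) + of_nat (Suc N) powr (- of_real x) / 2)
      + of_nat (Suc N) powr (1 - of_real x)) - (1 - x) / 2 * real (Suc N) powr (-x) \<ge> x" for N :: nat
    proof -
      have "complex_of_nat (Suc k) powr (- of_real x) = of_real (real (Suc k) powr (-x))"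
         "complex_of_nat (Suc k) powr (1 - of_real x) = of_real (real (Suc k) powr (1-x))" for k
        by (simp_all add: powr_of_real[symmetric] del: of_nat_Suc)
      hence "Re ((of_real x - 1) * ((\<Sum>k<N. of_nat (Suc k) powr (- of_real x)) + of_nat (Suc N) powr (- of_real x) / 2)
      + of_nat (Suc N) powr (1 - of_real x)) = 
         (x - 1) * ((\<Sum>k<N. real (Suc k) powr (-x)) + real (Suc N) powr (-x) / 2) + real (Suc N) powr (1 - x)"
        by (simp del: of_nat_Suc)
      thus ?thesis using sum_powr_le[OF assms 1, of N] by (simp add: field_simps)
    qed
    have "(\<lambda>N. Re ((of_real x - 1) * ((\<Sum>k<N. of_nat (Suc k) powr (- of_real x)) + of_nat (Suc N) powr (- of_real x) / 2)
      + of_nat (Suc N) powr (1 - of_real x)) - (1 - x) / 2 * real (Suc N) powr (-x)) \<longlonglongrightarrow> Re (zeta_reg (of_real x)) - (1 - x) / 2 * 0"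
      using assms
      by (intro tendsto_intros zeta_reg_LIMSEQ tendsto_neg_powr
            filterlim_compose[OF filterlim_real_sequentially filterlim_Suc]) auto
    from LIMSEQ_le_const[OF this, of x] have "Re (zeta_reg (of_real x)) \<ge> x"
      using ev by auto
    with assms show ?thesis by simp
  next
    case 3
    hence "0 < Re (zeta_reg (of_real x)) / (x - 1)"
      using suminf_pos[OF sums_summable[OF zeta_reg_sums_real]] sums_unique[OF zeta_reg_sums_real] by fastforce
    thus ?thesis using 3 by (simp add: zero_less_divide_iff)
  qed auto
qed

text \<open>The exponent 3 comes from the factor (s - 1) s (s + 1) in the bound for a single
  term.\<close>

lemma zeta_reg_bound:
  obtains C where "C > 0" "\<And>s. Re s \<ge> 0 \<Longrightarrow> norm (zeta_reg s) \<le> C * (1 + norm s) ^ 3"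
proof
  define K where "K = (\<Sum>k. real (Suc k) powr (-2))"
  have "summable (\<lambda>k. real k powr (-2))" by (simp add: summable_real_powr_iff)
  hence sm: "summable (\<lambda>k. real (Suc k) powr (-2))" by (subst summable_Suc_iff)
  have K: "K \<ge> 0" unfolding K_def by (rule suminf_nonneg[OF sm]) auto
  show "1 + K > 0" using K by simp
  fix s :: complex assume s: "Re s \<ge> 0"
  let ?n = "1 + norm s"
  have "norm (s - 1) \<le> ?n" "norm s \<le> ?n" "norm (s + 1) \<le> ?n"
    using norm_triangle_ineq4[of s 1] norm_triangle_ineq[of s 1] by auto
  hence "norm (s - 1) * norm s * norm (s + 1) \<le> ?n * ?n * ?n" by (intro mult_mono) auto
  hence n3: "norm ((s - 1) * s * (s + 1)) \<le> ?n ^ 3" by (simp add: norm_mult power3_eq_cube)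
  have "norm (\<Sum>k. zeta_term k s) \<le> (\<Sum>k. norm (zeta_term k s))"
    using s by (intro summable_norm summable_norm_zeta_term) auto
  also have "\<dots> \<le> (\<Sum>k. ?n ^ 3 * real (Suc k) powr (-2))"
  proof (rule suminf_le)
    fix k
    have "norm (zeta_term k s) \<le> norm ((s - 1) * s * (s + 1)) * real (Suc k) powr (- Re s - 2)"
      using s by (intro norm_zeta_term_le) auto
    also have "\<dots> \<le> ?n ^ 3 * real (Suc k) powr (- 2)"
      using n3 s by (intro mult_mono powr_mono) auto
    finally show "norm (zeta_term k s) \<le> ?n ^ 3 * real (Suc k) powr (-2)" .
  qed (use s sm summable_norm_zeta_term[of s] in \<open>auto intro: summable_mult\<close>)
  also have "\<dots> = ?n ^ 3 * K" unfolding K_def by (rule suminf_mult[OF sm])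
  finally have A: "norm (\<Sum>k. zeta_term k s) \<le> ?n ^ 3 * K" .
  have "norm ((s + 1) / 2) \<le> ?n"
    using norm_triangle_ineq[of s 1] norm_ge_zero[of s] by (simp add: norm_divide del: norm_ge_zero)
  also have "\<dots> \<le> ?n ^ 3" by (rule self_le_power) auto
  finally have "norm ((s + 1) / 2) \<le> ?n ^ 3" .
  with A show "norm (zeta_reg s) \<le> (1 + K) * ?n ^ 3"
    unfolding zeta_reg_def using norm_triangle_ineq[of "(s+1)/2" "\<Sum>k. zeta_term k s"]
    by (simp add: algebra_simps)
qed

lemma zeta_reg_2: "zeta_reg 2 = of_real (pi\<^sup>2 / 6)"
proof -
  have "(\<lambda>k. 1 / of_nat (Suc k) powr 2) sums (zeta_reg 2)"
    using zeta_reg_sums[of 2] by simp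
  moreover have "(\<lambda>k. complex_of_real (1 / (real k + 1)\<^sup>2)) sums of_real (pi\<^sup>2 / 6)"
    using inverse_squares_sums by (subst sums_of_real_iff) (simp add: add_ac)
  moreover have "complex_of_real (1 / (real k + 1)\<^sup>2) = 1 / of_nat (Suc k) powr 2" for k
  proof -
    have "complex_of_nat (Suc k) powr (of_nat 2) = of_nat (Suc k) ^ 2"
      by (rule powr_complexpow) (simp del: of_nat_Suc)
    thus ?thesis by (simp add: add_ac)
  qed
  ultimately show ?thesis by (simp add: sums_iff)
qed

section \<open>The cotangent series and a beta integral\<close>

text \<open>Take the logarithmic derivative of the reflection formula for Gamma(z) Gamma(-z): the
  left side gives a difference of Digamma values, hence a series, and the right side gives the
  cotangent. Splitting off the term n = 0, which is 2/z, turns +1/z into -1/z.\<close>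

lemma cot_partial_fractions:
  fixes z :: complex
  assumes z: "z \<notin> \<int>"
  shows "(\<lambda>k. 2 * z / (z\<^sup>2 - (of_nat (Suc k))\<^sup>2)) sums (of_real pi * cot (of_real pi * z) - 1 / z)"
proof -
  have z0: "z \<noteq> 0" using z by auto
  have nz: "z \<notin> \<int>\<^sub>\<le>\<^sub>0" "-z \<notin> \<int>\<^sub>\<le>\<^sub>0"
    using z nonpos_Ints_Int minus_in_Ints_iff by blast+
  have s0: "sin (of_real pi * z) \<noteq> 0"
  proof
    assume "sin (of_real pi * z) = 0"
    then obtain n :: int where "of_real pi * z = of_real (of_int n * pi)"
      by (auto simp: sin_eq_0)
    hence "z = of_int n" by simp
    with z show False by simp
  qed
  have "((\<lambda>w. Gamma w * Gamma (-w)) has_field_derivative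
      Gamma z * Gamma (-z) * (Digamma z - Digamma (-z))) (at z)"
    by (rule derivative_eq_intros refl nz)+ (simp add: algebra_simps)
  moreover have "((\<lambda>w. - of_real pi / (w * sin (of_real pi * w))) has_field_derivative
      of_real pi * (sin (of_real pi * z) + z * of_real pi * cos (of_real pi * z)) / (z * sin (of_real pi * z))\<^sup>2) (at z)"
    using z0 s0 by (auto intro!: derivative_eq_intros simp: power2_eq_square)
  ultimately have eq: "Gamma z * Gamma (-z) * (Digamma z - Digamma (-z)) =
     of_real pi * (sin (of_real pi * z) + z * of_real pi * cos (of_real pi * z)) / (z * sin (of_real pi * z))\<^sup>2"
    unfolding Gamma_reflection_complex' by (rule DERIV_unique)
  have gen: "D = - N / w" if "- p / w * D = p * N / w\<^sup>2" "p \<noteq> 0" "w \<noteq> 0" for p w D N :: complex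
  proof -
    have "- (p * (D * w)) = p * N" using that by (simp add: field_simps power2_eq_square)
    hence "p * (D * w) = p * (- N)" by (metis minus_minus mult_minus_right)
    hence "D * w = - N" using that(2) by (simp only: mult_cancel_left) simp
    thus ?thesis using that(3) by (simp add: field_simps)
  qed
  have "Digamma z - Digamma (-z) = - (sin (of_real pi * z) + z * of_real pi * cos (of_real pi * z)) / (z * sin (of_real pi * z))"
    by (rule gen[OF eq[unfolded Gamma_reflection_complex']]) (use z0 s0 in auto)
  hence "Digamma (-z) - Digamma z = (sin (of_real pi * z) + z * of_real pi * cos (of_real pi * z)) / (z * sin (of_real pi * z))"
    by (metis minus_diff_eq minus_divide_left minus_minus)
  hence D: "Digamma (-z) - Digamma z = 1 / z + of_real pi * cot (of_real pi * z)"
    using z0 s0 by (simp add: cot_def add_divide_distrib)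
  have sm: "(\<lambda>n. inverse (of_nat (Suc n)) - inverse (w + of_nat n)) sums (Digamma w + euler_mascheroni)"
    if "w \<noteq> 0" for w :: complex
    using summable_sums[OF summable_Digamma[OF that]] by (simp add: Digamma_def)
  have "(\<lambda>n. inverse (z + of_nat n) - inverse (- z + of_nat n)) sums (Digamma (-z) - Digamma z)"
    using sums_diff[OF sm[of "-z"] sm[of z]] z0 by (simp add: algebra_simps)
  from sums_split_initial_segment[OF this, of 1]
  have "(\<lambda>n. inverse (z + of_nat (Suc n)) - inverse (- z + of_nat (Suc n))) sums 
     (Digamma (-z) - Digamma z - (inverse z - inverse (-z)))" by simp
  also have "(\<lambda>n. inverse (z + of_nat (Suc n)) - inverse (- z + of_nat (Suc n))) = 
      (\<lambda>k. 2 * z / (z\<^sup>2 - (of_nat (Suc k))\<^sup>2))"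
  proof
    fix k
    define m where "m = complex_of_nat (Suc k)"
    have "z \<noteq> of_int (int (Suc k))" "z \<noteq> of_int (- int (Suc k))"
      using z Ints_of_int by blast+
    hence "z \<noteq> m" "z \<noteq> -m" by (auto simp: m_def)
    hence "z + m \<noteq> 0" "-z + m \<noteq> 0" by (simp_all add: eq_neg_iff_add_eq_0)
    hence "inverse (z + m) - inverse (- z + m) = ((- z + m) - (z + m)) / ((z + m) * (- z + m))"
      by (simp add: field_simps)
    also have "(- z + m) - (z + m) = - (2 * z)" by simp
    also have "(z + m) * (- z + m) = - (z\<^sup>2 - m\<^sup>2)" by (simp add: power2_eq_square algebra_simps)
    also have "- (2 * z) / - (z\<^sup>2 - m\<^sup>2) = 2 * z / (z\<^sup>2 - m\<^sup>2)" by (rule minus_divide_divide)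
    finally show "inverse (z + of_nat (Suc k)) - inverse (- z + of_nat (Suc k)) = 2 * z / (z\<^sup>2 - (of_nat (Suc k))\<^sup>2)"
      unfolding m_def .
  qed
  finally show ?thesis using z0 by (simp add: D divide_simps)
qed

text \<open>The cotangent expansion at the imaginary point z = i x / (2 pi), multiplied by i: there
  i cot(pi z) is the hyperbolic cotangent (exp x + 1) / (exp x - 1).\<close>

lemma bose_partial_fractions:
  assumes x: "x > (0::real)"
  shows "(\<lambda>k. 2 * x / (x\<^sup>2 + (2 * pi * real (Suc k))\<^sup>2)) sums (1 / (exp x - 1) - 1 / x + 1 / 2)"
proof -
  define y where "y = x / (2 * pi)"
  have y: "y > 0" "x = 2 * pi * y" using x by (auto simp: y_def)
  define z where "z = \<i> * complex_of_real y"
  have "z \<notin> \<int>" using y by (auto simp: z_def Ints_def complex_eq_iff)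
  from sums_mult[OF cot_partial_fractions[OF this], of \<i>]
  have "(\<lambda>k. \<i> * (2 * z / (z\<^sup>2 - (of_nat (Suc k))\<^sup>2))) sums (\<i> * (of_real pi * cot (of_real pi * z) - 1 / z))" .
  also have "(\<lambda>k. \<i> * (2 * z / (z\<^sup>2 - (of_nat (Suc k))\<^sup>2))) = (\<lambda>k. of_real (2 * y / (y\<^sup>2 + (real (Suc k))\<^sup>2)))"
  proof
    fix k
    have 1: "z\<^sup>2 - (of_nat (Suc k))\<^sup>2 = of_real (- (y\<^sup>2 + (real (Suc k))\<^sup>2))"
      by (simp add: z_def power_mult_distrib)
    have 2: "\<i> * (2 * z) = of_real (- (2 * y))" by (simp add: z_def)
    show "\<i> * (2 * z / (z\<^sup>2 - (of_nat (Suc k))\<^sup>2)) = of_real (2 * y / (y\<^sup>2 + (real (Suc k))\<^sup>2))"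
      unfolding times_divide_eq_right 1 2 of_real_divide [symmetric] minus_divide_divide ..
  qed
  also have "\<i> * (of_real pi * cot (of_real pi * z) - 1 / z) = of_real (2 * pi * (1 / (exp x - 1) - 1 / x + 1 / 2))"
  proof -
    define u where "u = exp (complex_of_real (x / 2))"
    have e1: "exp (\<i> * (of_real pi * z)) = inverse u"
    proof -
      have "\<i> * (of_real pi * z) = (\<i> * \<i>) * (of_real pi * of_real y)"
        unfolding z_def by (simp only: mult_ac)
      thus ?thesis by (simp add: u_def y(2) exp_minus[symmetric])
    qed
    have u0: "u \<noteq> 0" by (simp add: u_def)
    have uu: "u * u = of_real (exp x)" unfolding u_def exp_of_real[symmetric] 
      by (simp flip: exp_add)
    have ne: "of_real (exp x) \<noteq> (1::complex)" using x by (metis exp_eq_one_iff less_irrefl of_real_eq_1_iff)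
    have c: "\<i> * cot (of_real pi * z) = (u * u + 1) / (u * u - 1)"
      using u0 ne[folded uu]
      by (simp add: cot_def sin_exp_eq cos_exp_eq exp_minus e1 divide_simps) (simp add: algebra_simps)
    have "\<i> * (of_real pi * cot (of_real pi * z) - 1 / z) = of_real pi * (\<i> * cot (of_real pi * z)) - 1 / of_real y"
      using y by (simp add: z_def algebra_simps)
    also have "\<dots> = of_real (pi * ((exp x + 1) / (exp x - 1)) - 1 / y)"
      unfolding c uu by simp
    also have "pi * ((exp x + 1) / (exp x - 1)) - 1 / y = 2 * pi * (1 / (exp x - 1) - 1 / x + 1 / 2)"
    proof -
      have "exp x - 1 \<noteq> 0" "x \<noteq> 0" using x by auto
      thus ?thesis unfolding y_def by (simp add: divide_simps) (simp add: algebra_simps)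
    qed
    finally show ?thesis .
  qed
  finally have "(\<lambda>k. 2 * y / (y\<^sup>2 + (real (Suc k))\<^sup>2)) sums (2 * pi * (1 / (exp x - 1) - 1 / x + 1 / 2))"
    by (simp only: sums_of_real_iff)
  from sums_mult[OF this, of "1 / (2 * pi)"]
  have "(\<lambda>k. 1 / (2 * pi) * (2 * y / (y\<^sup>2 + (real (Suc k))\<^sup>2))) sums (1 / (exp x - 1) - 1 / x + 1 / 2)" by simp
  also have "(\<lambda>k. 1 / (2 * pi) * (2 * y / (y\<^sup>2 + (real (Suc k))\<^sup>2))) = (\<lambda>k. 2 * x / (x\<^sup>2 + (2 * pi * real (Suc k))\<^sup>2))"
  proof
    fix k
    have "x\<^sup>2 + (2 * pi * real (Suc k))\<^sup>2 = (2 * pi)\<^sup>2 * (y\<^sup>2 + (real (Suc k))\<^sup>2)"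
      by (simp add: y(2) power_mult_distrib algebra_simps del: of_nat_Suc)
    thus "1 / (2 * pi) * (2 * y / (y\<^sup>2 + (real (Suc k))\<^sup>2)) = 2 * x / (x\<^sup>2 + (2 * pi * real (Suc k))\<^sup>2)"
      by (simp add: y(2) power2_eq_square)
  qed
  finally show ?thesis .
qed

section \<open>Integrals of powers against exponential and rational kernels\<close>

lemma nn_integral_powr_exp:
  assumes s: "s > 0" and c: "c > (0::real)"
  shows "(\<integral>\<^sup>+x. ennreal (indicator {0<..} x * x powr (s - 1) * exp (- (c * x))) \<partial>lborel) = ennreal (Gamma s / c powr s)"
proof -
  let ?I = "\<integral>\<^sup>+x. ennreal (indicator {0<..} x * x powr (s - 1) * exp (- (c * x))) \<partial>lborel"
  have "ennreal (Gamma s) = (\<integral>\<^sup>+t. ennreal (indicator {0..} t * t powr (s - 1) / exp t) \<partial>lborel)"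
    using Gamma_conv_nn_integral_real[OF s] .
  also have "\<dots> = \<bar>c\<bar> * (\<integral>\<^sup>+x. ennreal (indicator {0..} (0 + c * x) * (0 + c * x) powr (s - 1) / exp (0 + c * x)) \<partial>lborel)"
    by (rule nn_integral_real_affine) (use c in auto)
  also have "\<dots> = (\<integral>\<^sup>+x. ennreal (c powr s) * ennreal (indicator {0<..} x * x powr (s - 1) * exp (- (c * x))) \<partial>lborel)"
  proof (subst nn_integral_cmult [symmetric], measurable, intro nn_integral_cong)
    fix x :: real
    show "ennreal \<bar>c\<bar> * ennreal (indicator {0..} (0 + c * x) * (0 + c * x) powr (s - 1) / exp (0 + c * x)) =
       ennreal (c powr s) * ennreal (indicator {0<..} x * x powr (s - 1) * exp (- (c * x)))"
    proof (cases "x > 0")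
      case True
      have "c * (c * x) powr (s - 1) = c powr s * x powr (s - 1)"
        using c True by (simp add: powr_mult powr_diff)
      thus ?thesis using c True
        by (simp add: ennreal_mult'[symmetric] exp_minus field_simps)
    next
      case False
      thus ?thesis using c by (cases "x = 0") (auto simp: indicator_def mult_le_0_iff not_le zero_le_mult_iff)
    qed
  qed
  also have "\<dots> = ennreal (c powr s) * ?I" by (rule nn_integral_cmult) measurable
  finally have *: "ennreal (Gamma s) = ennreal (c powr s) * ?I" .
  have "?I = ennreal (1 / c powr s) * (ennreal (c powr s) * ?I)"
    using c by (simp add: mult.assoc[symmetric] ennreal_mult'[symmetric])
  also have "\<dots> = ennreal (Gamma s / c powr s)"
    using c unfolding * [symmetric] by (simp add: ennreal_mult'[symmetric])
  finally show ?thesis .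
qed

text \<open>The beta integral B(p, 1 - p). Rescaling the second Gamma integral by the variable t of
  the first turns the product into a double integral whose t-integral is 1/(1 + u).\<close>

lemma nn_integral_powr_over_one_plus:
  assumes p: "0 < p" "p < (1::real)"
  shows "(\<integral>\<^sup>+u. ennreal (indicator {0<..} u * u powr (-p) / (1 + u)) \<partial>lborel) = ennreal (Gamma p * Gamma (1 - p))"
proof -
  have G: "Gamma p > 0" "Gamma (1 - p) > 0" using p by (auto intro: Gamma_real_pos)
  have "ennreal (Gamma p * Gamma (1 - p)) = 
     (\<integral>\<^sup>+t. ennreal (indicator {0<..} t * t powr (p - 1) * exp (- (1 * t))) \<partial>lborel) * ennreal (Gamma (1 - p))"
    using G p by (subst nn_integral_powr_exp) (auto simp: ennreal_mult')
  also have "\<dots> = (\<integral>\<^sup>+t. ennreal (indicator {0<..} t * t powr (p - 1) * exp (- (1 * t))) * ennreal (Gamma (1 - p)) \<partial>lborel)"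
    by (subst nn_integral_multc) auto
  \<comment> \<open>The factor \<open>t powr (1 - 1)\<close> equals 1 for t > 0; it is kept so that
    \<open>nn_integral_powr_exp\<close> matches with exponent parameter 1 after the order of
    integration is exchanged.\<close>
  also have "\<dots> = (\<integral>\<^sup>+t. (\<integral>\<^sup>+u. ennreal (indicator {0<..} u * u powr (-p)) * ennreal (indicator {0<..} t * t powr (1 - 1) * exp (- ((1 + u) * t))) \<partial>lborel) \<partial>lborel)"
  proof (intro nn_integral_cong)
    fix t :: real
    show "ennreal (indicator {0<..} t * t powr (p - 1) * exp (- (1 * t))) * ennreal (Gamma (1 - p)) = 
       (\<integral>\<^sup>+u. ennreal (indicator {0<..} u * u powr (-p)) * ennreal (indicator {0<..} t * t powr (1 - 1) * exp (- ((1 + u) * t))) \<partial>lborel)"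
    proof (cases "t > 0")
      case True
      have "ennreal (exp (-t)) * (\<integral>\<^sup>+u. ennreal (indicator {0<..} u * u powr ((1 - p) - 1) * exp (- (t * u))) \<partial>lborel)
        = ennreal (exp (-t)) * ennreal (Gamma (1 - p) / t powr (1 - p))"
        using p True by (subst nn_integral_powr_exp) auto
      also have "\<dots> = ennreal (indicator {0<..} t * t powr (p - 1) * exp (- (1 * t))) * ennreal (Gamma (1 - p))"
        using True G by (simp add: ennreal_mult'[symmetric] powr_diff field_simps)
      also have "ennreal (exp (-t)) * (\<integral>\<^sup>+u. ennreal (indicator {0<..} u * u powr ((1 - p) - 1) * exp (- (t * u))) \<partial>lborel)
        = (\<integral>\<^sup>+u. ennreal (exp (-t)) * ennreal (indicator {0<..} u * u powr ((1 - p) - 1) * exp (- (t * u))) \<partial>lborel)"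
        by (rule nn_integral_cmult [symmetric]) measurable
      also have "\<dots> = (\<integral>\<^sup>+u. ennreal (indicator {0<..} u * u powr (-p)) * ennreal (indicator {0<..} t * t powr (1 - 1) * exp (- ((1 + u) * t))) \<partial>lborel)"
      proof (intro nn_integral_cong)
        fix u :: real
        have "exp (- t) * exp (- (t * u)) = exp (- ((1 + u) * t))"
          by (simp add: exp_add [symmetric] algebra_simps)
        thus "ennreal (exp (-t)) * ennreal (indicator {0<..} u * u powr ((1 - p) - 1) * exp (- (t * u))) =
          ennreal (indicator {0<..} u * u powr (-p)) * ennreal (indicator {0<..} t * t powr (1 - 1) * exp (- ((1 + u) * t)))"
          using True by (simp add: ennreal_mult'[symmetric] mult_ac)
      qed
      finally show ?thesis by simp
    qed auto
  qed
  also have "\<dots> = (\<integral>\<^sup>+u. (\<integral>\<^sup>+t. ennreal (indicator {0<..} u * u powr (-p)) * ennreal (indicator {0<..} t * t powr (1 - 1) * exp (- ((1 + u) * t))) \<partial>lborel) \<partial>lborel)"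
    by (rule lborel_pair.Fubini') measurable
  also have "\<dots> = (\<integral>\<^sup>+u. ennreal (indicator {0<..} u * u powr (-p) / (1 + u)) \<partial>lborel)"
  proof (intro nn_integral_cong)
    fix u :: real
    show "(\<integral>\<^sup>+t. ennreal (indicator {0<..} u * u powr (-p)) * ennreal (indicator {0<..} t * t powr (1 - 1) * exp (- ((1 + u) * t))) \<partial>lborel)
       = ennreal (indicator {0<..} u * u powr (-p) / (1 + u))"
    proof (cases "u > 0")
      case True
      show ?thesis using True
        by (subst nn_integral_cmult, measurable, subst nn_integral_powr_exp)
           (auto simp: ennreal_mult'[symmetric])
    qed auto
  qed
  finally show ?thesis by simp
qed

text \<open>The substitution u = x^2 reduces this to the beta integral with p = (1 - s)/2, for which
  the sine in the reflection formula becomes cos(pi s / 2).\<close>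

lemma nn_integral_powr_over_square_plus_1:
  assumes s: "-1 < s" "s < (1::real)"
  shows "(\<integral>\<^sup>+x. ennreal (indicator {0<..} x * x powr s / (x\<^sup>2 + 1)) \<partial>lborel) = ennreal (pi / (2 * cos (pi * s / 2)))"
proof -
  define p where "p = (1 - s) / 2"
  define J where "J = Gamma p * Gamma (1 - p)"
  define f where "f = (\<lambda>u::real. u powr (-p) / (1 + u))"
  have p: "0 < p" "p < 1" using s by (auto simp: p_def)
  have J: "J > 0" unfolding J_def using p by (intro mult_pos_pos Gamma_real_pos) auto
  have "complex_of_real J = complex_of_real (pi / sin (pi * p))"
    using Gamma_reflection_complex[of "of_real p"] 
    by (simp add: J_def Gamma_complex_of_real[symmetric] sin_of_real[symmetric])
  hence Jeq: "J = pi / cos (pi * s / 2)"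
    by (simp only: of_real_eq_iff) (simp add: p_def sin_cos_eq field_simps)
  have nnf: "(\<integral>\<^sup>+u. ennreal (indicator {0<..} u * f u) \<partial>lborel) = ennreal J"
    using nn_integral_powr_over_one_plus[OF p] by (simp add: f_def J_def)
  have meas: "(\<lambda>u. indicator {0<..} u * f u) \<in> borel_measurable lborel" unfolding f_def by measurable
  have nn: "indicator {0<..} u * f u \<ge> 0" for u :: real by (auto simp: f_def indicator_def)
  have sint: "set_integrable lborel {0<..} f"
    unfolding set_integrable_def
    using meas nnf nn by (intro integrableI_nonneg) auto
  have "(LINT u:{0<..}|lborel. f u) = J"
    unfolding set_lebesgue_integral_def
    using meas nnf nn J by (subst integral_eq_nn_integral) auto
  hence fi: "f integrable_on {0<..}" "integral {0<..} f = J"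
    using set_borel_integral_eq_integral[OF sint] by auto
  have "f absolutely_integrable_on {0<..}"
    by (rule nonnegative_absolutely_integrable_1[OF fi(1)]) (auto simp: f_def)
  moreover have im: "(\<lambda>x::real. x\<^sup>2) ` {0<..} = {0<..}"
  proof (safe)
    fix x :: real assume "x > 0"
    thus "x \<in> (\<lambda>x. x\<^sup>2) ` {0<..}" by (intro image_eqI[of _ _ "sqrt x"]) auto
  qed auto
  ultimately have "(\<lambda>x. \<bar>2 * x\<bar> * f (x\<^sup>2)) absolutely_integrable_on {0<..} \<and> integral {0<..} (\<lambda>x. \<bar>2 * x\<bar> * f (x\<^sup>2)) = J"
    using fi
    by (subst has_absolute_integral_change_of_variables_1')
       (auto intro!: derivative_eq_intros inj_onI simp: power2_eq_iff)
  hence hi: "((\<lambda>x. \<bar>2 * x\<bar> * f (x\<^sup>2)) has_integral J) {0<..}"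
    by (meson absolutely_integrable_on_def has_integral_iff)
  have "((\<lambda>x. x powr s / (x\<^sup>2 + 1)) has_integral (J / 2)) {0<..}"
  proof (rule has_integral_eq[OF _ has_integral_divide[OF hi, of 2]])
    fix x :: real assume "x \<in> {0<..}"
    hence x: "x > 0" by simp
    have "(x\<^sup>2) powr (-p) = x powr (s - 1)"
    proof -
      have "(x\<^sup>2) powr (-p) = (x powr 2) powr (-p)" using x by simp
      also have "\<dots> = x powr (2 * (-p))" by (rule powr_powr)
      also have "2 * (-p) = s - 1" by (simp add: p_def field_simps)
      finally show ?thesis .
    qed
    thus "\<bar>2 * x\<bar> * f (x\<^sup>2) / 2 = x powr s / (x\<^sup>2 + 1)"
    proof -
      have "2 + x\<^sup>2 * 2 \<noteq> 0" "1 + x\<^sup>2 \<noteq> 0" by (smt (verit) zero_le_power2)+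
      thus ?thesis using x \<open>(x\<^sup>2) powr (-p) = x powr (s - 1)\<close>
        by (simp add: f_def powr_diff add_ac frac_eq_eq)
    qed
  qed
  from nn_integral_has_integral_lebesgue[OF _ this]
  have "(\<integral>\<^sup>+x. ennreal (indicator {0<..} x * (x powr s / (x\<^sup>2 + 1))) \<partial>lborel) = ennreal (J / 2)"
    by simp
  thus ?thesis by (simp add: Jeq mult.commute)
qed

text \<open>With a = 2 pi k the factor a^(s-1) supplies the terms of the series for zeta(1 -
  s).\<close>

lemma nn_integral_powr_over_square_plus:
  assumes s: "-1 < s" "s < (1::real)" and a: "a > 0"
  shows "(\<integral>\<^sup>+x. ennreal (indicator {0<..} x * x powr s / (x\<^sup>2 + a\<^sup>2)) \<partial>lborel) = ennreal (a powr (s - 1) * pi / (2 * cos (pi * s / 2)))"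
proof -
  have "cos (pi * s / 2) > 0"
  proof (rule cos_gt_zero_pi)
    have "pi * (-1) < pi * s" "pi * s < pi * 1" using s by (intro mult_strict_left_mono; simp)+
    thus "- (pi / 2) < pi * s / 2" "pi * s / 2 < pi / 2" by auto
  qed
  hence c: "pi / (2 * cos (pi * s / 2)) \<ge> 0" by simp
  have "(\<integral>\<^sup>+x. ennreal (indicator {0<..} x * x powr s / (x\<^sup>2 + a\<^sup>2)) \<partial>lborel)
     = \<bar>a\<bar> * (\<integral>\<^sup>+x. ennreal (indicator {0<..} (0 + a * x) * (0 + a * x) powr s / ((0 + a * x)\<^sup>2 + a\<^sup>2)) \<partial>lborel)"
    by (rule nn_integral_real_affine) (use a in auto)
  also have "\<dots> = (\<integral>\<^sup>+x. ennreal (a powr (s - 1)) * ennreal (indicator {0<..} x * x powr s / (x\<^sup>2 + 1)) \<partial>lborel)"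
  proof (subst nn_integral_cmult [symmetric], measurable, intro nn_integral_cong)
    fix x :: real
    show "ennreal \<bar>a\<bar> * ennreal (indicator {0<..} (0 + a * x) * (0 + a * x) powr s / ((0 + a * x)\<^sup>2 + a\<^sup>2)) =
       ennreal (a powr (s - 1)) * ennreal (indicator {0<..} x * x powr s / (x\<^sup>2 + 1))"
    proof (cases "x > 0")
      case True
      have d: "(a * x)\<^sup>2 + a\<^sup>2 = a * a * (x\<^sup>2 + 1)" by (simp add: power2_eq_square algebra_simps)
      have "x\<^sup>2 + 1 > 0" by (rule add_nonneg_pos) auto
      hence "a * ((a * x) powr s / ((a * x)\<^sup>2 + a\<^sup>2)) = a powr (s - 1) * (x powr s / (x\<^sup>2 + 1))"
        unfolding d using a True by (simp add: powr_mult powr_diff)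
      thus ?thesis using a True by (simp add: ennreal_mult'[symmetric])
    next
      case False
      thus ?thesis using a by (auto simp: indicator_def zero_less_mult_iff)
    qed
  qed
  also have "\<dots> = ennreal (a powr (s - 1)) * ennreal (pi / (2 * cos (pi * s / 2)))"
    by (subst nn_integral_cmult, measurable, subst nn_integral_powr_over_square_plus_1[OF s]) simp
  also have "\<dots> = ennreal (a powr (s - 1) * pi / (2 * cos (pi * s / 2)))"
    using c by (subst ennreal_mult[symmetric]) auto
  finally show ?thesis .
qed

section \<open>The functional equation\<close>

text \<open>Equal to coth(x/2)/2 - 1/x. The first two Laurent terms of 1/(exp x - 1) at 0 are
  removed, so it is O(x) there but tends to 1/2 at infinity.\<close>

definition bose_reg :: "real \<Rightarrow> real" where
  "bose_reg x = 1 / (exp x - 1) - 1 / x + 1 / 2"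

text \<open>Cutting at 1 makes the Mellin integral converge in the whole half-plane \<open>Re s > -1\<close>; the removed
  terms \<open>1/x - 1/2\<close> have explicit Mellin transforms.\<close>

definition bose_cut :: "real \<Rightarrow> real" where
  "bose_cut x = (if x < 1 then bose_reg x else 1 / (exp x - 1))"

lemma bose_reg_nonneg: "x > 0 \<Longrightarrow> bose_reg x \<ge> 0"
  unfolding bose_reg_def by (rule sums_le[OF _ sums_zero bose_partial_fractions]) auto

text \<open>Drop x^2 from the denominators of the partial fractions and sum the inverse squares;
  1/12 is the next Laurent coefficient.\<close>

lemma bose_reg_le:
  assumes "x > 0"
  shows "bose_reg x \<le> x / 12"
proof -
  have "(\<lambda>k. x / (2 * pi\<^sup>2) * (1 / (real k + 1)\<^sup>2)) sums (x / (2 * pi\<^sup>2) * (pi\<^sup>2 / 6))"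
    using inverse_squares_sums by (intro sums_mult) (simp add: add_ac)
  moreover have "2 * x / (x\<^sup>2 + (2 * pi * real (Suc k))\<^sup>2) \<le> x / (2 * pi\<^sup>2) * (1 / (real k + 1)\<^sup>2)" for k
  proof -
    have "2 * x / (x\<^sup>2 + (2 * pi * real (Suc k))\<^sup>2) \<le> 2 * x / (2 * pi * real (Suc k))\<^sup>2"
      using assms by (intro divide_left_mono mult_pos_pos add_nonneg_pos) auto
    also have "\<dots> = x / (2 * pi\<^sup>2) * (1 / (real k + 1)\<^sup>2)"
      by (simp add: power_mult_distrib add_ac)
    finally show ?thesis .
  qed
  ultimately have "bose_reg x \<le> x / (2 * pi\<^sup>2) * (pi\<^sup>2 / 6)"
    unfolding bose_reg_def by (intro sums_le[OF _ bose_partial_fractions[OF assms]])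
  thus ?thesis by simp
qed

lemma bose_cut_nonneg: "x > 0 \<Longrightarrow> bose_cut x \<ge> 0"
  by (simp add: bose_cut_def bose_reg_nonneg)

lemma measurable_bose [measurable]: "bose_reg \<in> borel_measurable borel" "bose_cut \<in> borel_measurable borel"
  unfolding bose_reg_def bose_cut_def by measurable

lemma has_bochner_integral_nn:
  fixes f :: "'a \<Rightarrow> real"
  assumes "f \<in> borel_measurable M" "\<And>x. f x \<ge> 0" "(\<integral>\<^sup>+x. ennreal (f x) \<partial>M) = ennreal I" "I \<ge> 0"
  shows "has_bochner_integral M f I"
  by (rule has_bochner_integral_nn_integral) (use assms in auto)

lemma has_bochner_integral_powr_0_1:
  assumes "p > (-1::real)"
  shows "has_bochner_integral lborel (\<lambda>x. indicator {0<..<1} x * x powr p) (1 / (p + 1))"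
proof (rule has_bochner_integral_nn)
  have "((\<lambda>x. x powr p) has_integral (1 / (p + 1))) {0<..<1}"
    using has_integral_powr_from_0[of p 1] assms by (simp add: has_integral_Icc_iff_Ioo)
  from nn_integral_has_integral_lebesgue[OF _ this]
  show "(\<integral>\<^sup>+x. ennreal (indicator {0<..<1} x * x powr p) \<partial>lborel) = ennreal (1 / (p + 1))" by simp
qed (use assms in \<open>auto simp: indicator_def\<close>)

lemma has_bochner_integral_powr_inf:
  assumes "p < (-1::real)" "a > 0"
  shows "has_bochner_integral lborel (\<lambda>x. indicator {a..} x * x powr p) (- (a powr (p + 1)) / (p + 1))"
proof (rule has_bochner_integral_nn)
  have "((\<lambda>x. x powr p) has_integral (- (a powr (p + 1)) / (p + 1))) {a..}"
    using has_integral_powr_to_inf[of p a] assms by simp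
  from nn_integral_has_integral_lebesgue[OF _ this]
  show "(\<integral>\<^sup>+x. ennreal (indicator {a..} x * x powr p) \<partial>lborel) = ennreal (- (a powr (p + 1)) / (p + 1))" by simp
qed (use assms in \<open>auto simp: indicator_def divide_simps\<close>)

lemma has_bochner_integral_powr_1_inf:
  assumes "p < (-1::real)"
  shows "has_bochner_integral lborel (\<lambda>x. indicator {1..} x * x powr p) (- 1 / (p + 1))"
  using has_bochner_integral_powr_inf[OF assms, of 1] by simp

text \<open>The classical Gamma(s) zeta(s) formula: expand the kernel as a geometric series in
  exp(-x) and integrate termwise, which positivity permits.\<close>

lemma bose_mellin:
  assumes s: "s > 1"
  shows "has_bochner_integral lborel (\<lambda>x. indicator {0<..} x * (1 / (exp x - 1)) * x powr (s - 1))
     (Gamma s * (Re (zeta_reg (of_real s)) / (s - 1)))"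
proof (rule has_bochner_integral_nn)
  have G: "Gamma s > 0" using s by (intro Gamma_real_pos) auto
  have Z: "Re (zeta_reg (of_real s)) / (s - 1) > 0" using s zeta_reg_pos_real[of s] by simp
  show "Gamma s * (Re (zeta_reg (of_real s)) / (s - 1)) \<ge> 0" using G Z by (intro mult_nonneg_nonneg) auto
  show "indicator {0<..} x * (1 / (exp x - 1)) * x powr (s - 1) \<ge> 0" for x :: real
    by (auto simp: indicator_def)
  have "(\<integral>\<^sup>+x. ennreal (indicator {0<..} x * (1 / (exp x - 1)) * x powr (s - 1)) \<partial>lborel)
    = (\<integral>\<^sup>+x. (\<Sum>k. ennreal (indicator {0<..} x * x powr (s - 1) * exp (- (real (Suc k) * x)))) \<partial>lborel)"
  proof (intro nn_integral_cong)
    fix x :: real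
    show "ennreal (indicator {0<..} x * (1 / (exp x - 1)) * x powr (s - 1)) =
       (\<Sum>k. ennreal (indicator {0<..} x * x powr (s - 1) * exp (- (real (Suc k) * x))))"
    proof (cases "x > 0")
      case True
      have "(\<lambda>k. exp (-x) * exp (-x) ^ k) sums (exp (-x) * (1 / (1 - exp (-x))))"
        using True by (intro sums_mult geometric_sums) auto
      also have "exp (-x) * (1 / (1 - exp (-x))) = 1 / (exp x - 1)"
        using True by (simp add: exp_minus field_simps)
      also have "(\<lambda>k. exp (-x) * exp (-x) ^ k) = (\<lambda>k. exp (- (real (Suc k) * x)))"
        by (simp add: exp_of_nat_mult[symmetric] exp_add[symmetric] algebra_simps)
      finally have "(\<lambda>k. x powr (s - 1) * exp (- (real (Suc k) * x))) sums (x powr (s - 1) * (1 / (exp x - 1)))"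
        by (rule sums_mult)
      hence "(\<Sum>k. ennreal (x powr (s - 1) * exp (- (real (Suc k) * x)))) = ennreal (x powr (s - 1) * (1 / (exp x - 1)))"
        by (intro suminf_ennreal_eq) auto
      thus ?thesis using True by (simp add: mult.commute)
    qed auto
  qed
  also have "\<dots> = (\<Sum>k. \<integral>\<^sup>+x. ennreal (indicator {0<..} x * x powr (s - 1) * exp (- (real (Suc k) * x))) \<partial>lborel)"
    by (rule nn_integral_suminf) measurable
  also have "\<dots> = (\<Sum>k. ennreal (Gamma s * (1 / real (Suc k) powr s)))"
    using s by (subst nn_integral_powr_exp) auto
  also have "\<dots> = ennreal (Gamma s * (Re (zeta_reg (of_real s)) / (s - 1)))"
    using G by (intro suminf_ennreal_eq sums_mult zeta_reg_sums_real s) auto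
  finally show "(\<integral>\<^sup>+x. ennreal (indicator {0<..} x * (1 / (exp x - 1)) * x powr (s - 1)) \<partial>lborel)
    = ennreal (Gamma s * (Re (zeta_reg (of_real s)) / (s - 1)))" .
qed measurable

lemma integrable_bose_cut:
  assumes "\<sigma> > -1"
  shows "integrable lborel (\<lambda>x. indicator {0<..} x * bose_cut x * x powr (\<sigma> - 1))"
proof (rule Bochner_Integration.integrable_bound)
  \<comment> \<open>Near 0 the majorant is x^\<sigma>. On x \<ge> 1 the exponent may be raised to
    \<tau> > 1, where \<open>bose_mellin\<close> already provides integrability.\<close>
  define \<tau> where "\<tau> = max \<sigma> 2"
  show "integrable lborel (\<lambda>x. indicator {0<..<1} x * x powr \<sigma> +
     indicator {0<..} x * (1 / (exp x - 1)) * x powr (\<tau> - 1))"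
    by (intro Bochner_Integration.integrable_add integrable.intros[OF has_bochner_integral_powr_0_1[OF assms]]
          integrable.intros[OF bose_mellin]) (simp add: \<tau>_def)
  show "AE x in lborel. norm (indicator {0<..} x * bose_cut x * x powr (\<sigma> - 1)) \<le>
     norm (indicator {0<..<1} x * x powr \<sigma> + indicator {0<..} x * (1 / (exp x - 1)) * x powr (\<tau> - 1))"
  proof (intro AE_I2)
    fix x :: real
    consider "x \<le> 0" | "0 < x" "x < 1" | "x \<ge> 1" by linarith
    thus "norm (indicator {0<..} x * bose_cut x * x powr (\<sigma> - 1)) \<le>
     norm (indicator {0<..<1} x * x powr \<sigma> + indicator {0<..} x * (1 / (exp x - 1)) * x powr (\<tau> - 1))"
    proof cases
      case 2
      have "bose_reg x * x powr (\<sigma> - 1) \<le> x * x powr (\<sigma> - 1)"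
        using bose_reg_le[of x] 2 by (intro mult_right_mono) auto
      also have "\<dots> = x powr \<sigma>" using 2 by (simp add: powr_diff)
      finally have "bose_reg x * x powr (\<sigma> - 1) \<le> x powr \<sigma>" .
      moreover have nn: "1 / (exp x - 1) * x powr (\<tau> - 1) \<ge> 0" "bose_reg x * x powr (\<sigma> - 1) \<ge> 0"
        using 2 bose_reg_nonneg[of x] by auto
      ultimately have "bose_reg x * x powr (\<sigma> - 1) \<le> x powr \<sigma> + 1 / (exp x - 1) * x powr (\<tau> - 1)"
        by linarith
      thus ?thesis using 2 nn(2) by (simp add: bose_cut_def)
    next
      case 3
      have "x powr (\<sigma> - 1) \<le> x powr (\<tau> - 1)" using 3 by (intro powr_mono) (auto simp: \<tau>_def)
      hence "1 / (exp x - 1) * x powr (\<sigma> - 1) \<le> 1 / (exp x - 1) * x powr (\<tau> - 1)"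
        using 3 by (intro mult_left_mono) auto
      thus ?thesis using 3 by (simp add: bose_cut_def)
    qed auto
  qed
qed measurable

text \<open>The Mellin transform of \<open>bose_cut\<close>, with x^(s-1) written as exp(s ln x) / x
  to fit \<open>exp_integral_holomorphic\<close>.\<close>

definition bose_transform :: "complex \<Rightarrow> complex" where
  "bose_transform s = (\<integral>x. of_real (indicator {0<..} x * bose_cut x / x) * exp (s * of_real (ln x)) \<partial>lborel)"

lemma holomorphic_bose_transform: "bose_transform holomorphic_on {s. Re s > -1}"
proof -
  have "bose_transform holomorphic_on {s. ereal (-1) < ereal (Re s) \<and> ereal (Re s) < \<infinity>}"
    unfolding bose_transform_def
  proof (rule exp_integral_holomorphic)
    fix \<sigma> assume "ereal (-1) < ereal \<sigma>"
    hence "\<sigma> > -1" by simp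
    have "norm (complex_of_real (indicator {0<..} x * bose_cut x / x)) * exp (\<sigma> * ln x) = 
       indicator {0<..} x * bose_cut x * x powr (\<sigma> - 1)" for x
      using bose_cut_nonneg[of x] by (cases "x > 0") (auto simp: powr_def exp_diff algebra_simps norm_mult norm_divide)
    thus "integrable lborel (\<lambda>x. norm (complex_of_real (indicator {0<..} x * bose_cut x / x)) * exp (\<sigma> * ln x))"
      using integrable_bose_cut[OF \<open>\<sigma> > -1\<close>] by simp
  qed measurable
  thus ?thesis by simp
qed

lemma bose_transform_of_real:
  "bose_transform (of_real s) = of_real (\<integral>x. indicator {0<..} x * bose_cut x * x powr (s - 1) \<partial>lborel)"
proof -
  have "of_real (indicator {0<..} x * bose_cut x / x) * exp (of_real s * of_real (ln x)) =
     complex_of_real (indicator {0<..} x * bose_cut x * x powr (s - 1))" for x :: real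
  proof (cases "x > 0")
    case True
    hence "x powr (s - 1) = exp (s * ln x) / x" by (simp add: powr_diff) (simp add: powr_def)
    thus ?thesis by (simp add: exp_of_real[symmetric] del: exp_of_real)
  qed auto
  thus ?thesis unfolding bose_transform_def by (simp only: integral_complex_of_real)
qed

text \<open>For 1 < s < 2 the terms cut off on (0, 1) integrate to 1/(s - 1) - 1/(2 s). Multiplying
  by s (s - 1) clears both poles, turns Gamma(s) into Gamma(s + 1), and leaves an identity that
  continues to Re s > -1.\<close>

lemma Gamma_times_zeta_reg:
  assumes "Re s > -1"
  shows "Gamma (s + 1) * zeta_reg s = s * (s - 1) * bose_transform s + (s + 1) / 2"
proof (rule holomorphic_eq_if_eq_on_reals[where S = "{s. Re s > -1}" and a = 1 and b = 2 and z = s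
      and f = "\<lambda>s. Gamma (s + 1) * zeta_reg s" and g = "\<lambda>s. s * (s - 1) * bose_transform s + (s + 1) / 2"])
  show "(\<lambda>s. Gamma (s + 1) * zeta_reg s) holomorphic_on {s. - 1 < Re s}"
    by (auto intro!: holomorphic_intros holomorphic_zeta_reg elim!: nonpos_Ints_cases simp: complex_eq_iff)
  show "(\<lambda>s. s * (s - 1) * bose_transform s + (s + 1) / 2) holomorphic_on {s. - 1 < Re s}"
    by (intro holomorphic_intros holomorphic_bose_transform) auto
  show "open {s. - 1 < Re s}" by (rule open_halfspace_Re_gt)
  show "connected {s. - 1 < Re s}" by (intro convex_connected convex_halfspace_Re_gt)
  fix x :: real assume x: "1 < x" "x < 2"
  define A where "A = (\<integral>t. indicator {0<..} t * bose_cut t * t powr (x - 1) \<partial>lborel)"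
  have "has_bochner_integral lborel (\<lambda>t. indicator {0<..} t * bose_cut t * t powr (x - 1)
     + (indicator {0<..<1} t * t powr (x - 2) - 1 / 2 * (indicator {0<..<1} t * t powr (x - 1)))) (A + (1 / ((x - 2) + 1) - 1 / 2 * (1 / ((x - 1) + 1))))"
    unfolding A_def using x
    by (intro has_bochner_integral_add has_bochner_integral_diff has_bochner_integral_mult_right 
        has_bochner_integral_powr_0_1 has_bochner_integral_integrable integrable_bose_cut) auto
  also have "(\<lambda>t. indicator {0<..} t * bose_cut t * t powr (x - 1)
     + (indicator {0<..<1} t * t powr (x - 2) - 1 / 2 * (indicator {0<..<1} t * t powr (x - 1)))) =
     (\<lambda>t. indicator {0<..} t * (1 / (exp t - 1)) * t powr (x - 1))"
  proof
    fix t :: real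
    have "t powr (x - 2) = t powr (x - 1) / t" if "t > 0"
      using that powr_diff[of t "x - 1" 1] by simp
    thus "indicator {0<..} t * bose_cut t * t powr (x - 1)
     + (indicator {0<..<1} t * t powr (x - 2) - 1 / 2 * (indicator {0<..<1} t * t powr (x - 1))) =
      indicator {0<..} t * (1 / (exp t - 1)) * t powr (x - 1)"
      by (cases "t > 0"; cases "t < 1") (auto simp: bose_cut_def bose_reg_def algebra_simps)
  qed
  finally have "A + (1 / (x - 1) - 1 / 2 * (1 / x)) = Gamma x * (Re (zeta_reg (of_real x)) / (x - 1))"
    using has_bochner_integral_eq[OF _ bose_mellin[OF x(1)]] by simp
  hence "x * (x - 1) * (Gamma x * (Re (zeta_reg (of_real x)) / (x - 1))) = x * (x - 1) * (A + (1 / (x - 1) - 1 / 2 * (1 / x)))"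
    by simp
  also have "\<dots> = x * (x - 1) * A + (x + 1) / 2"
    using x by (simp add: field_simps)
  also have "x * (x - 1) * (Gamma x * (Re (zeta_reg (of_real x)) / (x - 1))) = x * Gamma x * Re (zeta_reg (of_real x))"
    using x by simp
  finally have "x * Gamma x * Re (zeta_reg (of_real x)) = x * (x - 1) * A + (x + 1) / 2" .
  moreover have "Gamma (x + 1) = x * Gamma x" using x by (intro Gamma_plus1) (auto elim!: nonpos_Ints_cases)
  ultimately have "of_real (Gamma (x + 1) * Re (zeta_reg (of_real x))) = complex_of_real (x * (x - 1) * A + (x + 1) / 2)"
    by simp
  thus "Gamma (of_real x + 1) * zeta_reg (of_real x) = of_real x * (of_real x - 1) * bose_transform (of_real x) + (of_real x + 1) / 2"
    using x zeta_reg_of_real[of x] by (simp add: bose_transform_of_real A_def Gamma_complex_of_real[symmetric])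
qed (use assms in auto)

text \<open>For -1 < s < 0 the terms 1/x and 1/2 are integrated over [1, \<infinity>) instead of (0,
  1), yet yield the same rational expressions in s. So Gamma(s) zeta(s) is now the full Mellin
  integral of \<open>bose_reg\<close>, and integrating its partial fractions termwise produces
  zeta(1 - s).\<close>

lemma zeta_reg_functional_equation_real:
  assumes s: "-1 < s" "s < 0"
  shows "Gamma (s + 1) * Re (zeta_reg (of_real s)) * cos (pi * s / 2) =
     (1 - s) * (2 * pi) powr (s - 1) * pi * Re (zeta_reg (of_real (1 - s)))"
proof -
  define A where "A = (\<integral>t. indicator {0<..} t * bose_cut t * t powr (s - 1) \<partial>lborel)"
  have cos: "cos (pi * s / 2) > 0"
  proof (rule cos_gt_zero_pi)
    have "pi * (-1) < pi * s" "pi * s < pi * 1" using s by (intro mult_strict_left_mono; simp)+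
    thus "- (pi / 2) < pi * s / 2" "pi * s / 2 < pi / 2" by auto
  qed
  have "has_bochner_integral lborel (\<lambda>t. indicator {0<..} t * bose_cut t * t powr (s - 1)
     + (1 / 2 * (indicator {1..} t * t powr (s - 1)) - indicator {1..} t * t powr (s - 2))) 
     (A + (1 / 2 * (- 1 / ((s - 1) + 1)) - (- 1 / ((s - 2) + 1))))"
    unfolding A_def using s
    by (intro has_bochner_integral_add has_bochner_integral_diff has_bochner_integral_mult_right 
        has_bochner_integral_powr_1_inf has_bochner_integral_integrable integrable_bose_cut) auto
  also have "(\<lambda>t. indicator {0<..} t * bose_cut t * t powr (s - 1)
     + (1 / 2 * (indicator {1..} t * t powr (s - 1)) - indicator {1..} t * t powr (s - 2))) =
     (\<lambda>t. indicator {0<..} t * bose_reg t * t powr (s - 1))"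
  proof
    fix t :: real
    have "t powr (s - 2) = t powr (s - 1) / t" if "t > 0"
      using that powr_diff[of t "s - 1" 1] by simp
    thus "indicator {0<..} t * bose_cut t * t powr (s - 1)
     + (1 / 2 * (indicator {1..} t * t powr (s - 1)) - indicator {1..} t * t powr (s - 2)) =
      indicator {0<..} t * bose_reg t * t powr (s - 1)"
      by (cases "t > 0"; cases "t < 1") (auto simp: bose_cut_def bose_reg_def algebra_simps)
  qed
  finally have 1: "has_bochner_integral lborel (\<lambda>t. indicator {0<..} t * bose_reg t * t powr (s - 1)) (A + (1 / (s - 1) - 1 / (2 * s)))"
    using s by (simp add: field_simps)
  \<comment> \<open>The k-th partial fraction integrates to K k^(s-1) with k counted from 1, and Z
    is zeta(1 - s).\<close>
  define K where "K = (2 * pi) powr (s - 1) * pi / cos (pi * s / 2)"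
  have K: "K > 0" using cos by (simp add: K_def)
  define Z where "Z = Re (zeta_reg (of_real (1 - s))) / (- s)"
  have Z: "Z > 0" unfolding Z_def using s zeta_reg_pos_real[of "1 - s"] by (intro divide_pos_pos) auto
  have "has_bochner_integral lborel (\<lambda>t. indicator {0<..} t * bose_reg t * t powr (s - 1)) (K * Z)"
  proof (rule has_bochner_integral_nn)
    show "indicator {0<..} t * bose_reg t * t powr (s - 1) \<ge> 0" for t
      using bose_reg_nonneg[of t] by (auto simp: indicator_def)
    have "(\<integral>\<^sup>+t. ennreal (indicator {0<..} t * bose_reg t * t powr (s - 1)) \<partial>lborel) =
       (\<integral>\<^sup>+t. (\<Sum>k. ennreal 2 * ennreal (indicator {0<..} t * t powr s / (t\<^sup>2 + (2 * pi * real (Suc k))\<^sup>2))) \<partial>lborel)"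
    proof (intro nn_integral_cong)
      fix t :: real
      show "ennreal (indicator {0<..} t * bose_reg t * t powr (s - 1)) =
        (\<Sum>k. ennreal 2 * ennreal (indicator {0<..} t * t powr s / (t\<^sup>2 + (2 * pi * real (Suc k))\<^sup>2)))"
      proof (cases "t > 0")
        case True
        have "(\<lambda>k. t powr (s - 1) * (2 * t / (t\<^sup>2 + (2 * pi * real (Suc k))\<^sup>2))) sums (t powr (s - 1) * bose_reg t)"
          unfolding bose_reg_def by (intro sums_mult bose_partial_fractions True)
        also have "(\<lambda>k. t powr (s - 1) * (2 * t / (t\<^sup>2 + (2 * pi * real (Suc k))\<^sup>2))) =
          (\<lambda>k. 2 * (t powr s / (t\<^sup>2 + (2 * pi * real (Suc k))\<^sup>2)))"
          using True by (simp add: powr_diff mult.commute)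
        finally have "(\<Sum>k. ennreal (2 * (t powr s / (t\<^sup>2 + (2 * pi * real (Suc k))\<^sup>2)))) = ennreal (t powr (s - 1) * bose_reg t)"
          by (intro suminf_ennreal_eq) auto
        moreover have "ennreal (2 * (t powr s / (t\<^sup>2 + (2 * pi * real (Suc k))\<^sup>2))) = 
            ennreal 2 * ennreal (indicator {0<..} t * t powr s / (t\<^sup>2 + (2 * pi * real (Suc k))\<^sup>2))" for k
          using True by (subst ennreal_mult[symmetric]) auto
        ultimately show ?thesis using True by (simp add: mult.commute)
      qed auto
    qed
    also have "\<dots> = (\<Sum>k. \<integral>\<^sup>+t. ennreal 2 * ennreal (indicator {0<..} t * t powr s / (t\<^sup>2 + (2 * pi * real (Suc k))\<^sup>2)) \<partial>lborel)"
      by (rule nn_integral_suminf) measurable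
    also have "\<dots> = (\<Sum>k. ennreal (K * (1 / real (Suc k) powr (1 - s))))"
    proof (rule suminf_cong)
      fix k
      have "(\<integral>\<^sup>+t. ennreal 2 * ennreal (indicator {0<..} t * t powr s / (t\<^sup>2 + (2 * pi * real (Suc k))\<^sup>2)) \<partial>lborel)
        = ennreal 2 * ennreal ((2 * pi * real (Suc k)) powr (s - 1) * pi / (2 * cos (pi * s / 2)))"
        using s by (subst nn_integral_cmult, measurable, subst nn_integral_powr_over_square_plus) auto
      also have "\<dots> = ennreal (2 * ((2 * pi * real (Suc k)) powr (s - 1) * pi / (2 * cos (pi * s / 2))))"
        using cos by (intro ennreal_mult[symmetric]) auto
      also have "(2 * pi * real (Suc k)) powr (s - 1) = (2 * pi) powr (s - 1) * real (Suc k) powr (s - 1)"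
        by (rule powr_mult)
      also have "real (Suc k) powr (s - 1) = 1 / real (Suc k) powr (1 - s)"
        using powr_minus_divide[of "real (Suc k)" "1 - s"] by simp
      finally show "(\<integral>\<^sup>+t. ennreal 2 * ennreal (indicator {0<..} t * t powr s / (t\<^sup>2 + (2 * pi * real (Suc k))\<^sup>2)) \<partial>lborel) =
         ennreal (K * (1 / real (Suc k) powr (1 - s)))"
        using cos by (simp add: K_def field_simps)
    qed
    also have "\<dots> = ennreal (K * Z)"
      using zeta_reg_sums_real[of "1 - s"] s K unfolding Z_def
      by (intro suminf_ennreal_eq sums_mult) auto
    finally show "(\<integral>\<^sup>+t. ennreal (indicator {0<..} t * bose_reg t * t powr (s - 1)) \<partial>lborel) = ennreal (K * Z)" .
  qed (use K Z in auto)
  from has_bochner_integral_eq[OF 1 this]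
  have 2: "A + (1 / (s - 1) - 1 / (2 * s)) = K * Z" .
  have "Gamma (of_real s + 1) * zeta_reg (of_real s) = of_real s * (of_real s - 1) * bose_transform (of_real s) + (of_real s + 1) / 2"
    using s by (intro Gamma_times_zeta_reg) auto
  hence "complex_of_real (Gamma (s + 1) * Re (zeta_reg (of_real s))) = of_real (s * (s - 1) * A + (s + 1) / 2)"
    using s zeta_reg_of_real[of s] by (simp add: bose_transform_of_real A_def Gamma_complex_of_real[symmetric])
  hence "Gamma (s + 1) * Re (zeta_reg (of_real s)) = s * (s - 1) * A + (s + 1) / 2"
    by (simp only: of_real_eq_iff)
  also have "\<dots> = s * (s - 1) * (A + (1 / (s - 1) - 1 / (2 * s)))"
    using s by (simp add: field_simps)
  also have "\<dots> = s * (s - 1) * (K * Z)" unfolding 2 ..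
  also have "\<dots> = (1 - s) * K * Re (zeta_reg (of_real (1 - s)))"
    using s by (simp add: Z_def field_simps)
  finally show ?thesis using cos by (simp add: K_def)
qed

section \<open>The xi function and a zero of the zeta function\<close>

text \<open>Riemann's xi, with the factor s/2 absorbed into Gamma and s - 1 into
  \<open>zeta_reg\<close>, so that no removable singularities remain in Re s > -1.\<close>

definition xi_right :: "complex \<Rightarrow> complex" where
  "xi_right s = of_real pi powr (- s / 2) * Gamma (s / 2 + 1) * zeta_reg s"

definition xi :: "complex \<Rightarrow> complex" where
  "xi s = (if Re s > -1 then xi_right s else xi_right (1 - s))"

lemma Re_pos_not_nonpos_Int: "Re z > 0 \<Longrightarrow> z \<notin> \<int>\<^sub>\<le>\<^sub>0"
  by (auto elim!: nonpos_Ints_cases)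

lemma half_plus_1_not_nonpos_Int:
  assumes "Re s > -1"
  shows "s / 2 + 1 \<notin> \<int>\<^sub>\<le>\<^sub>0"
  using assms by (intro Re_pos_not_nonpos_Int) auto

lemma holomorphic_xi_right: "xi_right holomorphic_on {s. Re s > -1}"
  unfolding xi_right_def using half_plus_1_not_nonpos_Int
  by (auto intro!: holomorphic_intros holomorphic_zeta_reg)

lemma xi_right_of_real:
  assumes "x > -1"
  shows "xi_right (of_real x) = of_real (pi powr (- x / 2) * Gamma (x / 2 + 1) * Re (zeta_reg (of_real x)))"
proof -
  have "complex_of_real pi powr (- of_real x / 2) = of_real (pi powr (- x / 2))"
    using powr_of_real[of pi "- x / 2"] by simp
  moreover have "Gamma (complex_of_real x / 2 + 1) = of_real (Gamma (x / 2 + 1))"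
    using Gamma_complex_of_real[of "x / 2 + 1"] by simp
  ultimately show ?thesis
    unfolding xi_right_def using zeta_reg_of_real[OF assms] by simp
qed

lemma Gamma_reflection_real_cos:
  "Gamma ((1 + s) / 2) * Gamma ((1 - s) / 2) = pi / cos (pi * s / 2)" for s :: real
proof -
  have "1 - complex_of_real ((1 + s) / 2) = of_real ((1 - s) / 2)" by (simp add: field_simps)
  hence "complex_of_real (Gamma ((1 + s) / 2) * Gamma ((1 - s) / 2)) = of_real (pi / sin (pi * ((1 + s) / 2)))"
    using Gamma_reflection_complex[of "of_real ((1 + s) / 2)"]
    by (simp only: Gamma_complex_of_real of_real_mult [symmetric] sin_of_real of_real_divide [symmetric])
  hence "Gamma ((1 + s) / 2) * Gamma ((1 - s) / 2) = pi / sin (pi * ((1 + s) / 2))"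
    by (simp only: of_real_eq_iff)
  also have "sin (pi * ((1 + s) / 2)) = cos (pi * s / 2)"
    by (simp add: sin_cos_eq field_simps)
  finally show ?thesis .
qed

lemma Gamma_duplication_real:
  assumes "s > (-1::real)"
  shows "Gamma ((1 + s) / 2) * Gamma (s / 2 + 1) = 2 powr (-s) * sqrt pi * Gamma (s + 1)"
proof -
  have "complex_of_real ((1 + s) / 2) \<notin> \<int>\<^sub>\<le>\<^sub>0" "complex_of_real ((1 + s) / 2) + 1 / 2 \<notin> \<int>\<^sub>\<le>\<^sub>0"
    using assms by (auto intro!: Re_pos_not_nonpos_Int simp: field_simps)
  from Gamma_legendre_duplication[OF this]
  have "Gamma (complex_of_real ((1 + s) / 2)) * Gamma (complex_of_real ((1 + s) / 2) + 1 / 2) =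
      exp ((1 - 2 * complex_of_real ((1 + s) / 2)) * of_real (ln 2)) * of_real (sqrt pi) * Gamma (2 * complex_of_real ((1 + s) / 2))" .
  also have "complex_of_real ((1 + s) / 2) + 1 / 2 = of_real (s / 2 + 1)" by (simp add: field_simps)
  also have "2 * complex_of_real ((1 + s) / 2) = of_real (s + 1)" by (simp add: field_simps)
  also have "(1 - complex_of_real (s + 1)) * of_real (ln 2) = of_real (- s * ln 2)" by simp
  also have "exp (complex_of_real (- s * ln 2)) = of_real (2 powr (-s))"
    by (simp only: powr_def exp_of_real) simp
  finally show ?thesis
    by (simp only: Gamma_complex_of_real of_real_mult [symmetric] of_real_eq_iff)
qed

text \<open>The asymmetric functional equation becomes symmetric once the cosine is expressed by the
  reflection formula and Gamma(s + 1) by the duplication formula.\<close>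

lemma xi_right_reflect_real:
  assumes s: "-1 < s" "s < 0"
  shows "xi_right (of_real (1 - s)) = xi_right (of_real s)"
proof -
  define g1 g2 g3 g4 where "g1 = Gamma ((1 + s) / 2)" and "g2 = Gamma ((1 - s) / 2)"
    and "g3 = Gamma (s / 2 + 1)" and "g4 = Gamma (s + 1)"
  define c where "c = cos (pi * s / 2)"
  define a P q where "a = pi powr (s / 2)" and "P = 2 powr s" and "q = sqrt pi"
  define e e' where "e = Re (zeta_reg (of_real s))" and "e' = Re (zeta_reg (of_real (1 - s)))"
  have "g1 > 0" "g2 > 0" unfolding g1_def g2_def using s by (auto intro!: Gamma_real_pos)
  have pos: "a > 0" "P > 0" "q > 0" by (auto simp: a_def P_def q_def)
  have "c > 0" unfolding c_def
  proof (rule cos_gt_zero_pi)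
    have "pi * (-1) < pi * s" "pi * s < pi * 1" using s by (intro mult_strict_left_mono; simp)+
    thus "- (pi / 2) < pi * s / 2" "pi * s / 2 < pi / 2" by auto
  qed
  have qq: "q * q = pi" by (simp add: q_def)
  have R: "g1 * g2 * c = q * q"
    using Gamma_reflection_real_cos[of s] \<open>c > 0\<close> qq by (simp add: g1_def g2_def c_def field_simps)
  have "g1 * g3 = 2 powr (-s) * q * g4"
    using Gamma_duplication_real[of s] s by (simp add: g1_def g3_def g4_def q_def)
  hence L: "g1 * g3 * P = q * g4" using pos by (simp add: P_def powr_minus field_simps)
  have "(2 * pi) powr (s - 1) = P * (a * a) / (2 * pi)"
    by (simp add: powr_diff powr_mult P_def a_def flip: powr_add)
  hence W: "(2 * pi) powr (s - 1) * (2 * pi) = P * (a * a)" by simp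
  have "2 * (g4 * e * c) = (1 - s) * ((2 * pi) powr (s - 1) * (2 * pi)) * e'"
    using zeta_reg_functional_equation_real[OF s] by (simp add: g4_def e_def c_def e'_def mult_ac)
  hence F: "2 * (g4 * e * c) = (1 - s) * P * (a * a) * e'"
    unfolding W by (simp only: mult_ac)
  \<comment> \<open>The multiplier g1 P c is what lets the reflection formula \<open>R\<close>, the
    functional equation \<open>F\<close> and the duplication formula \<open>L\<close> be applied in
    turn; it is positive and cancels at the end.\<close>
  have key: "2 * q * g3 * e = a * a * (1 - s) * g2 * e'"
  proof -
    have "(g1 * P * c) * (a * a * (1 - s) * g2 * e') = g1 * g2 * c * ((1 - s) * P * (a * a) * e')"
      by (simp only: mult_ac)
    also have "\<dots> = q * q * (2 * (g4 * e * c))" unfolding R F ..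
    also have "\<dots> = 2 * q * e * c * (q * g4)" by (simp only: mult_ac)
    also have "\<dots> = 2 * q * e * c * (g1 * g3 * P)" unfolding L ..
    also have "\<dots> = (g1 * P * c) * (2 * q * g3 * e)" by (simp only: mult_ac)
    finally show ?thesis using \<open>g1 > 0\<close> \<open>P > 0\<close> \<open>c > 0\<close> by simp
  qed
  have "xi_right (of_real s) = of_real (1 / a * g3 * e)"
    using s by (subst xi_right_of_real) (simp_all add: a_def powr_minus_divide g3_def e_def)
  also have "1 / a * g3 * e = a / q * ((1 - s) / 2 * g2) * e'"
    using key pos by (simp add: field_simps)
  also have "(1 - s) / 2 * g2 = Gamma ((1 - s) / 2 + 1)"
    unfolding g2_def by (rule Gamma_plus1 [symmetric]) (use s in \<open>auto elim!: nonpos_Ints_cases\<close>)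
  also have "a / q = pi powr (- (1 - s) / 2)"
  proof -
    have "pi powr (- (1 - s) / 2) = pi powr (s / 2 - 1 / 2)" by (simp add: field_simps)
    thus ?thesis by (simp add: powr_diff a_def q_def powr_half_sqrt)
  qed
  also have "of_real (pi powr (- (1 - s) / 2) * Gamma ((1 - s) / 2 + 1) * e') = xi_right (of_real (1 - s))"
    using s by (subst xi_right_of_real) (simp_all add: e'_def)
  finally show ?thesis ..
qed

lemma xi_right_reflect:
  assumes "-1 < Re s" "Re s < 2"
  shows "xi_right (1 - s) = xi_right s"
proof (rule holomorphic_eq_if_eq_on_reals[where f = "\<lambda>s. xi_right (1 - s)" and g = xi_right and z = s
      and S = "{s. -1 < Re s} \<inter> {s. Re s < 2}" and a = "-1" and b = 0])
  have "(xi_right \<circ> (\<lambda>s. 1 - s)) holomorphic_on {s. -1 < Re s} \<inter> {s. Re s < 2}"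
    by (rule holomorphic_on_compose_gen[OF _ holomorphic_xi_right]) (auto intro!: holomorphic_intros)
  thus "(\<lambda>s. xi_right (1 - s)) holomorphic_on {s. -1 < Re s} \<inter> {s. Re s < 2}"
    by (simp add: o_def)
  show "xi_right holomorphic_on {s. -1 < Re s} \<inter> {s. Re s < 2}"
    by (rule holomorphic_on_subset[OF holomorphic_xi_right]) auto
  show "open ({s. -1 < Re s} \<inter> {s. Re s < 2})"
    by (intro open_Int open_halfspace_Re_gt open_halfspace_Re_lt)
  show "connected ({s. -1 < Re s} \<inter> {s. Re s < 2})"
    by (intro convex_connected convex_Int convex_halfspace_Re_gt convex_halfspace_Re_lt)
  show "xi_right (1 - of_real x) = xi_right (of_real x)" if "-1 < x" "x < 0" for x
    using xi_right_reflect_real[OF that] by simp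
qed (use assms in auto)

lemma xi_reflect: "xi (1 - s) = xi s"
  using xi_right_reflect[of s] by (auto simp: xi_def)

lemma holomorphic_xi: "xi holomorphic_on UNIV"
proof -
  have "xi holomorphic_on {s. Re s > -1}"
    by (rule holomorphic_transform[OF holomorphic_xi_right]) (auto simp: xi_def)
  moreover have "xi holomorphic_on {s. Re s < 2}"
  proof -
    have "(xi_right \<circ> (\<lambda>s. 1 - s)) holomorphic_on {s. Re s < 2}"
      by (rule holomorphic_on_compose_gen[OF _ holomorphic_xi_right]) (auto intro!: holomorphic_intros)
    thus ?thesis
      by (rule holomorphic_transform) (auto simp: xi_def xi_right_reflect)
  qed
  ultimately have "xi holomorphic_on ({s. Re s > -1} \<union> {s. Re s < 2})"
    by (intro holomorphic_on_Un open_halfspace_Re_gt open_halfspace_Re_lt)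
  also have "{s. Re s > -1} \<union> {s. Re s < 2} = UNIV" by auto
  finally show ?thesis .
qed

lemma xi_1: "xi 1 = 1 / 2"
proof -
  have "xi 1 = of_real (pi powr (- 1 / 2) * Gamma (1 / 2 + 1) * Re (zeta_reg (of_real 1)))"
    using xi_right_of_real[of 1] by (simp add: xi_def)
  also have "Gamma (1 / 2 + 1 :: real) = 1 / 2 * sqrt pi"
    by (subst Gamma_plus1) (auto elim!: nonpos_Ints_cases simp: Gamma_one_half_real)
  also have "pi powr (- 1 / 2) = 1 / sqrt pi"
    using powr_minus_divide[of pi "1 / 2"] by (simp add: powr_half_sqrt)
  finally show ?thesis by simp
qed

lemma xi_2: "xi 2 = of_real (pi / 6)"
proof -
  have "xi 2 = of_real (pi powr (- 2 / 2) * Gamma (2 / 2 + 1) * Re (zeta_reg (of_real 2)))"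
    using xi_right_of_real[of 2] by (simp add: xi_def)
  moreover have "Gamma (2 :: real) = 1" using Gamma_fact[of 1, where ?'a = real] by simp
  ultimately show ?thesis
    by (simp add: zeta_reg_2 powr_minus_divide power2_eq_square)
qed

text \<open>The description of \<open>zeta\<close> asks for a function on the entire punctured
  plane, beyond the half-plane of \<open>zeta_reg\<close>. It is recovered from the entire function
  \<open>xi\<close> by undoing the Gamma factor with the entire function \<open>rGamma\<close>;
  uniqueness is analytic continuation from Re s > 1.\<close>

lemma zeta_eq:
  assumes "Re s > -1" "s \<noteq> 1"
  shows "zeta s = zeta_reg s / (s - 1)"
proof -
  define f where "f = (\<lambda>s. if s = 1 then 0 else xi s * (of_real pi powr (s / 2) * rGamma (s / 2 + 1)) / (s - 1))"
  have f_eq: "f s = zeta_reg s / (s - 1)" if "Re s > -1" "s \<noteq> 1" for s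
  proof -
    have "of_real pi powr (- s / 2) * of_real pi powr (s / 2) = (1::complex)"
      by (simp flip: powr_add)
    moreover have "Gamma (s / 2 + 1) * rGamma (s / 2 + 1) = 1"
      using half_plus_1_not_nonpos_Int[OF that(1)] by (simp add: rGamma_inverse_Gamma Gamma_eq_zero_iff)
    moreover have "xi s * (of_real pi powr (s / 2) * rGamma (s / 2 + 1)) = 
       (of_real pi powr (- s / 2) * of_real pi powr (s / 2)) * (Gamma (s / 2 + 1) * rGamma (s / 2 + 1)) * zeta_reg s"
      using that by (simp add: xi_def xi_right_def mult_ac)
    ultimately show ?thesis using that by (simp add: f_def)
  qed
  define P where "P = (\<lambda>f. f holomorphic_on (- {1}) \<and>
                  (\<forall>s. Re s > 1 \<longrightarrow> (\<lambda>n. 1 / of_nat (Suc n) powr s) sums f s) \<and> f (1::complex) = (0::complex))"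
  have "(\<lambda>s. xi s * (of_real pi powr (s / 2) * rGamma (s / 2 + 1)) / (s - 1)) holomorphic_on (- {1})"
    by (intro holomorphic_intros holomorphic_on_subset[OF holomorphic_xi]) auto
  hence "f holomorphic_on (- {1})"
    by (rule holomorphic_transform) (auto simp: f_def)
  hence Pf: "P f"
    using zeta_reg_sums f_eq by (auto simp: P_def f_def split: if_splits)
  have "zeta = f"
    unfolding zeta_def P_def[symmetric]
  proof (rule the_equality[where P = P, OF Pf])
    fix g assume g: "P g"
    show "g = f"
    proof
      fix z
      show "g z = f z"
      proof (cases "z = 1")
        case False
        show ?thesis
        proof (rule analytic_continuation_open[where s = "{s. Re s > 1}" and s' = "- {1}" and f = g and g = f and z = z])
          show "{s. Re s > 1} \<noteq> {}" by (auto intro!: exI[of _ "2 :: complex"])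
          show "connected (- {1 :: complex})" by (intro connected_punctured_universe) simp
          show "g z = f z" if "z \<in> {s. Re s > 1}" for z
            using that g Pf unfolding P_def by (auto intro: sums_unique2)
        qed (use False g Pf in \<open>auto simp: P_def open_halfspace_Re_gt\<close>)
      qed (use g Pf in \<open>auto simp: P_def\<close>)
    qed
  qed
  thus ?thesis using f_eq[OF assms] by simp
qed

section \<open>Growth of xi and existence of a zero\<close>

lemma norm_Gamma_le:
  assumes "Re z > 0"
  shows "norm (Gamma z) \<le> Gamma (Re z)"
proof -
  have 1: "((\<lambda>t. of_real t powr (z - 1) / of_real (exp t)) has_integral Gamma z) {0..}"
    by (rule Gamma_integral_complex[OF assms])
  have 2: "((\<lambda>t. t powr (Re z - 1) / exp t) has_integral Gamma (Re z)) {0..}"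
    by (rule Gamma_integral_real[OF assms])
  have "norm (integral {0..} (\<lambda>t. of_real t powr (z - 1) / of_real (exp t)))
    \<le> integral {0..} (\<lambda>t. t powr (Re z - 1) / exp t)"
    by (rule integral_norm_bound_integral)
       (use 1 2 in \<open>auto simp: norm_divide norm_powr_real_powr has_integral_iff\<close>)
  thus ?thesis using 1 2 by (simp add: has_integral_iff)
qed

text \<open>A crude substitute for Stirling: round x up to an integer n \<le> x + 1 and use n! \<le>
  n^n.\<close>

lemma Gamma_real_le_exp:
  assumes "x \<ge> (1::real)"
  shows "Gamma x \<le> exp ((x + 1) * ln (x + 1))"
proof -
  define n where "n = nat \<lceil>x\<rceil>"
  have n: "real n \<ge> x" "real n \<le> x + 1" "n > 0" using assms unfolding n_def by linarith+
  have G: "Gamma x > 0" using assms by (intro Gamma_real_pos) auto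
  have "Gamma x \<le> x * Gamma x" using assms G by simp
  also have "\<dots> = Gamma (x + 1)" using assms by (intro Gamma_plus1 [symmetric]) (auto elim!: nonpos_Ints_cases)
  also have "\<dots> \<le> Gamma (real n + 1)"
  proof (cases "x = real n")
    case False
    hence "Gamma (x + 1) < Gamma (real n + 1)" using n assms by (intro Gamma_real_strict_mono) auto
    thus ?thesis by simp
  qed simp
  also have "\<dots> = fact n" using Gamma_fact[of n, where ?'a = real] by (simp add: add.commute)
  also have "\<dots> \<le> real n ^ n" using fact_le_power[of n, where ?'a = real] by simp
  also have "\<dots> = exp (real n * ln (real n))" using n by (simp add: exp_of_nat_mult)
  also have "\<dots> \<le> exp ((x + 1) * ln (x + 1))"
    using n assms by (intro exp_le_cancel_iff[THEN iffD2] mult_mono) auto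
  finally show ?thesis .
qed

lemma ln_le_two_sqrt:
  assumes "y \<ge> (1::real)"
  shows "ln y \<le> 2 * sqrt y"
proof -
  have "ln (sqrt y) \<le> sqrt y - 1" using assms by (intro ln_le_minus_one) auto
  thus ?thesis using assms by (simp add: ln_sqrt)
qed

text \<open>Any exponent below 2 would serve. The 3/2 arises from y ln y by ln y \<le> 2 sqrt y, and
  8 from (y + 3) ln y \<le> 4 y * 2 sqrt y. The left half-plane is reached by reflection, which can
  increase the norm by 1 and so turns 3 into 4.\<close>

lemma xi_growth:
  obtains C where "C \<ge> 1" "\<And>s. norm (xi s) \<le> C * exp (8 * (norm s + 4) powr (3 / 2))"
proof -
  obtain C where C: "C > 0" "\<And>s. Re s \<ge> 0 \<Longrightarrow> norm (zeta_reg s) \<le> C * (1 + norm s) ^ 3"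
    using zeta_reg_bound by blast
  have right: "norm (xi s) \<le> C * exp (8 * (norm s + 3) powr (3 / 2))" if s: "Re s \<ge> 1 / 2" for s
  proof -
    define y where "y = norm s + 3"
    define x where "x = Re s / 2 + 1"
    have y: "y \<ge> 3" by (simp add: y_def)
    have x: "x \<ge> 1" "x + 1 \<le> y"
      using s complex_Re_le_cmod[of s] by (auto simp: x_def y_def)
    have "norm (of_real pi powr (- s / 2) :: complex) = pi powr (- Re s / 2)"
      by (subst norm_powr_real_powr) auto
    also have "\<dots> \<le> pi powr 0" using s pi_ge_two by (intro powr_mono) auto
    finally have 1: "norm (of_real pi powr (- s / 2) :: complex) \<le> 1" by simp
    have "norm (Gamma (s / 2 + 1)) \<le> Gamma x"
      using norm_Gamma_le[of "s / 2 + 1"] s by (simp add: x_def)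
    also have "\<dots> \<le> exp ((x + 1) * ln (x + 1))" by (rule Gamma_real_le_exp[OF x(1)])
    also have "\<dots> \<le> exp (y * ln y)" using x by (intro exp_le_cancel_iff[THEN iffD2] mult_mono) auto
    finally have 2: "norm (Gamma (s / 2 + 1)) \<le> exp (y * ln y)" .
    have "(1 + norm s) ^ 3 \<le> y ^ 3" by (intro power_mono) (auto simp: y_def)
    also have "y ^ 3 = exp (3 * ln y)" using y exp_of_nat_mult[of 3 "ln y"] by simp
    finally have "C * (1 + norm s) ^ 3 \<le> C * exp (3 * ln y)" using C(1) by simp
    hence 3: "norm (zeta_reg s) \<le> C * exp (3 * ln y)" using C(2)[of s] s by auto
    have "norm (xi s) = norm (of_real pi powr (- s / 2) :: complex) * norm (Gamma (s / 2 + 1)) * norm (zeta_reg s)"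
      using s by (simp add: xi_def xi_right_def norm_mult)
    also have "\<dots> \<le> 1 * exp (y * ln y) * (C * exp (3 * ln y))"
      using 1 2 3 by (intro mult_mono) auto
    also have "\<dots> = C * exp ((y + 3) * ln y)" by (simp add: exp_add ring_distribs)
    also have "\<dots> \<le> C * exp (8 * y powr (3 / 2))"
    proof -
      have "(y + 3) * ln y \<le> (4 * y) * (2 * sqrt y)"
        using y ln_le_two_sqrt[of y] by (intro mult_mono) auto
      also have "\<dots> = 8 * (y * y powr (1 / 2))" using y by (simp add: powr_half_sqrt)
      also have "y * y powr (1 / 2) = y powr (3 / 2)" using y powr_add[of y 1 "1 / 2"] by simp
      finally show ?thesis using C(1) by simp
    qed
    finally show ?thesis by (simp add: y_def)
  qed
  have all: "norm (xi s) \<le> C * exp (8 * (norm s + 4) powr (3 / 2))" for s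
  proof -
    have "\<exists>w. Re w \<ge> 1 / 2 \<and> norm w \<le> norm s + 1 \<and> xi w = xi s"
    proof (cases "Re s \<ge> 1 / 2")
      case False
      thus ?thesis using xi_reflect[of s] norm_triangle_ineq4[of 1 s] by (intro exI[of _ "1 - s"]) auto
    qed (auto intro: exI[of _ s])
    then obtain w where w: "Re w \<ge> 1 / 2" "norm w \<le> norm s + 1" "xi w = xi s" by blast
    have "norm (xi s) \<le> C * exp (8 * (norm w + 3) powr (3 / 2))" using right[OF w(1)] w(3) by simp
    also have "\<dots> \<le> C * exp (8 * (norm s + 4) powr (3 / 2))"
      using C(1) w(2) by (intro mult_left_mono exp_le_cancel_iff[THEN iffD2] powr_mono2) auto
    finally show ?thesis .
  qed
  show ?thesis
  proof (rule that[of "max C 1"])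
    fix s :: complex
    have "C * exp (8 * (norm s + 4) powr (3 / 2)) \<le> max C 1 * exp (8 * (norm s + 4) powr (3 / 2))"
      by (intro mult_right_mono) auto
    thus "norm (xi s) \<le> max C 1 * exp (8 * (norm s + 4) powr (3 / 2))" using all[of s] by linarith
  qed auto
qed

text \<open>The map u / (2 A - u) sends the half-plane Re u < A into the unit disc and fixes 0.
  Schwarz's lemma at radius 1/2 then bounds |g| by half of |2 A - g|.\<close>

lemma borel_caratheodory:
  assumes g: "g holomorphic_on ball 0 R" "g 0 = 0" and A: "\<And>z. norm z < R \<Longrightarrow> Re (g z) < A"
    and R: "R > 0" and z: "norm z \<le> R / 2"
  shows "norm (g z) \<le> 2 * A"
proof -
  have A0: "A > 0" using A[of 0] g R by simp
  define f where "f = (\<lambda>w. g (of_real R * w) / (2 * of_real A - g (of_real R * w)))"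
  have Rw: "norm (of_real R * w) < R" if "norm w < 1" for w :: complex
    using that R by (simp add: norm_mult)
  have ne: "2 * of_real A - g (of_real R * w) \<noteq> 0" if "norm w < 1" for w
    using A[OF Rw[OF that]] A0 by (auto simp: complex_eq_iff)
  have "(g \<circ> (\<lambda>w. of_real R * w)) holomorphic_on ball 0 1"
    by (rule holomorphic_on_compose_gen[OF _ g(1)]) (use Rw in \<open>auto intro!: holomorphic_intros\<close>)
  hence "f holomorphic_on ball 0 1"
    unfolding f_def o_def using ne by (intro holomorphic_intros) auto
  moreover have "f 0 = 0" using g by (simp add: f_def)
  moreover have "norm (f w) < 1" if "norm w < 1" for w
  proof -
    define u where "u = g (of_real R * w)"
    have "Re u < A" unfolding u_def by (rule A[OF Rw[OF that]])
    hence "A * Re u < A * A" using A0 by (intro mult_strict_left_mono)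
    hence "(Re u)\<^sup>2 + (Im u)\<^sup>2 < (2 * A - Re u)\<^sup>2 + (Im u)\<^sup>2"
      by (simp add: power2_eq_square algebra_simps)
    hence "norm u < norm (2 * of_real A - u)"
      by (simp add: norm_complex_def)
    moreover have "2 * of_real A - u \<noteq> 0" unfolding u_def by (rule ne[OF that])
    ultimately show ?thesis by (simp add: f_def u_def[symmetric] norm_divide)
  qed
  moreover define w where "w = z / of_real R"
  have w: "norm w \<le> 1 / 2" "of_real R * w = z"
    using z R by (auto simp: w_def norm_divide field_simps)
  ultimately have "norm (f w) \<le> norm w" by (intro Schwarz_Lemma(1)) auto
  also have "\<dots> \<le> 1 / 2" by (rule w(1))
  finally have "norm (g z) \<le> 1 / 2 * norm (2 * of_real A - g z)"
    using ne[of w] w by (simp add: f_def norm_divide divide_simps)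
  also have "norm (2 * of_real A - g z) \<le> 2 * A + norm (g z)"
    using norm_triangle_ineq4[of "2 * of_real A" "g z"] A0 by (simp add: norm_mult)
  finally show ?thesis by simp
qed

theorem zeta_reg_has_zero:
  obtains \<rho> where "Re \<rho> \<ge> 1 / 2" "zeta_reg \<rho> = 0"
proof (rule ccontr)
  assume "\<not> thesis"
  with that have nz: "zeta_reg s \<noteq> 0" if "Re s \<ge> 1 / 2" for s using \<open>Re s \<ge> 1 / 2\<close> by blast
  have right: "xi s \<noteq> 0" if "Re s \<ge> 1 / 2" for s
    using that nz[OF that] half_plus_1_not_nonpos_Int[of s] by (simp add: xi_def xi_right_def Gamma_eq_zero_iff)
  have xi_nz: "xi s \<noteq> 0" for s
    using right[of s] right[of "1 - s"] xi_reflect[of s] by (cases "Re s \<ge> 1 / 2") auto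
  obtain g where g: "g holomorphic_on UNIV" "\<And>s. exp (g s) = xi s"
  proof (rule holomorphic_logarithm_exists[OF convex_UNIV open_UNIV holomorphic_xi xi_nz UNIV_I])
    fix g assume "g holomorphic_on UNIV" "\<And>x. x \<in> UNIV \<Longrightarrow> exp (g x) = xi x"
    thus thesis by (intro that) auto
  qed
  obtain C where C: "C \<ge> 1" "\<And>s. norm (xi s) \<le> C * exp (8 * (norm s + 4) powr (3 / 2))"
    using xi_growth by blast
  have Reg: "Re (g s) \<le> ln C + 8 * (norm s + 4) powr (3 / 2)" for s
  proof -
    have "exp (Re (g s)) = norm (xi s)" by (simp flip: g(2))
    also have "\<dots> \<le> C * exp (8 * (norm s + 4) powr (3 / 2))" by (rule C(2))
    also have "\<dots> = exp (ln C + 8 * (norm s + 4) powr (3 / 2))" using C(1) by (simp add: exp_add)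
    finally show ?thesis by simp
  qed
  \<comment> \<open>The norm of g(0) pays for normalising g to vanish at 0, and the 1 makes the
    bound strict.\<close>
  define A where "A = (\<lambda>R. ln C + norm (g 0) + 1 + 8 * (R + 4) powr (3 / 2))"
  have bound: "norm (g z - g 0) \<le> 2 * A (2 * r)" if "norm z = r" "r > 0" for z r
  proof (rule borel_caratheodory[where g = "\<lambda>z. g z - g 0" and R = "2 * r"])
    show "(\<lambda>z. g z - g 0) holomorphic_on ball 0 (2 * r)"
      by (intro holomorphic_intros holomorphic_on_subset[OF g(1)]) auto
    fix z :: complex assume z: "norm z < 2 * r"
    have "(norm z + 4) powr (3 / 2) \<le> (2 * r + 4) powr (3 / 2)"
      using z by (intro powr_mono2) auto
    moreover have "- Re (g 0) \<le> norm (g 0)" using abs_Re_le_cmod[of "g 0"] by linarith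
    ultimately show "Re (g z - g 0) < A (2 * r)"
      using Reg[of z] by (simp add: A_def)
  qed (use that in auto)
  \<comment> \<open>Cauchy's inequality at radius r compares A(2 r), of size r^(3/2), with r^n \<ge>
    r^2; letting r tend to infinity kills the coefficient, so g is linear.\<close>
  have deriv0: "(deriv ^^ n) g 0 = 0" if n: "n \<ge> 2" for n
  proof -
    have ev: "norm ((deriv ^^ n) g 0) \<le> fact n * (2 * A (2 * r)) / r ^ 2" if r: "r \<ge> 1" for r
    proof -
      have A0: "A (2 * r) \<ge> 0" using C(1) by (simp add: A_def)
      have "norm ((deriv ^^ n) (\<lambda>z. g z - g 0) 0) \<le> fact n * (2 * A (2 * r)) / r ^ n"
      proof (rule Cauchy_inequality)
        show "(\<lambda>z. g z - g 0) holomorphic_on ball 0 r"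
          by (intro holomorphic_intros holomorphic_on_subset[OF g(1)]) auto
        show "continuous_on (cball 0 r) (\<lambda>z. g z - g 0)"
          by (intro continuous_intros holomorphic_on_imp_continuous_on holomorphic_on_subset[OF g(1)]) auto
        show "norm (g x - g 0) \<le> 2 * A (2 * r)" if "norm (0 - x) = r" for x
          using bound[of x r] that r by simp
      qed (use r in auto)
      also have "(deriv ^^ n) (\<lambda>z. g z - g 0) 0 = (deriv ^^ n) g 0"
        using higher_deriv_diff[OF g(1) holomorphic_on_const open_UNIV, of 0 n "g 0"] n by simp
      also have "fact n * (2 * A (2 * r)) / r ^ n \<le> fact n * (2 * A (2 * r)) / r ^ 2"
        using r A0 n by (intro divide_left_mono power_increasing mult_nonneg_nonneg) auto
      finally show ?thesis .
    qed
    have "((\<lambda>r. fact n * (2 * A (2 * r)) / r ^ 2) \<longlongrightarrow> 0) at_top"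
      unfolding A_def by real_asymp
    hence "norm ((deriv ^^ n) g 0) \<le> 0"
      by (rule tendsto_lowerbound) (auto intro!: eventually_mono[OF eventually_ge_at_top[of 1]] ev)
    thus ?thesis by simp
  qed
  have g_lin: "g s = g 0 + deriv g 0 * s" for s
  proof -
    have "(\<lambda>n. (deriv ^^ n) g 0 / fact n * (s - 0) ^ n) sums g s"
      by (rule holomorphic_power_series[of _ _ "norm s + 1"]) (auto intro!: holomorphic_on_subset[OF g(1)])
    moreover have "(\<lambda>n. (deriv ^^ n) g 0 / fact n * (s - 0) ^ n) sums (\<Sum>n<2. (deriv ^^ n) g 0 / fact n * (s - 0) ^ n)"
      by (rule sums_finite) (auto simp: deriv0)
    ultimately have "g s = (\<Sum>n<2. (deriv ^^ n) g 0 / fact n * (s - 0) ^ n)"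
      by (rule sums_unique2)
    thus ?thesis by (simp add: numeral_2_eq_2)
  qed
  define b where "b = deriv g 0"
  have xi_eq: "xi s = exp (g 0) * exp (b * s)" for s
    using g(2)[of s] g_lin[of s] by (simp add: b_def exp_add)
  have "exp b = 1" using xi_reflect[of 0] xi_eq[of 0] xi_eq[of 1] by simp
  hence "xi 2 = xi 1" using exp_add[of b b] xi_eq[of 2] xi_eq[of 1] by (simp add: mult_2_right)
  hence "complex_of_real (pi / 6) = of_real (1 / 2)" by (simp add: xi_1 xi_2)
  hence "pi = 3" by (simp only: of_real_eq_iff)
  with pi_gt3 show False by simp
qed

section \<open>The Mellin transform of the Mertens function\<close>

lemma moebius_mu_prime_mult:
  assumes p: "prime p" and d: "\<not> p dvd d" "squarefree d"
  shows "squarefree (p * d) \<and> moebius_mu (p * d) = - moebius_mu d"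
proof -
  have d0: "d \<noteq> 0" using d(1) by (metis dvd_0_right)
  have "coprime p d" using p d by (simp add: prime_imp_coprime)
  hence sq: "squarefree (p * d)" using squarefree_mult_coprime squarefree_prime p d by blast
  have "prime_factors (p * d) = insert p (prime_factors d)"
    using p d0 by (auto simp: prime_factors_dvd prime_dvd_mult_iff prime_gt_0_nat dest: primes_dvd_imp_eq)
  moreover have "p \<notin> prime_factors d" using d by (auto simp: prime_factors_dvd)
  ultimately have "card (prime_factors (p * d)) = Suc (card (prime_factors d))" by simp
  with sq d show ?thesis by (simp add: moebius_mu_def)
qed

text \<open>Fix a prime p dividing n. The squarefree divisors d not divisible by p pair off with p
  d, and the two members of a pair have opposite signs.\<close>

lemma sum_moebius_mu_divisors:
  assumes "n > 0"
  shows "(\<Sum>d | d dvd n. moebius_mu d) = (if n = 1 then 1 else 0)"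
proof (cases "n = 1")
  case False
  then obtain p where p: "prime p" "p dvd n" using prime_factor_nat by blast
  have fin: "finite {d. d dvd n}" using assms by simp
  define D0 where "D0 = {d. d dvd n \<and> squarefree d \<and> \<not> p dvd d}"
  have D0: "finite D0" "D0 \<subseteq> {d. d dvd n}" using fin by (auto simp: D0_def)
  have inj: "inj_on (\<lambda>d. p * d) D0" using p by (auto intro!: inj_onI simp: prime_gt_0_nat)
  have img: "(\<lambda>d. p * d) ` D0 \<subseteq> {d. d dvd n}"
    using p by (auto simp: D0_def intro!: divides_mult prime_imp_coprime)
  have disj: "D0 \<inter> (\<lambda>d. p * d) ` D0 = {}" by (auto simp: D0_def)
  have "(\<Sum>d | d dvd n. moebius_mu d) = (\<Sum>d \<in> D0 \<union> (\<lambda>d. p * d) ` D0. moebius_mu d)"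
  proof (rule sum.mono_neutral_right[OF fin])
    show "D0 \<union> (\<lambda>d. p * d) ` D0 \<subseteq> {d. d dvd n}" using D0 img by blast
    show "\<forall>d\<in>{d. d dvd n} - (D0 \<union> (\<lambda>d. p * d) ` D0). moebius_mu d = 0"
    proof
      fix d assume "d \<in> {d. d dvd n} - (D0 \<union> (\<lambda>d. p * d) ` D0)"
      hence d: "d dvd n" "d \<notin> D0" "d \<notin> (\<lambda>d. p * d) ` D0" by auto
      have "\<not> squarefree d"
      proof
        assume sq: "squarefree d"
        with d have "p dvd d" by (auto simp: D0_def)
        then obtain e where e: "d = p * e" by blast
        have "\<not> p dvd e"
        proof
          assume "p dvd e"
          hence "p ^ 2 dvd d" by (auto simp: e power2_eq_square)
          from squarefreeD[OF sq this] show False using p by (simp add: prime_nat_iff)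
        qed
        moreover have "squarefree e" using sq squarefree_multD(2) unfolding e by blast
        moreover have "e dvd n" using d(1) unfolding e by (rule dvd_mult_right)
        ultimately show False using d(3) by (auto simp: D0_def e)
      qed
      thus "moebius_mu d = 0" by (simp add: moebius_mu_def)
    qed
  qed
  also have "\<dots> = (\<Sum>d\<in>D0. moebius_mu d) + (\<Sum>d\<in>(\<lambda>d. p * d) ` D0. moebius_mu d)"
    using D0 disj by (intro sum.union_disjoint) auto
  also have "(\<Sum>d\<in>(\<lambda>d. p * d) ` D0. moebius_mu d) = (\<Sum>d\<in>D0. moebius_mu (p * d))"
    using inj by (subst sum.reindex) auto
  also have "\<dots> = (\<Sum>d\<in>D0. - moebius_mu d)"
    using moebius_mu_prime_mult[OF p(1)] by (intro sum.cong) (auto simp: D0_def)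
  finally show ?thesis using False by (simp add: sum_negf)
qed (simp add: moebius_mu_def)

lemma mertens_eq_0: "x < 1 \<Longrightarrow> mertens x = 0"
  by (simp add: mertens_def)

lemma abs_mertens_le:
  assumes "x \<ge> 0"
  shows "\<bar>mertens x\<bar> \<le> x"
proof -
  have "\<bar>mertens x\<bar> \<le> (\<Sum>n = 1..nat \<lfloor>x\<rfloor>. \<bar>real_of_int (moebius_mu n)\<bar>)"
    unfolding mertens_def by (rule sum_abs)
  also have "\<dots> \<le> (\<Sum>n = 1..nat \<lfloor>x\<rfloor>. 1)"
    by (intro sum_mono) (auto simp: moebius_mu_def)
  also have "\<dots> \<le> x" using assms by simp
  finally show ?thesis .
qed

lemma measurable_mertens [measurable]: "mertens \<in> borel_measurable borel"
  unfolding mertens_def by measurable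

text \<open>M(x/k) sums mu(n) over n k \<le> x. Grouping the pairs by their product m leaves the
  divisor sums of mu, of which only m = 1 contributes.\<close>

lemma sum_mertens:
  assumes "x \<ge> 1"
  shows "(\<lambda>k. mertens (x / real (Suc k))) sums 1"
proof -
  define N where "N = nat \<lfloor>x\<rfloor>"
  have N: "N \<ge> 1" "real N \<le> x" "x < real N + 1" using assms unfolding N_def by linarith+
  have "nat \<lfloor>x / real d\<rfloor> = N div d" for d
  proof -
    have "\<lfloor>x / real_of_int (int d)\<rfloor> = \<lfloor>x\<rfloor> div int d" by (rule floor_divide_real_eq_div) simp
    also have "\<lfloor>x\<rfloor> = int N" using assms by (simp add: N_def)
    finally show ?thesis by (simp flip: zdiv_int)
  qed
  hence mert: "mertens (x / real d) = (\<Sum>n = 1..N div d. real_of_int (moebius_mu n))" for d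
    by (simp add: mertens_def)
  have le: "k \<le> N" if "Suc 0 \<le> b" "b * k \<le> N" for b k
    using that by (metis One_nat_def le_trans mult_le_mono1 nat_mult_1)
  have "(\<lambda>k. mertens (x / real (Suc k))) sums (\<Sum>k<N. mertens (x / real (Suc k)))"
  proof (rule sums_finite)
    fix k assume "k \<notin> {..<N}"
    hence "real (Suc k) > x" using N by auto
    thus "mertens (x / real (Suc k)) = 0" by (intro mertens_eq_0) (auto simp: divide_simps)
  qed auto
  also have "(\<Sum>k<N. mertens (x / real (Suc k))) = (\<Sum>d=1..N. mertens (x / real d))"
    by (rule sum.reindex_bij_witness[of _ "\<lambda>d. d - 1" Suc]) auto
  also have "\<dots> = (\<Sum>(d,n)\<in>(SIGMA d:{1..N}. {1..N div d}). real_of_int (moebius_mu n))"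
    unfolding mert by (subst sum.Sigma) auto
  also have "\<dots> = (\<Sum>(k,n)\<in>(SIGMA k:{1..N}. {n. n dvd k}). real_of_int (moebius_mu n))"
    by (rule sum.reindex_bij_witness[of _ "\<lambda>(k,n). (k div n, n)" "\<lambda>(d,n). (d * n, n)"])
       (use N in \<open>auto simp: less_eq_div_iff_mult_less_eq mult.commute elim!: dvdE intro: le\<close>)
  also have "\<dots> = (\<Sum>k=1..N. \<Sum>n | n dvd k. real_of_int (moebius_mu n))"
    by (subst sum.Sigma) auto
  also have "\<dots> = (\<Sum>k=1..N. if k = 1 then 1 else 0)"
  proof (rule sum.cong)
    fix k assume "k \<in> {1..N}"
    hence "k > 0" by auto
    from sum_moebius_mu_divisors[OF this]
    show "(\<Sum>n | n dvd k. real_of_int (moebius_mu n)) = (if k = 1 then 1 else 0)"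
      by (simp flip: of_int_sum)
  qed auto
  also have "\<dots> = 1" using N by (simp add: sum.delta)
  finally show ?thesis .
qed

lemma integrable_mertens:
  assumes "s > 1"
  shows "integrable lborel (\<lambda>x. indicator {1..} x * mertens x * x powr (- s - 1))"
proof (rule Bochner_Integration.integrable_bound)
  show "integrable lborel (\<lambda>x. indicator {1..} x * x powr (-s))"
    using assms by (intro integrable.intros[OF has_bochner_integral_powr_1_inf]) auto
  show "AE x in lborel. norm (indicator {1..} x * mertens x * x powr (- s - 1)) \<le> norm (indicator {1..} x * x powr (-s))"
  proof (intro AE_I2)
    fix x :: real
    show "norm (indicator {1..} x * mertens x * x powr (- s - 1)) \<le> norm (indicator {1..} x * x powr (-s))"
    proof (cases "x \<ge> 1")
      case True
      have "\<bar>mertens x\<bar> * x powr (- s - 1) \<le> x * x powr (- s - 1)"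
        using True abs_mertens_le[of x] by (intro mult_right_mono) auto
      also have "\<dots> = x powr (-s)" using True powr_add[of x 1 "- s - 1"] by simp
      finally show ?thesis using True by (simp add: abs_mult)
    qed auto
  qed
qed measurable

text \<open>Multiply the transform by zeta(s) instead of inverting the Dirichlet series: the
  multiples k^(-s) of the transform are the transforms of M(x/k), and these functions add up to 1 on
  [1, \<infinity>), whose transform is 1/s.\<close>

lemma mertens_mellin:
  assumes s: "s > 1"
  shows "(\<integral>x. indicator {1..} x * mertens x * x powr (- s - 1) \<partial>lborel) = (s - 1) / (s * Re (zeta_reg (of_real s)))"
proof -
  define m where "m = (\<lambda>x. indicator {1..} x * mertens x * x powr (- s - 1))"
  define c where "c = (\<lambda>k. real (Suc k))"
  \<comment> \<open>The scaling is such that f k x equals x^(-s-1) M(x / (k + 1)) for x \<ge> 1,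
    while its integral is (k + 1)^(-s) times that of m.\<close>
  define f where "f = (\<lambda>k x. c k powr (- s - 1) * m (x / c k))"
  have c: "c k > 0" for k by (simp add: c_def)
  have cp: "c k * c k powr (- s - 1) = c k powr (-s)" for k
    using powr_add[of "c k" 1 "- s - 1"] c[of k] by simp
  have [measurable]: "m \<in> borel_measurable borel" unfolding m_def by measurable
  have im: "integrable lborel m" unfolding m_def by (rule integrable_mertens[OF s])
  have if': "integrable lborel (f k)" for k
  proof -
    have "integrable lborel (\<lambda>x. m (0 + (1 / c k) * x))"
      using c[of k] by (intro lborel_integrable_real_affine im) auto
    thus ?thesis unfolding f_def by simp
  qed
  have scale: "(\<integral>x. g (x / c k) * c k powr (- s - 1) \<partial>lborel) = c k powr (-s) * (\<integral>x. g x \<partial>lborel)" for g :: "real \<Rightarrow> real" and k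
  proof -
    have "(\<integral>x. g x \<partial>lborel) = \<bar>1 / c k\<bar> *\<^sub>R (\<integral>x. g (0 + (1 / c k) * x) \<partial>lborel)"
      using c[of k] by (intro lborel_integral_real_affine) auto
    hence "(\<integral>x. g (x / c k) \<partial>lborel) = c k * (\<integral>x. g x \<partial>lborel)"
      using c[of k] by (simp add: field_simps)
    thus ?thesis using cp[of k] by (simp add: mult_ac)
  qed
  have zs: "(\<lambda>k. c k powr (-s)) sums (Re (zeta_reg (of_real s)) / (s - 1))"
    using zeta_reg_sums_real[OF s] by (simp add: c_def powr_minus_divide)
  have f_val: "(\<lambda>k. f k x) sums (indicator {1..} x * x powr (- s - 1))" 
     and f_sum: "summable (\<lambda>k. norm (f k x))" for x
  proof -
    have "(\<lambda>k. f k x) sums (indicator {1..} x * x powr (- s - 1)) \<and> summable (\<lambda>k. norm (f k x))"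
    proof (cases "x \<ge> 1")
      case True
      have f_eq: "f k x = x powr (- s - 1) * mertens (x / real (Suc k))" for k
      proof (cases "x / c k \<ge> 1")
        case True
        have "c k powr (- s - 1) * (x / c k) powr (- s - 1) = x powr (- s - 1)"
          using c[of k] True \<open>x \<ge> 1\<close> by (simp add: powr_mult[symmetric])
        thus ?thesis using True by (simp add: f_def m_def c_def mult_ac)
      next
        case False
        thus ?thesis by (simp add: f_def m_def mertens_eq_0 c_def)
      qed
      have "(\<lambda>k. f k x) sums (x powr (- s - 1) * 1)"
        unfolding f_eq by (intro sums_mult sum_mertens True)
      moreover have "summable (\<lambda>k. norm (f k x))"
      proof (rule summable_finite[of "{..<nat \<lceil>x\<rceil>}"])
        fix k assume "k \<notin> {..<nat \<lceil>x\<rceil>}"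
        hence "real (Suc k) > x" by simp linarith
        hence "mertens (x / real (Suc k)) = 0" by (intro mertens_eq_0) (auto simp: divide_simps)
        thus "norm (f k x) = 0" by (simp only: f_eq) simp
      qed auto
      ultimately show ?thesis using True by simp
    next
      case False
      have "x / c k < 1" for k
      proof -
        have "x < c k" using False by (simp add: c_def)
        thus ?thesis using c[of k] by simp
      qed
      hence "f k x = 0" for k by (auto simp: f_def m_def not_le[symmetric])
      thus ?thesis using False by simp
    qed
    thus "(\<lambda>k. f k x) sums (indicator {1..} x * x powr (- s - 1))" "summable (\<lambda>k. norm (f k x))" by auto
  qed
  have "(\<lambda>k. \<integral>x. f k x \<partial>lborel) sums (\<integral>x. (\<Sum>k. f k x) \<partial>lborel)"
  proof (rule sums_integral[OF if'])
    show "AE x in lborel. summable (\<lambda>k. norm (f k x))" using f_sum by simp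
    have "(\<integral>x. norm (f k x) \<partial>lborel) = c k powr (-s) * (\<integral>x. norm (m x) \<partial>lborel)" for k
      using scale[of "\<lambda>x. norm (m x)" k] by (simp add: f_def abs_mult mult_ac)
    thus "summable (\<lambda>k. \<integral>x. norm (f k x) \<partial>lborel)"
      using sums_summable[OF zs] by (simp only: summable_mult2)
  qed
  also have "(\<lambda>k. \<integral>x. f k x \<partial>lborel) = (\<lambda>k. c k powr (-s) * (\<integral>x. m x \<partial>lborel))"
    using scale[of m] by (simp add: f_def mult_ac)
  also have "(\<lambda>x. \<Sum>k. f k x) = (\<lambda>x. indicator {1..} x * x powr (- s - 1))"
    using sums_unique[OF f_val] by simp
  also have "(\<integral>x. indicator {1..} x * x powr (- s - 1) \<partial>lborel) = - 1 / ((- s - 1) + 1)"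
    using s by (intro has_bochner_integral_integral_eq has_bochner_integral_powr_1_inf) auto
  finally have "(\<lambda>k. c k powr (-s) * (\<integral>x. m x \<partial>lborel)) sums (1 / s)" by simp
  with sums_mult2[OF zs, of "\<integral>x. m x \<partial>lborel"]
  have "Re (zeta_reg (of_real s)) / (s - 1) * (\<integral>x. m x \<partial>lborel) = 1 / s"
    by (rule sums_unique2)
  moreover have "Re (zeta_reg (of_real s)) > 0" using s by (intro zeta_reg_pos_real) auto
  ultimately show ?thesis using s unfolding m_def by (simp add: field_simps)
qed

section \<open>The weighted integral of the Mertens function and its transform\<close>

text \<open>The upper limit enters as \<open>indicator {u..} x\<close>, which makes joint
  measurability in u and x, and hence Fubini, directly available.\<close>

definition mertens_int :: "real \<Rightarrow> real \<Rightarrow> real" where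
  "mertens_int \<kappa> x = (\<integral>u. indicator {1..} u * mertens u * u powr (-\<kappa>) * indicator {u..} x \<partial>lborel)"

lemma set_integrable_mertens:
  "set_integrable lborel {1..x} (\<lambda>u. mertens u / u powr \<kappa>)"
proof (cases "x \<ge> 1")
  case True
  show ?thesis unfolding set_integrable_def
  proof (rule integrableI_bounded_set_indicator[where B = "x * max 1 (x powr (-\<kappa>))"])
    show "AE u in lborel. u \<in> {1..x} \<longrightarrow> norm (mertens u / u powr \<kappa>) \<le> x * max 1 (x powr (-\<kappa>))"
    proof (intro AE_I2 impI)
      fix u assume u: "u \<in> {1..x}"
      have "\<bar>mertens u\<bar> \<le> x" using abs_mertens_le[of u] u by auto
      moreover have "u powr (-\<kappa>) \<le> max 1 (x powr (-\<kappa>))"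
      proof (cases "\<kappa> \<ge> 0")
        case True
        hence "u powr (-\<kappa>) \<le> u powr 0" using u by (intro powr_mono) auto
        thus ?thesis using u by auto
      next
        case False
        hence "u powr (-\<kappa>) \<le> x powr (-\<kappa>)" using u by (intro powr_mono2) auto
        thus ?thesis by auto
      qed
      ultimately have "\<bar>mertens u\<bar> * u powr (-\<kappa>) \<le> x * max 1 (x powr (-\<kappa>))"
        using u by (intro mult_mono) auto
      thus "norm (mertens u / u powr \<kappa>) \<le> x * max 1 (x powr (-\<kappa>))"
        by (simp add: abs_mult powr_minus_divide)
    qed
  qed (use True in auto)
qed (simp add: set_integrable_def)

lemma mertens_int_eq: "mertens_int \<kappa> x = integral {1..x} (\<lambda>u. mertens u / u powr \<kappa>)"
proof -
  have "integral {1..x} (\<lambda>u. mertens u / u powr \<kappa>) = (LINT u:{1..x}|lborel. mertens u / u powr \<kappa>)"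
    using set_borel_integral_eq_integral(2)[OF set_integrable_mertens] by simp
  also have "\<dots> = mertens_int \<kappa> x"
    unfolding mertens_int_def set_lebesgue_integral_def
    by (intro Bochner_Integration.integral_cong) (auto simp: indicator_def powr_minus_divide)
  finally show ?thesis ..
qed

lemma measurable_mertens_int [measurable]: "mertens_int \<kappa> \<in> borel_measurable borel"
proof -
  have "(\<lambda>x. \<integral>u. indicator {1..} u * mertens u * u powr (-\<kappa>) * (if u \<le> x then 1 else 0) \<partial>lborel) \<in> borel_measurable borel"
    by measurable
  moreover have ind: "indicator {u..} x = (if u \<le> x then 1 else 0 :: real)" for u x :: real by (simp add: indicator_def)
  ultimately show ?thesis unfolding mertens_int_def ind by simp
qed

text \<open>Exchanging the integrals, the inner one over x \<ge> u is u^(\<kappa>-1-s) / (s -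
  \<kappa> + 1), and the powers of u combine to the weight of \<open>mertens_mellin\<close>. The
  exponent \<kappa> - 2 - s is normalised so that x^(3/2-\<kappa>) has the transform 1/(s - 1/2) for
  every \<kappa>.\<close>

lemma mertens_int_mellin:
  assumes s: "s > 1" and w: "s - \<kappa> + 1 > 0"
  shows "has_bochner_integral lborel (\<lambda>x. indicator {1..} x * mertens_int \<kappa> x * x powr (\<kappa> - 2 - s))
     ((s - 1) / (s * Re (zeta_reg (of_real s))) / (s - \<kappa> + 1))"
proof -
  define p where "p = \<kappa> - 2 - s"
  have p: "p < -1" using w by (simp add: p_def)
  define f where "f = (\<lambda>u x. (indicator {1..} u * mertens u * u powr (-\<kappa>)) * ((if u \<le> x then 1 else 0) * x powr p) :: real)"
  have meas: "case_prod f \<in> borel_measurable (lborel \<Otimes>\<^sub>M lborel)"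
    unfolding f_def case_prod_beta by measurable
  have ind: "(if u \<le> x then 1 else 0) = (indicator {u..} x :: real)" for u x :: real by (simp add: indicator_def)
  have inner: "has_bochner_integral lborel (\<lambda>x. (if u \<le> x then 1 else 0) * x powr p) (u powr (p + 1) / (s - \<kappa> + 1))"
    if "u \<ge> 1" for u
  proof -
    have "- (u powr (p + 1)) / (p + 1) = u powr (p + 1) / (s - \<kappa> + 1)"
      using w by (simp add: p_def divide_simps) (simp add: algebra_simps)
    thus ?thesis using has_bochner_integral_powr_inf[OF p, of u] that unfolding ind by simp
  qed
  have comb: "(indicator {1..} u * mertens u * u powr (-\<kappa>)) * (u powr (p + 1) / (s - \<kappa> + 1)) = 
     (indicator {1..} u * mertens u * u powr (- s - 1)) * (1 / (s - \<kappa> + 1))" for u :: real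
    by (simp add: p_def powr_add[symmetric] mult.assoc)
  have f_int: "has_bochner_integral lborel (f u) ((indicator {1..} u * mertens u * u powr (- s - 1)) * (1 / (s - \<kappa> + 1)))" for u
  proof (cases "u \<ge> 1")
    case True
    show ?thesis unfolding f_def comb[symmetric] by (intro has_bochner_integral_mult_right inner True)
  qed (simp add: f_def has_bochner_integral_zero)
  have f_norm: "(\<integral>x. norm (f u x) \<partial>lborel) = norm (indicator {1..} u * mertens u * u powr (- s - 1)) * (1 / (s - \<kappa> + 1))" for u
  proof (cases "u \<ge> 1")
    case True
    have "norm (f u x) = (indicator {1..} u * \<bar>mertens u\<bar> * u powr (-\<kappa>)) * ((if u \<le> x then 1 else 0) * x powr p)" for x
      by (simp add: f_def abs_mult)
    hence "(\<integral>x. norm (f u x) \<partial>lborel) = (indicator {1..} u * \<bar>mertens u\<bar> * u powr (-\<kappa>)) * (u powr (p + 1) / (s - \<kappa> + 1))"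
      using has_bochner_integral_integral_eq[OF has_bochner_integral_mult_right[OF inner[OF True], of "indicator {1..} u * \<bar>mertens u\<bar> * u powr (-\<kappa>)"]]
      by simp
    also have "\<dots> = (indicator {1..} u * \<bar>mertens u\<bar>) * (u powr (-\<kappa>) * u powr (p + 1)) / (s - \<kappa> + 1)"
      by simp
    also have "u powr (-\<kappa>) * u powr (p + 1) = u powr (- s - 1)"
      by (simp add: p_def powr_add[symmetric])
    finally show ?thesis by (simp add: abs_mult)
  qed (simp add: f_def)
  have int: "integrable (lborel \<Otimes>\<^sub>M lborel) (case_prod f)"
  proof (rule lborel_pair.Fubini_integrable[OF meas])
    show "integrable lborel (\<lambda>u. \<integral>x. norm (case (u, x) of (u, x) \<Rightarrow> f u x) \<partial>lborel)"
      using integrable_mult_left[OF integrable_norm[OF integrable_mertens[OF s]], of "1 / (s - \<kappa> + 1)"]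
      by (simp only: prod.case f_norm)
    show "AE u in lborel. integrable lborel (\<lambda>x. case (u, x) of (u, x) \<Rightarrow> f u x)"
      using integrable.intros[OF f_int] by simp
  qed
  have eq: "(\<integral>u. f u x \<partial>lborel) = indicator {1..} x * mertens_int \<kappa> x * x powr (\<kappa> - 2 - s)" for x
  proof -
    have "(\<integral>u. f u x \<partial>lborel) = (\<integral>u. (indicator {1..} u * mertens u * u powr (-\<kappa>) * indicator {u..} x) * x powr p \<partial>lborel)"
      unfolding f_def ind by (simp add: mult_ac)
    also have "\<dots> = mertens_int \<kappa> x * x powr p" unfolding mertens_int_def by (rule integral_mult_left_zero)
    also have "mertens_int \<kappa> x = indicator {1..} x * mertens_int \<kappa> x"
    proof (cases "x \<ge> 1")
      case False
      have "(\<lambda>u. indicator {1..} u * mertens u * u powr (-\<kappa>) * indicator {u..} x) = (\<lambda>u. 0)"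
        using False by (auto simp: indicator_def)
      hence "mertens_int \<kappa> x = 0" by (simp add: mertens_int_def)
      thus ?thesis by simp
    qed simp
    finally show ?thesis by (simp add: p_def)
  qed
  have "integrable lborel (\<lambda>x. \<integral>u. f u x \<partial>lborel)" by (rule lborel_pair.integrable_snd[OF int])
  moreover have "(\<integral>x. (\<integral>u. f u x \<partial>lborel) \<partial>lborel) = (\<integral>u. (\<integral>x. f u x \<partial>lborel) \<partial>lborel)"
    by (rule lborel_pair.Fubini_integral[OF int])
  moreover have "(\<integral>u. (\<integral>x. f u x \<partial>lborel) \<partial>lborel) = (s - 1) / (s * Re (zeta_reg (of_real s))) / (s - \<kappa> + 1)"
    unfolding has_bochner_integral_integral_eq[OF f_int] integral_mult_left_zero mertens_mellin[OF s] by simp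
  ultimately show ?thesis unfolding eq by (simp add: has_bochner_integral_iff)
qed

section \<open>Oscillation\<close>

lemma integrable_mertens_int:
  "integrable lborel (\<lambda>u. indicator {1..} u * mertens u * u powr (-\<kappa>) * indicator {u..} x)"
proof -
  have "indicator {1..} u * mertens u * u powr (-\<kappa>) * indicator {u..} x = indicator {1..x} u *\<^sub>R (mertens u / u powr \<kappa>)" for u
    by (auto simp: indicator_def powr_minus_divide)
  thus ?thesis using set_integrable_mertens[of x \<kappa>] by (simp add: set_integrable_def)
qed

lemma mertens_int_bounded:
  obtains K where "K \<ge> 0" "\<And>x. x \<le> X \<Longrightarrow> \<bar>mertens_int \<kappa> x\<bar> \<le> K"
proof
  define m where "m = (\<lambda>x u. indicator {1..} u * mertens u * u powr (-\<kappa>) * indicator {u..} x :: real)"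
  have int: "integrable lborel (m x)" for x
    unfolding m_def by (rule integrable_mertens_int)
  show "(\<integral>u. \<bar>m X u\<bar> \<partial>lborel) \<ge> 0" by simp
  fix x assume x: "x \<le> X"
  have "\<bar>mertens_int \<kappa> x\<bar> \<le> (\<integral>u. \<bar>m x u\<bar> \<partial>lborel)"
    using integral_norm_bound[of lborel "m x"] by (simp add: mertens_int_def m_def)
  also have "\<dots> \<le> (\<integral>u. \<bar>m X u\<bar> \<partial>lborel)"
    using int x by (intro integral_mono integrable_abs) (auto simp: m_def indicator_def)
  finally show "\<bar>mertens_int \<kappa> x\<bar> \<le> (\<integral>u. \<bar>m X u\<bar> \<partial>lborel)" .
qed

text \<open>For \<kappa> = 3/2 this is the value of 1/(s zeta(s)) at s = 1/2, where s - \<kappa> + 1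
  vanishes.\<close>

definition mertens_const :: "real \<Rightarrow> real" where
  "mertens_const \<kappa> = (if \<kappa> = 3 / 2 then 2 / Re (zeta (1 / 2)) else 0)"

lemma mertens_const_3_2: "mertens_const (3 / 2) = - 1 / Re (zeta_reg (of_real (1 / 2)))"
proof -
  have "zeta (1 / 2) = - 2 * zeta_reg (of_real (1 / 2))" by (subst zeta_eq) auto
  thus ?thesis by (simp add: mertens_const_def)
qed

lemma continuous_zeta_reg: "Re s > -1 \<Longrightarrow> isCont zeta_reg s"
  using holomorphic_on_imp_continuous_on[OF holomorphic_zeta_reg] open_halfspace_Re_gt[of "-1"]
  by (auto simp: continuous_on_eq_continuous_at)

text \<open>For \<open>Re \<rho> > 1/2\<close> the hypotheses are contradictory. The auxiliary power \<open>x\<^bsup>-3/4\<^esup>\<close> in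
  \<open>\<psi>\<close> makes \<open>\<psi>\<close> non-negative below \<open>X\<close> while its transform is regular for \<open>Re s > 1/4\<close>.\<close>

lemma one_sided_bound:
  fixes \<kappa> \<epsilon> \<tau> X :: real and \<rho> :: complex
  assumes \<kappa>: "\<kappa> \<le> 3 / 2" and \<tau>: "\<tau> = 1 \<or> \<tau> = -1" and \<epsilon>: "\<epsilon> > 0" and X: "X \<ge> 1"
    and bd: "\<And>x. x \<ge> X \<Longrightarrow> \<tau> * (mertens_int \<kappa> x - mertens_const \<kappa>) \<le> \<epsilon> * x powr (3 / 2 - \<kappa>)"
    and \<rho>: "Re \<rho> \<ge> 1 / 2" "zeta_reg \<rho> = 0"
  shows "norm (\<rho> - 1) \<le> \<epsilon> * norm (\<rho> - of_real \<kappa> + 1) * (norm \<rho> * norm (deriv zeta_reg \<rho>))"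
proof -
  define c where "c = mertens_const \<kappa>"
  define F where "F = mertens_int \<kappa>"
  define r where "r = (\<lambda>x. Re (zeta_reg (of_real x)))"
  have r_pos: "r x > 0" if "x > 0" for x unfolding r_def by (rule zeta_reg_pos_real[OF that])
  have r_eq: "zeta_reg (of_real x) = of_real (r x)" if "x > 0" for x
    unfolding r_def using that by (intro zeta_reg_of_real) auto
  have [measurable]: "F \<in> borel_measurable borel" unfolding F_def by measurable
  obtain K where K: "K \<ge> 0" "\<And>x. x \<le> X \<Longrightarrow> \<bar>F x\<bar> \<le> K"
    unfolding F_def using mertens_int_bounded by blast
  \<comment> \<open>For 1 \<le> x \<le> X the power x^(\<kappa>-2) is at most x^(-1/2), which is
    x^(1/4) x^(-3/4) and hence at most X^(1/4) x^(-3/4).\<close>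
  define B where "B = (K + \<bar>c\<bar>) * X powr (1 / 4)"
  have B: "B \<ge> 0" using K by (simp add: B_def)
  define \<psi> where "\<psi> = (\<lambda>x. indicator {1..} x *
     (\<epsilon> * x powr (- 1 / 2) + B * x powr (- 3 / 4) - \<tau> * (F x - c) * x powr (\<kappa> - 2)))"
  \<comment> \<open>Landau's theorem wants a globally nonnegative exponent. Truncating at 1 costs
    nothing because \<psi> vanishes below 1.\<close>
  define g where "g = (\<lambda>x::real. ln (max 1 x))"
  have [measurable]: "\<psi> \<in> borel_measurable borel" "g \<in> borel_measurable borel"
    unfolding \<psi>_def g_def by measurable
  have g_nn: "g x \<ge> 0" for x by (simp add: g_def)
  have \<psi>_nn: "\<psi> x \<ge> 0" for x
  proof (cases "x \<ge> 1")
    case True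
    have "\<tau> * (F x - c) * x powr (\<kappa> - 2) \<le> \<epsilon> * x powr (- 1 / 2) + B * x powr (- 3 / 4)"
    proof (cases "x \<ge> X")
      case True
      have "\<tau> * (F x - c) * x powr (\<kappa> - 2) \<le> \<epsilon> * x powr (3 / 2 - \<kappa>) * x powr (\<kappa> - 2)"
        using bd[OF True] by (intro mult_right_mono) (auto simp: F_def c_def)
      also have "\<dots> = \<epsilon> * x powr (- 1 / 2)" by (simp add: powr_add[symmetric] mult.assoc)
      finally show ?thesis using B by (simp add: add_increasing2)
    next
      case False
      have "\<tau> * (F x - c) \<le> \<bar>F x - c\<bar>" using \<tau> by auto
      also have "\<dots> \<le> K + \<bar>c\<bar>" using K(2)[of x] False by auto
      finally have "\<tau> * (F x - c) * x powr (\<kappa> - 2) \<le> (K + \<bar>c\<bar>) * x powr (\<kappa> - 2)"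
        by (intro mult_right_mono) auto
      also have "x powr (\<kappa> - 2) \<le> x powr (1 / 4 + (- 3 / 4))" using \<kappa> \<open>x \<ge> 1\<close> by (intro powr_mono) auto
      also have "\<dots> = x powr (1 / 4) * x powr (- 3 / 4)" by (rule powr_add)
      also have "\<dots> \<le> X powr (1 / 4) * x powr (- 3 / 4)"
        using False \<open>x \<ge> 1\<close> by (intro mult_right_mono powr_mono2) auto
      finally have "\<tau> * (F x - c) * x powr (\<kappa> - 2) \<le> B * x powr (- 3 / 4)"
        using K(1) by (simp add: B_def mult_left_mono mult.assoc)
      moreover have "\<epsilon> * x powr (- 1 / 2) \<ge> 0" using \<epsilon> by simp
      ultimately show ?thesis by linarith
    qed
    thus ?thesis using True by (simp add: \<psi>_def)
  qed (simp add: \<psi>_def)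
  define h where "h = (\<lambda>s::complex. of_real \<epsilon> / (s - 1 / 2) + of_real B / (s - 1 / 4)
     - of_real \<tau> * (((s - 1) / (s * zeta_reg s) - of_real c) / (s - of_real \<kappa> + 1)))"
  define P where "P = (\<lambda>\<sigma>. \<epsilon> / (\<sigma> - 1 / 2) + B / (\<sigma> - 1 / 4)
     - \<tau> * (((\<sigma> - 1) / (\<sigma> * r \<sigma>) - c) / (\<sigma> - \<kappa> + 1)))"
  have hP: "h (of_real \<sigma>) = of_real (P \<sigma>)" if "\<sigma> > 0" for \<sigma>
    unfolding h_def P_def r_eq[OF that] by simp
  define I where "I = (\<lambda>\<sigma>. \<integral>x. \<psi> x * exp (- \<sigma> * g x) \<partial>lborel)"
  have start: "integrable lborel (\<lambda>x. \<psi> x * exp (- \<sigma> * g x)) \<and> h (of_real \<sigma>) = of_real (I \<sigma>)" if \<sigma>: "\<sigma> > 1" for \<sigma>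
  proof -
    have w: "\<sigma> - \<kappa> + 1 > 0" using \<sigma> \<kappa> by simp
    have pt: "\<psi> x * exp (- \<sigma> * g x) = 
       \<epsilon> * (indicator {1..} x * x powr (- 1 / 2 - \<sigma>)) + B * (indicator {1..} x * x powr (- 3 / 4 - \<sigma>))
       - \<tau> * (indicator {1..} x * F x * x powr (\<kappa> - 2 - \<sigma>) - c * (indicator {1..} x * x powr (\<kappa> - 2 - \<sigma>)))" for x
    proof (cases "x \<ge> 1")
      case True
      have e: "exp (- \<sigma> * g x) = x powr (- \<sigma>)" using True by (simp add: g_def powr_def max_def)
      have s: "x powr (a - \<sigma>) = x powr a * x powr (- \<sigma>)" for a by (simp add: powr_add[symmetric])
      show ?thesis unfolding e s using True by (simp add: \<psi>_def algebra_simps)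
    qed (simp add: \<psi>_def)
    have "has_bochner_integral lborel (\<lambda>x. \<psi> x * exp (- \<sigma> * g x))
       (\<epsilon> * (- 1 / ((- 1 / 2 - \<sigma>) + 1)) + B * (- 1 / ((- 3 / 4 - \<sigma>) + 1))
        - \<tau> * ((\<sigma> - 1) / (\<sigma> * r \<sigma>) / (\<sigma> - \<kappa> + 1) - c * (- 1 / ((\<kappa> - 2 - \<sigma>) + 1))))"
      unfolding pt r_def F_def using \<sigma> w
      by (intro has_bochner_integral_add has_bochner_integral_diff has_bochner_integral_mult_right
            has_bochner_integral_powr_1_inf mertens_int_mellin) auto
    moreover have "- 1 / ((- 1 / 2 - \<sigma>) + 1) = 1 / (\<sigma> - 1 / 2)" "- 1 / ((- 3 / 4 - \<sigma>) + 1) = 1 / (\<sigma> - 1 / 4)"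
      "- 1 / ((\<kappa> - 2 - \<sigma>) + 1) = 1 / (\<sigma> - \<kappa> + 1)"
      using \<sigma> w by (simp_all add: divide_simps)
    ultimately have "has_bochner_integral lborel (\<lambda>x. \<psi> x * exp (- \<sigma> * g x)) (P \<sigma>)"
      by (simp only: P_def diff_divide_distrib times_divide_eq_right mult_1_right)
    thus ?thesis using hP[of \<sigma>] \<sigma> by (auto simp: has_bochner_integral_iff I_def)
  qed
  \<comment> \<open>Possible complex zeros are simply cut out; the real ray survives because
    \<open>zeta_reg\<close> is positive on it.\<close>
  define S where "S = {s. Re s > 1 / 2} \<inter> zeta_reg -` (- {0})"
  have all: "integrable lborel (\<lambda>x. \<psi> x * exp (- \<sigma> * g x)) \<and> h (of_real \<sigma>) = of_real (I \<sigma>)" if \<sigma>: "\<sigma> > 1 / 2" for \<sigma>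
    unfolding I_def
  proof (rule landau_abscissa[where S = S and a = 1 and b = "1 / 2"])
    show "open S" unfolding S_def
      by (intro continuous_open_preimage holomorphic_on_imp_continuous_on
            holomorphic_on_subset[OF holomorphic_zeta_reg] open_halfspace_Re_gt) auto
    show "of_real ` {1 / 2<..} \<subseteq> S"
    proof (rule image_subsetI)
      fix x :: real assume x: "x \<in> {1 / 2<..}"
      hence "r x > 0" by (intro r_pos) auto
      with x show "complex_of_real x \<in> S" by (simp add: S_def r_eq)
    qed
    have nz: "s \<noteq> 0 \<and> zeta_reg s \<noteq> 0 \<and> s - 1 / 2 \<noteq> 0 \<and> s - 1 / 4 \<noteq> 0 \<and> s - of_real \<kappa> + 1 \<noteq> 0"
      if "s \<in> S" for s
    proof -
      have "Re s > 1 / 2" "zeta_reg s \<noteq> 0" using that by (auto simp: S_def)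
      moreover from this have "Re (s - of_real \<kappa> + 1) > 0" using \<kappa> by simp
      ultimately show ?thesis by (force simp: complex_eq_iff)
    qed
    show "h holomorphic_on S" unfolding h_def
    proof (intro holomorphic_intros)
      show "zeta_reg holomorphic_on S"
        by (rule holomorphic_on_subset[OF holomorphic_zeta_reg]) (auto simp: S_def)
    qed (use nz in auto)
  qed (use \<sigma> start g_nn \<psi>_nn in \<open>auto simp: I_def\<close>)
  have IP: "I \<sigma> = P \<sigma>" if "\<sigma> > 1 / 2" for \<sigma>
    using all[OF that] hP[of \<sigma>] that by simp
  define \<Phi> where "\<Phi> = (\<lambda>s. \<integral>x. complex_of_real (\<psi> x) * exp (s * of_real (- g x)) \<partial>lborel)"
  have \<Phi>_hol: "\<Phi> holomorphic_on {s. Re s > 1 / 2}"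
  proof -
    have "\<Phi> holomorphic_on {s. ereal (1 / 2) < ereal (Re s) \<and> ereal (Re s) < \<infinity>}"
      unfolding \<Phi>_def
    proof (rule exp_integral_holomorphic)
      fix \<sigma> assume "ereal (1 / 2) < ereal \<sigma>"
      hence "\<sigma> > 1 / 2" by simp
      thus "integrable lborel (\<lambda>x. norm (complex_of_real (\<psi> x)) * exp (\<sigma> * - g x))"
        using all[of \<sigma>] \<psi>_nn by simp
    qed measurable
    thus ?thesis by simp
  qed
  have \<Phi>_real: "\<Phi> (of_real \<sigma>) = of_real (I \<sigma>)" for \<sigma>
  proof -
    have "complex_of_real (\<psi> x) * exp (of_real \<sigma> * of_real (- g x)) = of_real (\<psi> x * exp (- \<sigma> * g x))" for x
      by (simp flip: exp_of_real)
    thus ?thesis unfolding \<Phi>_def I_def by (simp only: integral_complex_of_real)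
  qed
  \<comment> \<open>Solving the transform formula for s - 1 leaves no division by
    \<open>zeta_reg\<close>, so the identity survives at a zero s with Re s > 1/2, where it reads 0
    = s - 1. Multiplication by \<tau> undoes the sign since \<tau>^2 = 1.\<close>
  have identity: "(of_real \<tau> * (of_real \<epsilon> / (s - 1 / 2) + of_real B / (s - 1 / 4) - \<Phi> s) * (s - of_real \<kappa> + 1) + of_real c)
      * (s * zeta_reg s) = s - 1" if "Re s > 1 / 2" for s
  proof (rule holomorphic_eq_if_eq_on_reals[where S = "{s. Re s > 1 / 2}" and a = 1 and b = 2 and z = s and g = "\<lambda>s. s - 1"
        and f = "\<lambda>s. (of_real \<tau> * (of_real \<epsilon> / (s - 1 / 2) + of_real B / (s - 1 / 4) - \<Phi> s) * (s - of_real \<kappa> + 1) + of_real c)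
      * (s * zeta_reg s)"])
    show "(\<lambda>s. (of_real \<tau> * (of_real \<epsilon> / (s - 1 / 2) + of_real B / (s - 1 / 4) - \<Phi> s) * (s - of_real \<kappa> + 1) + of_real c)
      * (s * zeta_reg s)) holomorphic_on {s. Re s > 1 / 2}"
      by (intro holomorphic_intros \<Phi>_hol holomorphic_on_subset[OF holomorphic_zeta_reg]) (auto simp: complex_eq_iff)
    show "open {s. Re s > 1 / 2}" by (rule open_halfspace_Re_gt)
    show "connected {s. Re s > 1 / 2}" by (intro convex_connected convex_halfspace_Re_gt)
    fix x :: real assume x: "1 < x" "x < 2"
    define N where "N = (x - 1) / (x * r x) - c"
    have w: "x - \<kappa> + 1 > 0" using x \<kappa> by simp
    have "\<epsilon> / (x - 1 / 2) + B / (x - 1 / 4) - P x = \<tau> * (N / (x - \<kappa> + 1))"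
      by (simp add: P_def N_def)
    hence "(\<tau> * (\<epsilon> / (x - 1 / 2) + B / (x - 1 / 4) - P x) * (x - \<kappa> + 1) + c) * (x * r x) = (\<tau> * \<tau> * N + c) * (x * r x)"
      using w by simp
    also have "\<tau> * \<tau> = 1" using \<tau> by auto
    also have "(1 * N + c) * (x * r x) = x - 1" using x r_pos[of x] by (simp add: N_def)
    finally have "complex_of_real ((\<tau> * (\<epsilon> / (x - 1 / 2) + B / (x - 1 / 4) - P x) * (x - \<kappa> + 1) + c) * (x * r x)) = of_real (x - 1)"
      by simp
    thus "(of_real \<tau> * (of_real \<epsilon> / (of_real x - 1 / 2) + of_real B / (of_real x - 1 / 4) - \<Phi> (of_real x)) * (of_real x - of_real \<kappa> + 1) + of_real c)
      * (of_real x * zeta_reg (of_real x)) = of_real x - 1"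
      using x by (simp add: \<Phi>_real IP r_eq)
  qed (use that in \<open>auto intro!: holomorphic_intros\<close>)
  have \<rho>1: "\<rho> \<noteq> 1" using \<rho>(2) by auto
  show ?thesis
  proof (cases "Re \<rho> = 1 / 2")
    case False
    with \<rho>(1) have "Re \<rho> > 1 / 2" by simp
    from identity[OF this] \<rho>1 show ?thesis by (simp add: \<rho>(2))
  next
    case True
    have Im: "Im \<rho> \<noteq> 0"
    proof
      assume "Im \<rho> = 0"
      hence "\<rho> = of_real (1 / 2)" using True by (simp add: complex_eq_iff)
      with \<rho>(2) r_eq[of "1/2"] r_pos[of "1/2"] show False by simp
    qed
    define D where "D = deriv zeta_reg \<rho>"
    define s where "s = (\<lambda>\<delta>::real. \<rho> + of_real \<delta>)"
    define lhs where "lhs = (\<lambda>\<delta>. norm (s \<delta> - 1))"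
    \<comment> \<open>One factor \<delta> is moved from \<open>zeta_reg\<close> into the bracket:
      the difference quotient at \<rho> tends to the derivative, and in the bracket only \<delta>
      P(1/2 + \<delta>), which tends to \<epsilon>, survives.\<close>
    define rhs where "rhs = (\<lambda>\<delta>. ((\<delta> * \<epsilon> / norm (s \<delta> - 1 / 2) + \<delta> * B / norm (s \<delta> - 1 / 4) + \<delta> * P (1 / 2 + \<delta>))
        * norm (s \<delta> - of_real \<kappa> + 1) + \<delta> * \<bar>c\<bar>) * (norm (s \<delta>) * norm (zeta_reg (s \<delta>) / of_real \<delta>)))"
    have le: "lhs \<delta> \<le> rhs \<delta>" if \<delta>: "\<delta> > 0" for \<delta>
    proof -
      have Res: "Re (s \<delta>) = 1 / 2 + \<delta>" using True by (simp add: s_def)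
      have "norm (\<Phi> (s \<delta>)) \<le> (\<integral>x. norm (complex_of_real (\<psi> x) * exp (s \<delta> * of_real (- g x))) \<partial>lborel)"
        unfolding \<Phi>_def by (rule integral_norm_bound)
      also have "(\<lambda>x. norm (complex_of_real (\<psi> x) * exp (s \<delta> * of_real (- g x)))) = (\<lambda>x. \<psi> x * exp (- (1 / 2 + \<delta>) * g x))"
      proof
        fix x
        have "Re (s \<delta> * of_real (- g x)) = - (1 / 2 + \<delta>) * g x" by (simp add: Res algebra_simps)
        thus "norm (complex_of_real (\<psi> x) * exp (s \<delta> * of_real (- g x))) = \<psi> x * exp (- (1 / 2 + \<delta>) * g x)"
          using \<psi>_nn[of x] by (simp only: norm_mult norm_exp_eq_Re norm_of_real abs_of_nonneg)
      qed
      also have "(\<integral>x. \<psi> x * exp (- (1 / 2 + \<delta>) * g x) \<partial>lborel) = P (1 / 2 + \<delta>)"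
        by (rule IP[unfolded I_def]) (use \<delta> in simp)
      finally have \<Phi>_le: "norm (\<Phi> (s \<delta>)) \<le> P (1 / 2 + \<delta>)" .
      have "norm (of_real \<tau> * (of_real \<epsilon> / (s \<delta> - 1 / 2) + of_real B / (s \<delta> - 1 / 4) - \<Phi> (s \<delta>)))
         \<le> \<epsilon> / norm (s \<delta> - 1 / 2) + B / norm (s \<delta> - 1 / 4) + P (1 / 2 + \<delta>)" (is "norm ?L \<le> ?R")
      proof -
        have "norm ?L = norm (of_real \<epsilon> / (s \<delta> - 1 / 2) + of_real B / (s \<delta> - 1 / 4) - \<Phi> (s \<delta>))"
          using \<tau> by (auto simp: norm_mult)
        also have "\<dots> \<le> norm (of_real \<epsilon> / (s \<delta> - 1 / 2)) + norm (of_real B / (s \<delta> - 1 / 4)) + norm (\<Phi> (s \<delta>))"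
          by (meson norm_triangle_ineq4 norm_triangle_ineq order_trans add_right_mono)
        also have "\<dots> \<le> ?R" using \<Phi>_le \<epsilon> B by (simp add: norm_divide)
        finally show ?thesis .
      qed
      hence L: "norm (?L * (s \<delta> - of_real \<kappa> + 1) + of_real c) \<le> ?R * norm (s \<delta> - of_real \<kappa> + 1) + \<bar>c\<bar>"
        using norm_triangle_ineq[of "?L * (s \<delta> - of_real \<kappa> + 1)" "of_real c"]
          mult_right_mono[of "norm ?L" ?R "norm (s \<delta> - of_real \<kappa> + 1)"]
        by (simp add: norm_mult)
      have "s \<delta> - 1 = (?L * (s \<delta> - of_real \<kappa> + 1) + of_real c) * (s \<delta> * zeta_reg (s \<delta>))"
        using identity[of "s \<delta>"] Res \<delta> by simp
      hence "lhs \<delta> = norm (?L * (s \<delta> - of_real \<kappa> + 1) + of_real c) * (norm (s \<delta>) * norm (zeta_reg (s \<delta>)))"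
        by (simp only: lhs_def norm_mult)
      also have "\<dots> \<le> (?R * norm (s \<delta> - of_real \<kappa> + 1) + \<bar>c\<bar>) * (norm (s \<delta>) * norm (zeta_reg (s \<delta>)))"
        using L by (intro mult_right_mono) auto
      also have "\<dots> = (\<delta> * (?R * norm (s \<delta> - of_real \<kappa> + 1) + \<bar>c\<bar>)) * (norm (s \<delta>) * (norm (zeta_reg (s \<delta>)) / \<delta>))"
        using \<delta> by simp
      also have "\<dots> = rhs \<delta>"
        using \<delta> by (simp add: rhs_def norm_divide algebra_simps)
      finally show ?thesis .
    qed
    have s_lim: "(s \<longlongrightarrow> \<rho>) (at_right 0)"
      unfolding s_def by (auto intro!: tendsto_eq_intros)
    have \<delta>_lim: "((\<lambda>\<delta>. \<delta>) \<longlongrightarrow> 0) (at_right (0::real))" by (rule tendsto_ident_at)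
    have "zeta_reg field_differentiable (at \<rho>)"
      by (rule holomorphic_on_imp_differentiable_at[OF holomorphic_zeta_reg])
         (use \<rho>(1) in \<open>auto simp: open_halfspace_Re_gt\<close>)
    hence "(zeta_reg has_field_derivative D) (at \<rho>)"
      unfolding D_def by (simp add: field_differentiable_derivI)
    hence "((\<lambda>h. (zeta_reg (\<rho> + h) - zeta_reg \<rho>) / h) \<longlongrightarrow> D) (at 0)"
      by (simp add: DERIV_def)
    moreover have "filterlim complex_of_real (at 0) (at_right 0)"
      by (auto simp: filterlim_at eventually_at_filter intro!: tendsto_eq_intros)
    ultimately have "((\<lambda>\<delta>. (zeta_reg (\<rho> + of_real \<delta>) - zeta_reg \<rho>) / of_real \<delta>) \<longlongrightarrow> D) (at_right 0)"
      by (rule filterlim_compose)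
    hence z_lim: "((\<lambda>\<delta>. zeta_reg (s \<delta>) / of_real \<delta>) \<longlongrightarrow> D) (at_right 0)"
      by (simp add: \<rho>(2) s_def)
    have r_lim: "((\<lambda>\<delta>. r (1 / 2 + \<delta>)) \<longlongrightarrow> r (1 / 2)) (at_right 0)"
    proof -
      have "((\<lambda>\<delta>. of_real (1 / 2 + \<delta>)) \<longlongrightarrow> complex_of_real (1 / 2 + 0)) (at_right 0)"
        by (intro tendsto_intros)
      hence "((\<lambda>\<delta>. zeta_reg (of_real (1 / 2 + \<delta>))) \<longlongrightarrow> zeta_reg (of_real (1 / 2))) (at_right 0)"
        by (intro isCont_tendsto_compose[OF continuous_zeta_reg]) auto
      thus ?thesis unfolding r_def by (rule tendsto_Re)
    qed
    define N where "N = (\<lambda>\<delta>. (\<delta> - 1 / 2) / ((1 / 2 + \<delta>) * r (1 / 2 + \<delta>)) - c)"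
    have N_lim: "(N \<longlongrightarrow> (0 - 1 / 2) / ((1 / 2 + 0) * r (1 / 2)) - c) (at_right 0)"
      unfolding N_def using r_pos[of "1/2"] by (intro tendsto_intros r_lim) auto
    \<comment> \<open>If \<kappa> < 3/2 the quotient tends to 0. If \<kappa> = 3/2 it is identically
      1, and N tends to 0 by the choice of c.\<close>
    have NN: "((\<lambda>\<delta>. N \<delta> * (\<delta> / (\<delta> + 3 / 2 - \<kappa>))) \<longlongrightarrow> 0) (at_right 0)"
    proof (cases "\<kappa> = 3 / 2")
      case True
      have "c = - 1 / r (1 / 2)" unfolding c_def r_def True by (rule mertens_const_3_2)
      hence "(N \<longlongrightarrow> 0) (at_right 0)" using N_lim by (simp add: field_simps)
      moreover have "eventually (\<lambda>\<delta>. N \<delta> = N \<delta> * (\<delta> / (\<delta> + 3 / 2 - \<kappa>))) (at_right 0)"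
        using eventually_at_right_less[of "0::real"] by eventually_elim (simp add: True)
      ultimately show ?thesis by (rule Lim_transform_eventually)
    next
      case False
      have "((\<lambda>\<delta>. N \<delta> * (\<delta> / (\<delta> + 3 / 2 - \<kappa>))) \<longlongrightarrow> ((0 - 1 / 2) / ((1 / 2 + 0) * r (1 / 2)) - c) * (0 / (0 + 3 / 2 - \<kappa>))) (at_right 0)"
        using False by (intro tendsto_intros N_lim) auto
      thus ?thesis by simp
    qed
    have P_lim: "((\<lambda>\<delta>. \<delta> * P (1 / 2 + \<delta>)) \<longlongrightarrow> \<epsilon>) (at_right 0)"
    proof -
      have "((\<lambda>\<delta>. \<epsilon> + \<delta> * B / (\<delta> + 1 / 4) - \<tau> * (N \<delta> * (\<delta> / (\<delta> + 3 / 2 - \<kappa>)))) \<longlongrightarrow> \<epsilon> + 0 * B / (0 + 1 / 4) - \<tau> * 0) (at_right 0)"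
        by (intro tendsto_intros NN) auto
      hence "((\<lambda>\<delta>. \<epsilon> + \<delta> * B / (\<delta> + 1 / 4) - \<tau> * (N \<delta> * (\<delta> / (\<delta> + 3 / 2 - \<kappa>)))) \<longlongrightarrow> \<epsilon>) (at_right 0)" by simp
      moreover have "eventually (\<lambda>\<delta>. \<epsilon> + \<delta> * B / (\<delta> + 1 / 4) - \<tau> * (N \<delta> * (\<delta> / (\<delta> + 3 / 2 - \<kappa>))) = \<delta> * P (1 / 2 + \<delta>)) (at_right 0)"
        using eventually_at_right_less[of "0::real"]
      proof eventually_elim
        case (elim \<delta>)
        have "1 / 2 + \<delta> - 1 / 2 = \<delta>" "1 / 2 + \<delta> - 1 / 4 = \<delta> + 1 / 4" "1 / 2 + \<delta> - 1 = \<delta> - 1 / 2"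
          "1 / 2 + \<delta> - \<kappa> + 1 = \<delta> + 3 / 2 - \<kappa>" by simp_all
        hence "P (1 / 2 + \<delta>) = \<epsilon> / \<delta> + B / (\<delta> + 1 / 4) - \<tau> * (N \<delta> / (\<delta> + 3 / 2 - \<kappa>))"
          by (simp only: P_def N_def)
        thus ?case using elim by (simp add: distrib_left right_diff_distrib mult_ac)
      qed
      ultimately show ?thesis by (rule Lim_transform_eventually)
    qed
    have ne: "\<rho> - 1 / 2 \<noteq> 0" "\<rho> - 1 / 4 \<noteq> 0" using Im by (auto simp: complex_eq_iff)
    have lhs_lim: "(lhs \<longlongrightarrow> norm (\<rho> - 1)) (at_right 0)"
      unfolding lhs_def by (intro tendsto_intros s_lim)
    have "(rhs \<longlongrightarrow> ((0 * \<epsilon> / norm (\<rho> - 1 / 2) + 0 * B / norm (\<rho> - 1 / 4) + \<epsilon>) * norm (\<rho> - of_real \<kappa> + 1) + 0 * \<bar>c\<bar>)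
        * (norm \<rho> * norm D)) (at_right 0)"
      unfolding rhs_def using ne by (intro tendsto_intros s_lim \<delta>_lim P_lim z_lim) auto
    hence rhs_lim: "(rhs \<longlongrightarrow> \<epsilon> * norm (\<rho> - of_real \<kappa> + 1) * (norm \<rho> * norm D)) (at_right 0)" by simp
    have "eventually (\<lambda>\<delta>. lhs \<delta> \<le> rhs \<delta>) (at_right 0)"
      using eventually_at_right_less[of "0::real"] by eventually_elim (rule le)
    from tendsto_le[OF _ rhs_lim lhs_lim this] show ?thesis by (simp add: D_def)
  qed
qed

lemma not_eventually_small:
  assumes "\<kappa> \<le> 3 / 2" "\<tau> = 1 \<or> \<tau> = (-1::real)"
  shows "\<exists>\<epsilon>>0. \<not> eventually (\<lambda>x. \<tau> * (mertens_int \<kappa> x - mertens_const \<kappa>) \<le> \<epsilon> * x powr (3 / 2 - \<kappa>)) at_top"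
proof -
  obtain \<rho> where \<rho>: "Re \<rho> \<ge> 1 / 2" "zeta_reg \<rho> = 0" by (rule zeta_reg_has_zero)
  define K where "K = norm (\<rho> - of_real \<kappa> + 1) * (norm \<rho> * norm (deriv zeta_reg \<rho>))"
  have K: "K \<ge> 0" by (simp add: K_def)
  have pos: "norm (\<rho> - 1) > 0" using \<rho>(2) by auto
  \<comment> \<open>K vanishes if \<rho> is a multiple zero, hence the denominator K + 1; any
    \<epsilon> with \<epsilon> K < |\<rho> - 1| contradicts \<open>one_sided_bound\<close>.\<close>
  define \<epsilon> where "\<epsilon> = norm (\<rho> - 1) / (K + 1)"
  have \<epsilon>: "\<epsilon> > 0" using pos K by (simp add: \<epsilon>_def)
  have "\<epsilon> * K < \<epsilon> * (K + 1)" using \<epsilon> by simp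
  also have "\<dots> = norm (\<rho> - 1)" using K by (simp add: \<epsilon>_def)
  finally have less: "\<epsilon> * K < norm (\<rho> - 1)" .
  show ?thesis
  proof (intro exI[of _ \<epsilon>] conjI \<epsilon> notI)
    assume "eventually (\<lambda>x. \<tau> * (mertens_int \<kappa> x - mertens_const \<kappa>) \<le> \<epsilon> * x powr (3 / 2 - \<kappa>)) at_top"
    then obtain X where X: "\<And>x. x \<ge> X \<Longrightarrow> \<tau> * (mertens_int \<kappa> x - mertens_const \<kappa>) \<le> \<epsilon> * x powr (3 / 2 - \<kappa>)"
      by (auto simp: eventually_at_top_linorder)
    have "norm (\<rho> - 1) \<le> \<epsilon> * norm (\<rho> - of_real \<kappa> + 1) * (norm \<rho> * norm (deriv zeta_reg \<rho>))"
      by (rule one_sided_bound[OF assms \<epsilon>, of "max 1 X"]) (use X \<rho> in auto)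
    with less show False by (simp add: K_def mult.assoc)
  qed
qed

lemma omega_pm_mertens_int:
  assumes "\<kappa> \<le> 3 / 2"
  shows "omega_pm (\<lambda>x. mertens_int \<kappa> x - mertens_const \<kappa>) (\<lambda>x. x powr (3 / 2 - \<kappa>))"
proof -
  define f where "f = (\<lambda>x. mertens_int \<kappa> x - mertens_const \<kappa>)"
  have pos: "eventually (\<lambda>x::real. x powr (3 / 2 - \<kappa>) > 0) at_top"
    using eventually_gt_at_top[of 0] by eventually_elim simp
  have "Limsup at_top (\<lambda>x. ereal (f x / x powr (3 / 2 - \<kappa>))) > 0"
  proof (rule ccontr)
    assume "\<not> ?thesis"
    obtain \<epsilon> where \<epsilon>: "\<epsilon> > 0" "\<not> eventually (\<lambda>x. 1 * f x \<le> \<epsilon> * x powr (3 / 2 - \<kappa>)) at_top"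
      using not_eventually_small[OF assms, of 1] by (auto simp: f_def)
    from \<open>\<not> ?thesis\<close> have "Limsup at_top (\<lambda>x. ereal (f x / x powr (3 / 2 - \<kappa>))) \<le> 0" by (simp add: not_less)
    also have "0 < ereal \<epsilon>" using \<epsilon>(1) by simp
    finally have "eventually (\<lambda>x. ereal (f x / x powr (3 / 2 - \<kappa>)) < ereal \<epsilon>) at_top"
      by (rule Limsup_lessD)
    with pos have "eventually (\<lambda>x. 1 * f x \<le> \<epsilon> * x powr (3 / 2 - \<kappa>)) at_top"
      by eventually_elim (auto simp: divide_simps)
    with \<epsilon>(2) show False by simp
  qed
  moreover have "Liminf at_top (\<lambda>x. ereal (f x / x powr (3 / 2 - \<kappa>))) < 0"
  proof (rule ccontr)
    assume "\<not> ?thesis"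
    obtain \<epsilon> where \<epsilon>: "\<epsilon> > 0" "\<not> eventually (\<lambda>x. (-1) * f x \<le> \<epsilon> * x powr (3 / 2 - \<kappa>)) at_top"
      using not_eventually_small[OF assms, of "-1"] by (auto simp: f_def)
    have "ereal (- \<epsilon>) < 0" using \<epsilon>(1) by simp
    also from \<open>\<not> ?thesis\<close> have "0 \<le> Liminf at_top (\<lambda>x. ereal (f x / x powr (3 / 2 - \<kappa>)))" by (simp add: not_less)
    finally have "eventually (\<lambda>x. ereal (- \<epsilon>) < ereal (f x / x powr (3 / 2 - \<kappa>))) at_top"
      by (rule less_LiminfD)
    with pos have "eventually (\<lambda>x. (-1) * f x \<le> \<epsilon> * x powr (3 / 2 - \<kappa>)) at_top"
      by eventually_elim (auto simp: divide_simps)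
    with \<epsilon>(2) show False by simp
  qed
  ultimately show ?thesis using pos by (simp add: omega_pm_def f_def)
qed

text \<open>Were the integral finite, dominated convergence would give
  \<open>mertens_int (3 / 2)\<close> a limit. For \<kappa> = 3/2 the comparison function is the
  constant 1, so limsup and liminf would coincide, whereas \<open>omega_pm\<close> makes one
  positive and the other negative.\<close>

lemma nn_integral_abs_mertens_infinite:
  "(\<integral>\<^sup>+x\<in>{1..}. ennreal (\<bar>mertens x\<bar> / x powr (3 / 2)) \<partial>lborel) = \<infinity>"
proof (rule ccontr)
  define m where "m = (\<lambda>u. indicator {1..} u * mertens u * u powr (- (3 / 2)) :: real)"
  assume "\<not> ?thesis"
  moreover have "(\<integral>\<^sup>+x\<in>{1..}. ennreal (\<bar>mertens x\<bar> / x powr (3 / 2)) \<partial>lborel) = (\<integral>\<^sup>+x. ennreal (norm (m x)) \<partial>lborel)"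
    by (intro nn_integral_cong) (auto simp: m_def indicator_def abs_mult powr_minus_divide)
  ultimately have int: "integrable lborel m"
    by (intro integrableI_bounded) (auto simp: m_def less_top)
  have lim: "(mertens_int (3 / 2) \<longlongrightarrow> (\<integral>u. m u \<partial>lborel)) at_top"
  proof -
    have "((\<lambda>x. \<integral>u. m u * indicator {u..} x \<partial>lborel) \<longlongrightarrow> (\<integral>u. m u \<partial>lborel)) at_top"
    proof (rule integral_dominated_convergence_at_top[where w = "\<lambda>u. norm (m u)"])
      show "m \<in> borel_measurable lborel" using int by auto
      show "(\<lambda>u. m u * indicator {u..} x) \<in> borel_measurable lborel" for x
        using borel_measurable_integrable[OF integrable_mertens_int[of "3 / 2" x]] by (simp add: m_def)
      show "AE u in lborel. ((\<lambda>x. m u * indicator {u..} x) \<longlongrightarrow> m u) at_top"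
      proof (intro AE_I2 tendsto_eventually)
        show "eventually (\<lambda>x. m u * indicator {u..} x = m u) at_top" for u
          using eventually_ge_at_top[of u] by eventually_elim simp
      qed
    qed (use int in \<open>auto simp: indicator_def\<close>)
    thus ?thesis unfolding mertens_int_def m_def .
  qed
  define L where "L = (\<integral>u. m u \<partial>lborel) - mertens_const (3 / 2)"
  have "((\<lambda>x. mertens_int (3 / 2) x - mertens_const (3 / 2)) \<longlongrightarrow> L) at_top"
    unfolding L_def by (intro tendsto_intros lim)
  moreover have "eventually (\<lambda>x. mertens_int (3 / 2) x - mertens_const (3 / 2) = 
      (mertens_int (3 / 2) x - mertens_const (3 / 2)) / x powr (3 / 2 - 3 / 2)) at_top"
    using eventually_gt_at_top[of "0::real"] by eventually_elim simp
  ultimately have "((\<lambda>x. (mertens_int (3 / 2) x - mertens_const (3 / 2)) / x powr (3 / 2 - 3 / 2)) \<longlongrightarrow> L) at_top"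
    by (rule Lim_transform_eventually)
  hence "((\<lambda>x. ereal ((mertens_int (3 / 2) x - mertens_const (3 / 2)) / x powr (3 / 2 - 3 / 2))) \<longlongrightarrow> ereal L) at_top"
    by (simp only: lim_ereal)
  from lim_imp_Limsup[OF _ this] lim_imp_Liminf[OF _ this] omega_pm_mertens_int[of "3 / 2"]
  show False unfolding omega_pm_def by auto
qed

theorem theorem4:
  shows "(\<forall>\<kappa>::real. \<kappa> \<le> 3 / 2 \<longrightarrow>
            omega_pm
              (\<lambda>x. integral {1..x} (\<lambda>u. mertens u / u powr \<kappa>)
                     - (if \<kappa> = 3 / 2 then 2 / Re (zeta (1 / 2)) else 0))
              (\<lambda>x. x powr (3 / 2 - \<kappa>)))
       \<and> (\<integral>\<^sup>+x\<in>{1..}. ennreal (\<bar>mertens x\<bar> / x powr (3 / 2)) \<partial>lborel) = \<infinity>"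
  using omega_pm_mertens_int nn_integral_abs_mertens_infinite
  unfolding mertens_int_eq mertens_const_def by blast

end
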